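(* Let $X$ and $Y$ be the subproduct systems associated with monomial ideals $\mathcal I$ of $\mathbb C\langle x_1,\dots,x_d\rangle$ and $\mathcal J$ of $\mathbb C\langle y_1,\dots,y_{d'}\rangle$, and suppose that $x_i\notin\mathcal I$ and $y_j\notin\mathcal J$ for all $i,j$. The following are equivalent: (i) $\mathcal A_X$ and $\mathcal A_Y$ are completely isometrically isomorphic; (ii) $\mathcal A_X$ and $\mathcal A_Y$ are algebraically isomorphic; (iii) $\mathbb C\langle x_1,\dots,x_d\rangle/\mathcal I$ and $\mathbb C\langle y_1,\dots,y_{d'}\rangle/\mathcal J$ are algebraically isomorphic by a graded isomorphism; (iv) $X$ and $Y$ are similar; (v) $X$ and $Y$ are isomorphic; (vi) $d=d'$ and there is a permutation on the variables $y_1,\dots,y_d$ such that $\mathcal I$ and $\mathcal J$ are defined by the same words.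
   Context: $\mathbb C\langle x_1,\dots,x_d\rangle$ is the ring of polynomials in noncommuting variables, graded by degree; a monomial ideal is a two-sided ideal generated by monomials. For a word $\mu=\mu_1\cdots\mu_n$ in $\{1,\dots,d\}$ put $x^\mu=x_{\mu_1}\cdots x_{\mu_n}$ and $e_\mu=e_{\mu_1}\otimes\cdots\otimes e_{\mu_n}\in(\mathbb C^d)^{\otimes n}$, with $\{e_i\}$ the standard orthonormal basis. The subproduct system associated with $\mathcal I$ is $X=(X(n),p_n)_{n\ge0}$, where $X(n)=\mathrm{span}\{e_\mu:|\mu|=n,\ x^\mu\notin\mathcal I\}$ and $p_n$ is the orthogonal projection of $(\mathbb C^d)^{\otimes n}$ onto $X(n)$. $\mathcal F_X=\bigoplus_{n\ge0}X(n)$, and $T_i\in B(\mathcal F_X)$ is given by $T_ie_\nu=e_{i\nu}$ if $x^{i\nu}\notin\mathcal I$ and $T_ie_\nu=0$ otherwise. The tensor algebra $\mathcal A_X$ is the norm-closed algebra generated by $I,T_1,\dots,T_d$. Similarly for $\mathcal J$ and $Y=(Y(n),q_n)$. $X$ and $Y$ are similar if there are invertible linear maps $V_n:X(n)\to Y(n)$, $n\ge0$, with $\sup_n\|V_n\|<\infty$, $\sup_n\|V_n^{-1}\|<\infty$ and $V_{m+n}(p_{m+n}(\xi\otimes\eta))=q_{m+n}(V_m\xi\otimes V_n\eta)$ for all $m,n$, $\xi\in X(m)$, $\eta\in X(n)$; they are isomorphic if such $V_n$ can be chosen unitary. A graded isomorphism is an algebra isomorphism mapping the degree-$n$ component onto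 the degree-$n$ component for all $n$. Condition (vi) means that some bijection $x_i\mapsto y_{\pi(i)}$ of the variables carries $\mathcal I$ onto $\mathcal J$. *)

theory Defs
  imports
    "HOL-Analysis.Infinite_Sum"
    "HOL-Library.Extended_Nonnegative_Real"
    "HOL-Library.FuncSet"
    "HOL-Algebra.Ideal"
    "HOL-Algebra.QuotRing"
    "HOL-Algebra.Module"
    "HOL-Combinatorics.Permutations"
begin

section \<open>Noncommutative polynomials and monomial ideals\<close>

text \<open>
  The letters are numbered from 0, so a word in \<open>d\<close> letters is a list over \<open>{..<d}\<close>.
  A noncommutative polynomial is its coefficient function: finitely supported,
  and supported on such words.
\<close>

definition words :: "nat \<Rightarrow> nat list set" where
  "words d = lists {..<d}"

definition monom_word :: "nat list \<Rightarrow> nat list \<Rightarrow> complex" where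
  "monom_word \<mu> = (\<lambda>w. if w = \<mu> then 1 else 0)"

definition nc_mult :: "(nat list \<Rightarrow> complex) \<Rightarrow> (nat list \<Rightarrow> complex) \<Rightarrow> nat list \<Rightarrow> complex" where
  "nc_mult f g = (\<lambda>w. \<Sum>k\<le>length w. f (take k w) * g (drop k w))"

definition nc_poly :: "nat \<Rightarrow> (complex, nat list \<Rightarrow> complex) module" where
  "nc_poly d =
    \<lparr>carrier = {f. finite {w. f w \<noteq> 0} \<and> {w. f w \<noteq> 0} \<subseteq> words d},
     mult = nc_mult,
     one = monom_word [],
     zero = (\<lambda>w. 0),
     add = (\<lambda>f g w. f w + g w),
     smult = (\<lambda>c f w. c * f w)\<rparr>"

text \<open>\<^const>\<open>genideal\<close> is the two-sided ideal generated by a set.\<close>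

definition monomial_ideal :: "nat \<Rightarrow> (nat list \<Rightarrow> complex) set \<Rightarrow> bool" where
  "monomial_ideal d I \<longleftrightarrow>
    (\<exists>S\<subseteq>words d. I = genideal (nc_poly d) (monom_word ` S))"

text \<open>The scalar action on cosets follows the pattern of \<^const>\<open>rcoset_mult\<close>.\<close>

definition nc_quot :: "nat \<Rightarrow> (nat list \<Rightarrow> complex) set \<Rightarrow> (complex, (nat list \<Rightarrow> complex) set) module" where
  "nc_quot d I = ring.extend (nc_poly d Quot I)
     (module.fields (\<lambda>c C. \<Union>f\<in>C. I +>\<^bsub>nc_poly d\<^esub> (c \<odot>\<^bsub>nc_poly d\<^esub> f)))"

definition quot_component :: "nat \<Rightarrow> (nat list \<Rightarrow> complex) set \<Rightarrow> nat \<Rightarrow> (nat list \<Rightarrow> complex) set set" where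
  "quot_component d I n =
    {I +>\<^bsub>nc_poly d\<^esub> f | f. f \<in> carrier (nc_poly d) \<and> (\<forall>w. f w \<noteq> 0 \<longrightarrow> length w = n)}"

text \<open>For a permutation \<open>\<pi>\<close>, this is the substitution of variables sending the
  monomial of \<open>\<mu>\<close> to that of \<open>map \<pi> \<mu>\<close>; see \<open>subst_vars_monom_word\<close> below.\<close>

definition subst_vars :: "(nat \<Rightarrow> nat) \<Rightarrow> (nat list \<Rightarrow> complex) \<Rightarrow> nat list \<Rightarrow> complex" where
  "subst_vars \<pi> f = (\<lambda>w. f (map (inv_into UNIV \<pi>) w))"

text \<open>Members of \<open>ring_iso\<close> are unital ring homomorphisms by definition.\<close>

definition alg_iso :: "(complex, 'a, 'm) module_scheme \<Rightarrow> (complex, 'b, 'n) module_scheme \<Rightarrow> ('a \<Rightarrow> 'b) set" where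
  "alg_iso A B = {\<phi> \<in> ring_iso A B. \<forall>c. \<forall>a\<in>carrier A. \<phi> (c \<odot>\<^bsub>A\<^esub> a) = c \<odot>\<^bsub>B\<^esub> \<phi> a}"

definition graded_quot_iso :: "nat \<Rightarrow> (nat list \<Rightarrow> complex) set \<Rightarrow> nat \<Rightarrow> (nat list \<Rightarrow> complex) set
    \<Rightarrow> ((nat list \<Rightarrow> complex) set \<Rightarrow> (nat list \<Rightarrow> complex) set) set" where
  "graded_quot_iso d I d' J =
    {\<phi> \<in> alg_iso (nc_quot d I) (nc_quot d' J).
       \<forall>n. \<phi> ` quot_component d I n = quot_component d' J n}"


section \<open>Square-summable families\<close>

text \<open>
  All Hilbert spaces below are subspaces of the square-summable functions on words:
  the \<open>n\<close>-fold tensor power of \<open>\<complex>\<^sup>d\<close> is the space of functions supported on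
  words of length \<open>n\<close> over \<open>{..<d}\<close>, and the orthonormal basis vector belonging to
  a word is its indicator function.
\<close>

definition ell2 :: "(nat list \<Rightarrow> complex) set" where
  "ell2 = {\<xi>. (\<lambda>w. (cmod (\<xi> w))\<^sup>2) summable_on UNIV}"

definition l2_norm :: "(nat list \<Rightarrow> complex) \<Rightarrow> real" where
  "l2_norm \<xi> = sqrt (\<Sum>\<^sub>\<infinity>w. (cmod (\<xi> w))\<^sup>2)"

definition l2_inner :: "(nat list \<Rightarrow> complex) \<Rightarrow> (nat list \<Rightarrow> complex) \<Rightarrow> complex" where
  "l2_inner \<xi> \<eta> = (\<Sum>\<^sub>\<infinity>w. \<xi> w * cnj (\<eta> w))"

definition basis_vec :: "nat list \<Rightarrow> nat list \<Rightarrow> complex" where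
  "basis_vec \<mu> = (\<lambda>w. if w = \<mu> then 1 else 0)"

text \<open>The tensor product of a vector of the \<open>m\<close>-fold with one of an \<open>n\<close>-fold tensor power;
  concatenating basis words gives the basis word of the product.\<close>

definition tensor :: "nat \<Rightarrow> (nat list \<Rightarrow> complex) \<Rightarrow> (nat list \<Rightarrow> complex) \<Rightarrow> nat list \<Rightarrow> complex" where
  "tensor m \<xi> \<eta> = (\<lambda>w. \<xi> (take m w) * \<eta> (drop m w))"

definition orth_proj :: "(nat list \<Rightarrow> complex) set \<Rightarrow> (nat list \<Rightarrow> complex) \<Rightarrow> nat list \<Rightarrow> complex" where
  "orth_proj M \<xi> = (THE \<eta>. \<eta> \<in> M \<and> (\<forall>\<zeta>\<in>M. l2_inner (\<lambda>w. \<xi> w - \<eta> w) \<zeta> = 0))"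

definition linear_map_on :: "(nat list \<Rightarrow> complex) set \<Rightarrow> ((nat list \<Rightarrow> complex) \<Rightarrow> nat list \<Rightarrow> complex) \<Rightarrow> bool" where
  "linear_map_on H T \<longleftrightarrow>
    (\<forall>\<xi>\<in>H. \<forall>\<eta>\<in>H. T (\<lambda>w. \<xi> w + \<eta> w) = (\<lambda>w. T \<xi> w + T \<eta> w)) \<and>
    (\<forall>c. \<forall>\<xi>\<in>H. T (\<lambda>w. c * \<xi> w) = (\<lambda>w. c * T \<xi> w))"

definition op_norm :: "(nat list \<Rightarrow> complex) set \<Rightarrow> ((nat list \<Rightarrow> complex) \<Rightarrow> nat list \<Rightarrow> complex) \<Rightarrow> ennreal" where
  "op_norm H T = (SUP \<xi>\<in>{\<xi>\<in>H. l2_norm \<xi> \<le> 1}. ennreal (l2_norm (T \<xi>)))"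

text \<open>Norm of an \<open>n \<times> n\<close> matrix of operators on \<open>H\<close>, acting on the Hilbert space \<open>H\<^sup>n\<close>.\<close>

definition mat_op_norm :: "(nat list \<Rightarrow> complex) set \<Rightarrow> nat
    \<Rightarrow> (nat \<Rightarrow> nat \<Rightarrow> (nat list \<Rightarrow> complex) \<Rightarrow> nat list \<Rightarrow> complex) \<Rightarrow> ennreal" where
  "mat_op_norm H n a =
    (SUP \<xi>\<in>{\<xi>. (\<forall>j<n. \<xi> j \<in> H) \<and> (\<Sum>j<n. (l2_norm (\<xi> j))\<^sup>2) \<le> 1}.
       ennreal (sqrt (\<Sum>i<n. (l2_norm (\<lambda>w. \<Sum>j<n. a i j (\<xi> j) w))\<^sup>2)))"

text \<open>Operators on \<open>H\<close> are extensional functions, so that equality of operators is equality on \<open>H\<close>.\<close>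

definition bounded_ops :: "(nat list \<Rightarrow> complex) set
    \<Rightarrow> (complex, (nat list \<Rightarrow> complex) \<Rightarrow> nat list \<Rightarrow> complex) module" where
  "bounded_ops H =
    \<lparr>carrier = {T \<in> H \<rightarrow>\<^sub>E H. linear_map_on H T \<and> op_norm H T < \<infinity>},
     mult = (\<lambda>S T. compose H S T),
     one = (\<lambda>\<xi>\<in>H. \<xi>),
     zero = (\<lambda>\<xi>\<in>H. (\<lambda>w. 0)),
     add = (\<lambda>S T. \<lambda>\<xi>\<in>H. (\<lambda>w. S \<xi> w + T \<xi> w)),
     smult = (\<lambda>c T. \<lambda>\<xi>\<in>H. (\<lambda>w. c * T \<xi> w))\<rparr>"

definition closed_subalgebra :: "(nat list \<Rightarrow> complex) set
    \<Rightarrow> ((nat list \<Rightarrow> complex) \<Rightarrow> nat list \<Rightarrow> complex) set \<Rightarrow> bool" where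
  "closed_subalgebra H A \<longleftrightarrow>
    A \<subseteq> carrier (bounded_ops H) \<and>
    \<one>\<^bsub>bounded_ops H\<^esub> \<in> A \<and>
    (\<forall>S\<in>A. \<forall>T\<in>A. S \<oplus>\<^bsub>bounded_ops H\<^esub> T \<in> A \<and> S \<otimes>\<^bsub>bounded_ops H\<^esub> T \<in> A) \<and>
    (\<forall>c. \<forall>T\<in>A. c \<odot>\<^bsub>bounded_ops H\<^esub> T \<in> A) \<and>
    (\<forall>S\<in>carrier (bounded_ops H).
       (\<forall>\<epsilon>>0. \<exists>T\<in>A. op_norm H (\<lambda>\<xi> w. S \<xi> w - T \<xi> w) < ennreal \<epsilon>) \<longrightarrow> S \<in> A)"


section \<open>Subproduct systems and tensor algebras of monomial ideals\<close>

definition allowable :: "nat \<Rightarrow> (nat list \<Rightarrow> complex) set \<Rightarrow> nat list set" where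
  "allowable d I = {\<mu> \<in> words d. monom_word \<mu> \<notin> I}"

definition sps :: "nat \<Rightarrow> (nat list \<Rightarrow> complex) set \<Rightarrow> nat \<Rightarrow> (nat list \<Rightarrow> complex) set" where
  "sps d I n = {(\<lambda>w. \<Sum>\<mu>\<in>{\<mu>\<in>allowable d I. length \<mu> = n}. c \<mu> * basis_vec \<mu> w) | c. True}"

definition sps_proj :: "nat \<Rightarrow> (nat list \<Rightarrow> complex) set \<Rightarrow> nat \<Rightarrow> (nat list \<Rightarrow> complex) \<Rightarrow> nat list \<Rightarrow> complex" where
  "sps_proj d I n = orth_proj (sps d I n)"

definition sps_similarity :: "nat \<Rightarrow> (nat list \<Rightarrow> complex) set \<Rightarrow> nat \<Rightarrow> (nat list \<Rightarrow> complex) set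
    \<Rightarrow> (nat \<Rightarrow> (nat list \<Rightarrow> complex) \<Rightarrow> nat list \<Rightarrow> complex) \<Rightarrow> bool" where
  "sps_similarity d I d' J V \<longleftrightarrow>
    (\<forall>n. linear_map_on (sps d I n) (V n) \<and> bij_betw (V n) (sps d I n) (sps d' J n)) \<and>
    (SUP n. op_norm (sps d I n) (V n)) < \<infinity> \<and>
    (SUP n. op_norm (sps d' J n) (inv_into (sps d I n) (V n))) < \<infinity> \<and>
    (\<forall>m n. \<forall>\<xi>\<in>sps d I m. \<forall>\<eta>\<in>sps d I n.
       V (m + n) (sps_proj d I (m + n) (tensor m \<xi> \<eta>)) =
       sps_proj d' J (m + n) (tensor m (V m \<xi>) (V n \<eta>)))"

definition sps_similar :: "nat \<Rightarrow> (nat list \<Rightarrow> complex) set \<Rightarrow> nat \<Rightarrow> (nat list \<Rightarrow> complex) set \<Rightarrow> bool" where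
  "sps_similar d I d' J \<longleftrightarrow> (\<exists>V. sps_similarity d I d' J V)"

definition sps_isomorphic :: "nat \<Rightarrow> (nat list \<Rightarrow> complex) set \<Rightarrow> nat \<Rightarrow> (nat list \<Rightarrow> complex) set \<Rightarrow> bool" where
  "sps_isomorphic d I d' J \<longleftrightarrow>
    (\<exists>V. sps_similarity d I d' J V \<and>
      (\<forall>n. \<forall>\<xi>\<in>sps d I n. \<forall>\<eta>\<in>sps d I n. l2_inner (V n \<xi>) (V n \<eta>) = l2_inner \<xi> \<eta>))"

text \<open>The Hilbert space direct sum of the \<^term>\<open>sps d I n\<close>: square-summable
  vectors whose degree-\<open>n\<close> parts lie in \<^term>\<open>sps d I n\<close>.\<close>

definition fock :: "nat \<Rightarrow> (nat list \<Rightarrow> complex) set \<Rightarrow> (nat list \<Rightarrow> complex) set" where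
  "fock d I = {\<xi> \<in> ell2. \<forall>n. (\<lambda>w. if length w = n then \<xi> w else 0) \<in> sps d I n}"

text \<open>The bounded operator given on the basis by \<open>e\<^sub>\<nu> \<mapsto> e\<^sub>i\<^sub>\<nu>\<close> if \<open>i\<nu>\<close> is allowable and
  \<open>e\<^sub>\<nu> \<mapsto> 0\<close> otherwise, in coordinates; see \<open>shift_basis_vec\<close> and \<open>shift_bounded\<close> below.\<close>

definition shift :: "nat \<Rightarrow> (nat list \<Rightarrow> complex) set \<Rightarrow> nat \<Rightarrow> (nat list \<Rightarrow> complex) \<Rightarrow> nat list \<Rightarrow> complex" where
  "shift d I i = (\<lambda>\<xi>\<in>fock d I. (\<lambda>w. case w of [] \<Rightarrow> 0
     | j # \<nu> \<Rightarrow> if j = i \<and> i # \<nu> \<in> allowable d I then \<xi> \<nu> else 0))"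

definition tensor_algebra :: "nat \<Rightarrow> (nat list \<Rightarrow> complex) set
    \<Rightarrow> (complex, (nat list \<Rightarrow> complex) \<Rightarrow> nat list \<Rightarrow> complex) module" where
  "tensor_algebra d I = (bounded_ops (fock d I))
    \<lparr>carrier := \<Inter>{A. closed_subalgebra (fock d I) A \<and> (\<forall>i<d. shift d I i \<in> A)}\<rparr>"

definition completely_isometric_iso :: "nat \<Rightarrow> (nat list \<Rightarrow> complex) set \<Rightarrow> nat \<Rightarrow> (nat list \<Rightarrow> complex) set
    \<Rightarrow> (((nat list \<Rightarrow> complex) \<Rightarrow> nat list \<Rightarrow> complex) \<Rightarrow> (nat list \<Rightarrow> complex) \<Rightarrow> nat list \<Rightarrow> complex) set" where
  "completely_isometric_iso d I d' J =
    {\<phi> \<in> alg_iso (tensor_algebra d I) (tensor_algebra d' J).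
       \<forall>n a. (\<forall>i<n. \<forall>j<n. a i j \<in> carrier (tensor_algebra d I)) \<longrightarrow>
         mat_op_norm (fock d' J) n (\<lambda>i j. \<phi> (a i j)) = mat_op_norm (fock d I) n a}"


section \<open>Consistency of the encodings\<close>

lemma nc_mult_finite_support:
  assumes "finite {w. f w \<noteq> 0}" "finite {w. g w \<noteq> 0}"
  shows "finite {w. nc_mult f g w \<noteq> 0}"
    and "\<And>A. {w. f w \<noteq> 0} \<subseteq> lists A \<Longrightarrow> {w. g w \<noteq> 0} \<subseteq> lists A \<Longrightarrow> {w. nc_mult f g w \<noteq> 0} \<subseteq> lists A"
proof -
  have sub: "{w. nc_mult f g w \<noteq> 0} \<subseteq> (\<lambda>(u, v). u @ v) ` ({w. f w \<noteq> 0} \<times> {w. g w \<noteq> 0})"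
  proof
    fix w assume "w \<in> {w. nc_mult f g w \<noteq> 0}"
    then obtain k where "f (take k w) * g (drop k w) \<noteq> 0"
      unfolding nc_mult_def by (auto elim: sum.not_neutral_contains_not_neutral)
    then have "(take k w, drop k w) \<in> {w. f w \<noteq> 0} \<times> {w. g w \<noteq> 0}" by auto
    then have "(\<lambda>(u, v). u @ v) (take k w, drop k w) \<in> (\<lambda>(u, v). u @ v) ` ({w. f w \<noteq> 0} \<times> {w. g w \<noteq> 0})"
      by (rule imageI)
    then show "w \<in> (\<lambda>(u, v). u @ v) ` ({w. f w \<noteq> 0} \<times> {w. g w \<noteq> 0})" by simp
  qed
  show "finite {w. nc_mult f g w \<noteq> 0}"
    by (rule finite_subset[OF sub]) (use assms in auto)
  show "{w. nc_mult f g w \<noteq> 0} \<subseteq> lists A"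
    if "{w. f w \<noteq> 0} \<subseteq> lists A" "{w. g w \<noteq> 0} \<subseteq> lists A" for A
  proof
    fix w assume "w \<in> {w. nc_mult f g w \<noteq> 0}"
    from subsetD[OF sub this] obtain u v
      where uv: "w = u @ v" "u \<in> {w. f w \<noteq> 0}" "v \<in> {w. g w \<noteq> 0}" by auto
    then show "w \<in> lists A"
      using subsetD[OF that(1) uv(2)] subsetD[OF that(2) uv(3)] by simp
  qed
qed

lemma nc_mult_assoc: "nc_mult (nc_mult f g) h = nc_mult f (nc_mult g h)"
proof
  fix w :: "nat list"
  let ?t = "\<lambda>j k. f (take j w) * g (take (k - j) (drop j w)) * h (drop k w)"
  let ?n = "length w"
  have "nc_mult (nc_mult f g) h w = (\<Sum>k\<le>?n. \<Sum>j\<le>k. ?t j k)"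
    unfolding nc_mult_def
    by (intro sum.cong refl) (auto simp: sum_distrib_right min_def drop_take intro!: sum.cong)
  also have "\<dots> = (\<Sum>(k, j)\<in>Sigma {..?n} (\<lambda>k. {..k}). ?t j k)"
    by (simp add: sum.Sigma)
  also have "\<dots> = (\<Sum>(j, i)\<in>Sigma {..?n} (\<lambda>j. {..?n - j}). ?t j (j + i))"
    by (rule sum.reindex_bij_witness[where i = "\<lambda>(j, i). (j + i, j)" and j = "\<lambda>(k, j). (j, k - j)"]) auto
  also have "\<dots> = (\<Sum>j\<le>?n. \<Sum>i\<le>?n - j. ?t j (j + i))"
    by (simp add: sum.Sigma)
  also have "\<dots> = nc_mult f (nc_mult g h) w"
    unfolding nc_mult_def
    by (intro sum.cong refl) (auto simp: sum_distrib_left mult.assoc add.commute intro!: sum.cong)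
  finally show "nc_mult (nc_mult f g) h w = nc_mult f (nc_mult g h) w" .
qed

lemma nc_mult_one: "nc_mult (monom_word []) f = f" "nc_mult f (monom_word []) = f"
proof -
  show "nc_mult (monom_word []) f = f"
  proof
    fix w
    have "nc_mult (monom_word []) f w = (\<Sum>k\<in>{0}. monom_word [] (take k w) * f (drop k w))"
      unfolding nc_mult_def by (rule sum.mono_neutral_right) (auto simp: monom_word_def)
    then show "nc_mult (monom_word []) f w = f w" by (simp add: monom_word_def)
  qed
  show "nc_mult f (monom_word []) = f"
  proof
    fix w
    have "nc_mult f (monom_word []) w = (\<Sum>k\<in>{length w}. f (take k w) * monom_word [] (drop k w))"
      unfolding nc_mult_def by (rule sum.mono_neutral_right) (auto simp: monom_word_def)
    then show "nc_mult f (monom_word []) w = f w" by (simp add: monom_word_def)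
  qed
qed

lemma nc_poly_ring: "ring (nc_poly d)"
proof (rule ringI)
  have minus: "(\<lambda>w. - f w) \<in> carrier (nc_poly d)" if "f \<in> carrier (nc_poly d)" for f
    using that by (simp add: nc_poly_def)
  have plus: "(\<lambda>w. f w + g w) \<in> carrier (nc_poly d)"
    if "f \<in> carrier (nc_poly d)" "g \<in> carrier (nc_poly d)" for f g
  proof -
    have "{w. f w + g w \<noteq> 0} \<subseteq> {w. f w \<noteq> 0} \<union> {w. g w \<noteq> 0}" by auto
    moreover from that have "finite ({w. f w \<noteq> 0} \<union> {w. g w \<noteq> 0})" "{w. f w \<noteq> 0} \<union> {w. g w \<noteq> 0} \<subseteq> words d"
      by (auto simp: nc_poly_def)
    ultimately have "finite {w. f w + g w \<noteq> 0}" "{w. f w + g w \<noteq> 0} \<subseteq> words d"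
      by (meson finite_subset, meson subset_trans)
    then show ?thesis by (simp add: nc_poly_def)
  qed
  show "abelian_group (nc_poly d)"
  proof (rule abelian_groupI)
    fix f assume f: "f \<in> carrier (nc_poly d)"
    show "\<exists>g\<in>carrier (nc_poly d). g \<oplus>\<^bsub>nc_poly d\<^esub> f = \<zero>\<^bsub>nc_poly d\<^esub>"
      by (rule bexI[OF _ minus[OF f]]) (simp add: nc_poly_def)
  next
    fix f g assume "f \<in> carrier (nc_poly d)" "g \<in> carrier (nc_poly d)"
    from plus[OF this] show "f \<oplus>\<^bsub>nc_poly d\<^esub> g \<in> carrier (nc_poly d)"
      by (simp add: nc_poly_def)
  qed (auto simp: nc_poly_def add_ac)
  show "monoid (nc_poly d)"
  proof (rule monoidI)
    fix f g assume "f \<in> carrier (nc_poly d)" "g \<in> carrier (nc_poly d)"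
    then show "f \<otimes>\<^bsub>nc_poly d\<^esub> g \<in> carrier (nc_poly d)"
      using nc_mult_finite_support[of f g] by (simp add: nc_poly_def words_def)
  next
    show "\<one>\<^bsub>nc_poly d\<^esub> \<in> carrier (nc_poly d)"
      by (auto simp: nc_poly_def words_def monom_word_def)
  qed (auto simp: nc_poly_def nc_mult_assoc nc_mult_one)
qed (auto simp: nc_poly_def nc_mult_def algebra_simps sum.distrib)

lemma monom_word_mult: "nc_mult (monom_word \<mu>) (monom_word \<nu>) = monom_word (\<mu> @ \<nu>)"
proof
  fix w
  have "monom_word \<mu> (take k w) * monom_word \<nu> (drop k w) =
      (if k = length \<mu> then if w = \<mu> @ \<nu> then 1 else 0 else 0)" if "k \<le> length w" for k
  proof -
    have "(take k w = \<mu> \<and> drop k w = \<nu>) \<longleftrightarrow> (k = length \<mu> \<and> w = \<mu> @ \<nu>)"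
      using that by (metis append_eq_conv_conj append_take_drop_id length_take min.absorb2)
    moreover have "monom_word \<mu> (take k w) * monom_word \<nu> (drop k w) =
        (if take k w = \<mu> \<and> drop k w = \<nu> then 1 else 0)"
      by (simp add: monom_word_def)
    ultimately show ?thesis by simp
  qed
  then have "nc_mult (monom_word \<mu>) (monom_word \<nu>) w =
      (\<Sum>k\<le>length w. if k = length \<mu> then (if w = \<mu> @ \<nu> then 1 else 0) else 0)"
    unfolding nc_mult_def by (intro sum.cong refl) simp
  also have "\<dots> = monom_word (\<mu> @ \<nu>) w"
    by (auto simp: monom_word_def)
  finally show "nc_mult (monom_word \<mu>) (monom_word \<nu>) w = monom_word (\<mu> @ \<nu>) w" .
qed

lemma nc_quot_simps [simp]:
  "carrier (nc_quot d I) = carrier (nc_poly d Quot I)"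
  "mult (nc_quot d I) = mult (nc_poly d Quot I)"
  "one (nc_quot d I) = one (nc_poly d Quot I)"
  "zero (nc_quot d I) = zero (nc_poly d Quot I)"
  "add (nc_quot d I) = add (nc_poly d Quot I)"
  "smult (nc_quot d I) = (\<lambda>c C. \<Union>f\<in>C. I +>\<^bsub>nc_poly d\<^esub> (c \<odot>\<^bsub>nc_poly d\<^esub> f))"
  by (simp_all add: nc_quot_def ring.defs module.defs)

lemma subst_vars_monom_word:
  assumes "bij \<pi>"
  shows "subst_vars \<pi> (monom_word \<mu>) = monom_word (map \<pi> \<mu>)"
proof
  fix w
  have "map (inv_into UNIV \<pi>) w = \<mu> \<longleftrightarrow> w = map \<pi> \<mu>"
    using assms by (auto simp: o_def bij_inv_eq_iff surj_f_inv_f bij_is_surj bij_is_inj)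
  then show "subst_vars \<pi> (monom_word \<mu>) w = monom_word (map \<pi> \<mu>) w"
    by (simp add: subst_vars_def monom_word_def)
qed

lemma finite_words_length: "finite {\<mu> \<in> allowable d I. length \<mu> = n}"
proof (rule finite_subset)
  show "{\<mu> \<in> allowable d I. length \<mu> = n} \<subseteq> {xs. set xs \<subseteq> {..<d} \<and> length xs = n}"
    by (auto simp: allowable_def words_def)
qed (simp add: finite_lists_length_eq)

lemma sps_iff: "\<xi> \<in> sps d I n \<longleftrightarrow> (\<forall>w. \<xi> w \<noteq> 0 \<longrightarrow> w \<in> allowable d I \<and> length w = n)"
proof -
  have *: "(\<Sum>\<mu>\<in>{\<mu>\<in>allowable d I. length \<mu> = n}. c \<mu> * basis_vec \<mu> w) =
      (if w \<in> allowable d I \<and> length w = n then c w else 0)" for c w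
  proof -
    have "(\<Sum>\<mu>\<in>{\<mu>\<in>allowable d I. length \<mu> = n}. c \<mu> * basis_vec \<mu> w) =
        (\<Sum>\<mu>\<in>{\<mu>\<in>allowable d I. length \<mu> = n}. if w = \<mu> then c \<mu> else 0)"
      by (intro sum.cong) (auto simp: basis_vec_def)
    then show ?thesis using finite_words_length[of d I n] by simp
  qed
  show ?thesis unfolding sps_def *
    by (auto simp: fun_eq_iff split: if_splits)
qed

lemma sps_proj_eq:
  "sps_proj d I n \<xi> = (\<lambda>w. if w \<in> allowable d I \<and> length w = n then \<xi> w else 0)"
proof -
  let ?p = "\<lambda>w. if w \<in> allowable d I \<and> length w = n then \<xi> w else 0"
  have basis: "l2_inner f (basis_vec \<mu>) = f \<mu>" for f \<mu>
  proof -
    have "l2_inner f (basis_vec \<mu>) = (\<Sum>\<^sub>\<infinity>w\<in>{\<mu>}. f w * cnj (basis_vec \<mu> w))"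
      unfolding l2_inner_def by (rule infsum_cong_neutral) (auto simp: basis_vec_def)
    then show ?thesis by (simp add: basis_vec_def)
  qed
  have "\<eta> = ?p" if "\<eta> \<in> sps d I n" "\<forall>\<zeta>\<in>sps d I n. l2_inner (\<lambda>w. \<xi> w - \<eta> w) \<zeta> = 0" for \<eta>
  proof
    fix w
    have "\<xi> w = \<eta> w" if "w \<in> allowable d I" "length w = n"
    proof -
      have "basis_vec w \<in> sps d I n" using that by (simp add: sps_iff basis_vec_def)
      with \<open>\<forall>\<zeta>\<in>sps d I n. l2_inner (\<lambda>w. \<xi> w - \<eta> w) \<zeta> = 0\<close>
      have "l2_inner (\<lambda>w. \<xi> w - \<eta> w) (basis_vec w) = 0" by blast
      then show ?thesis by (simp add: basis)
    qed
    then show "\<eta> w = ?p w" using \<open>\<eta> \<in> sps d I n\<close> by (auto simp: sps_iff)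
  qed
  moreover have "?p \<in> sps d I n" by (simp add: sps_iff)
  moreover have "l2_inner (\<lambda>w. \<xi> w - ?p w) \<zeta> = 0" if "\<zeta> \<in> sps d I n" for \<zeta>
    unfolding l2_inner_def by (rule infsum_0) (use that in \<open>auto simp: sps_iff\<close>)
  ultimately show ?thesis unfolding sps_proj_def orth_proj_def
    by (intro the_equality) blast+
qed

lemma tensor_basis_vec: "tensor (length \<mu>) (basis_vec \<mu>) (basis_vec \<nu>) = basis_vec (\<mu> @ \<nu>)"
  by (auto simp: tensor_def basis_vec_def fun_eq_iff) (metis append_take_drop_id)+

lemma fock_iff: "\<xi> \<in> fock d I \<longleftrightarrow> \<xi> \<in> ell2 \<and> (\<forall>w. \<xi> w \<noteq> 0 \<longrightarrow> w \<in> allowable d I)"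
  by (auto simp: fock_def sps_iff)

lemma basis_vec_fock: "basis_vec \<nu> \<in> fock d I" if "\<nu> \<in> allowable d I"
proof -
  have "(\<lambda>w. (cmod (basis_vec \<nu> w))\<^sup>2) summable_on UNIV \<longleftrightarrow>
      (\<lambda>w. (cmod (basis_vec \<nu> w))\<^sup>2) summable_on {\<nu>}"
    by (rule summable_on_cong_neutral) (auto simp: basis_vec_def)
  then show ?thesis using that by (auto simp: fock_iff ell2_def basis_vec_def)
qed

lemma shift_basis_vec:
  assumes "\<nu> \<in> allowable d I"
  shows "shift d I i (basis_vec \<nu>) = (if i # \<nu> \<in> allowable d I then basis_vec (i # \<nu>) else (\<lambda>w. 0))"
  using basis_vec_fock[OF assms]
  by (auto simp: shift_def basis_vec_def fun_eq_iff split: list.split)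

lemma shift_bounded: "shift d I i \<in> carrier (bounded_ops (fock d I))"
proof -
  let ?s = "\<lambda>\<xi> w. case w of [] \<Rightarrow> 0 | j # \<nu> \<Rightarrow> if j = i \<and> i # \<nu> \<in> allowable d I then \<xi> \<nu> else 0"
  have main: "?s \<xi> \<in> fock d I \<and> l2_norm (?s \<xi>) \<le> l2_norm \<xi>" if \<xi>: "\<xi> \<in> fock d I" for \<xi>
  proof -
    let ?N = "{\<nu>. i # \<nu> \<in> allowable d I}"
    have inj: "inj_on ((#) i) ?N" by simp
    have s: "(\<lambda>w. (cmod (\<xi> w))\<^sup>2) summable_on UNIV" using \<xi> by (simp add: fock_iff ell2_def)
    then have sN: "(\<lambda>w. (cmod (\<xi> w))\<^sup>2) summable_on ?N" by (rule summable_on_subset_banach) simp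
    have comp: "((\<lambda>w. (cmod (?s \<xi> w))\<^sup>2) \<circ> (#) i) w = (cmod (\<xi> w))\<^sup>2" if "w \<in> ?N" for w
      using that by simp
    have "(\<lambda>w. (cmod (?s \<xi> w))\<^sup>2) summable_on ((#) i ` ?N)"
      unfolding summable_on_reindex[OF inj] by (rule iffD2[OF summable_on_cong[OF comp] sN])
    moreover have out: "(cmod (?s \<xi> w))\<^sup>2 = 0" if "w \<notin> (#) i ` ?N" for w
      using that by (auto split: list.split)
    ultimately have sum: "(\<lambda>w. (cmod (?s \<xi> w))\<^sup>2) summable_on UNIV"
      by (subst summable_on_cong_neutral[where T = "(#) i ` ?N" and g = "\<lambda>w. (cmod (?s \<xi> w))\<^sup>2"]) auto
    have "(\<Sum>\<^sub>\<infinity>w. (cmod (?s \<xi> w))\<^sup>2) = (\<Sum>\<^sub>\<infinity>w\<in>(#) i ` ?N. (cmod (?s \<xi> w))\<^sup>2)"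
      by (rule infsum_cong_neutral) (use out in auto)
    also have "\<dots> = (\<Sum>\<^sub>\<infinity>w\<in>?N. (cmod (\<xi> w))\<^sup>2)"
      unfolding infsum_reindex[OF inj] by (rule infsum_cong[OF comp])
    also have "\<dots> \<le> (\<Sum>\<^sub>\<infinity>w. (cmod (\<xi> w))\<^sup>2)"
      by (rule infsum_mono_neutral[OF sN s]) auto
    finally have "l2_norm (?s \<xi>) \<le> l2_norm \<xi>" by (simp add: l2_norm_def)
    moreover have "?s \<xi> \<in> fock d I"
      using sum by (auto simp: fock_iff ell2_def split: list.splits if_splits)
    ultimately show ?thesis by blast
  qed
  have add: "(\<lambda>w. \<xi> w + \<eta> w) \<in> fock d I" if "\<xi> \<in> fock d I" "\<eta> \<in> fock d I" for \<xi> \<eta>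
  proof -
    have "(\<lambda>w. 2 * (cmod (\<xi> w))\<^sup>2 + 2 * (cmod (\<eta> w))\<^sup>2) summable_on UNIV"
      using that by (intro summable_on_add summable_on_cmult_right) (auto simp: fock_iff ell2_def)
    moreover have "(cmod (\<xi> w + \<eta> w))\<^sup>2 \<le> 2 * (cmod (\<xi> w))\<^sup>2 + 2 * (cmod (\<eta> w))\<^sup>2" for w
    proof -
      have "(cmod (\<xi> w + \<eta> w))\<^sup>2 \<le> (cmod (\<xi> w) + cmod (\<eta> w))\<^sup>2"
        by (rule power_mono[OF norm_triangle_ineq]) simp
      also have "\<dots> \<le> 2 * (cmod (\<xi> w))\<^sup>2 + 2 * (cmod (\<eta> w))\<^sup>2"
        using sum_squares_bound[of "cmod (\<xi> w)" "cmod (\<eta> w)"] by (simp add: power2_sum)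
      finally show ?thesis .
    qed
    ultimately have "(\<lambda>w. (cmod (\<xi> w + \<eta> w))\<^sup>2) summable_on UNIV"
      by (rule summable_on_comparison_test) auto
    moreover have "w \<in> allowable d I" if "\<xi> w + \<eta> w \<noteq> 0" for w
      using that \<open>\<xi> \<in> fock d I\<close> \<open>\<eta> \<in> fock d I\<close> by (metis add_0 fock_iff)
    ultimately show ?thesis by (simp add: fock_iff ell2_def)
  qed
  have scale: "(\<lambda>w. c * \<xi> w) \<in> fock d I" if "\<xi> \<in> fock d I" for c \<xi>
    using that by (auto simp: fock_iff ell2_def norm_mult power_mult_distrib intro: summable_on_cmult_right)
  have "linear_map_on (fock d I) (shift d I i)"
    by (auto simp: linear_map_on_def shift_def add scale fun_eq_iff split: list.split)
  moreover have "op_norm (fock d I) (shift d I i) \<le> ennreal 1"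
    unfolding op_norm_def
    by (rule SUP_least, rule ennreal_leI) (use main in \<open>force simp: shift_def\<close>)
  then have "op_norm (fock d I) (shift d I i) < \<infinity>"
    using le_less_trans by fastforce
  ultimately show ?thesis
    using main by (auto simp: bounded_ops_def shift_def)
qed

end

theory Submission
  imports Defs "HOL-Complex_Analysis.Conformal_Mappings" "Jordan_Normal_Form.Determinant"
begin

text \<open>
  All conditions are compared with (vi) through one linear-algebraic consequence: a matrix with a
  right inverse, viewed as a substitution of variables, that maps every word outside the language
  \<open>L\<close> of allowable words of \<open>\<I>\<close> into \<open>\<J>\<close>. If this holds in both directions, a nonzero term of
  the Leibniz expansion of the determinant is a permutation of the variables carrying \<open>\<I>\<close> into
  \<open>\<J>\<close>, and counting words gives equality.

  For graded isomorphisms and similarities the matrix is the degree-one part. For an algebraic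
  isomorphism \<open>f\<close> of the tensor algebras, which is not assumed continuous, let \<open>z\<close> be the point of
  the character obtained by composing \<open>f\<close> with the vacuum character. The maximum modulus principle
  shows that \<open>z\<close> lies in the open unit ball. Commutant lifting, done row by row with a
  Hahn-Banach step and followed by Fejer averaging, then yields that every element of the algebra is
  a scalar plus a combination of the \<open>x\<^sub>i - z\<^sub>i\<close> with coefficients to the right of them. Hence
  polynomials of degree less than \<open>n\<close> are mapped onto the target modulo degree \<open>n\<close>, and by
  symmetry of the situation bijectively. For a word \<open>\<mu>\<close> of length \<open>n\<close> outside \<open>L\<close> the product
  of the \<open>x\<^sub>\<mu>\<^sub>k - z\<^sub>\<mu>\<^sub>k\<close> has degree less than \<open>n\<close> but an image of order at least \<open>n\<close>, so it
  vanishes, and the lowest-order part of its image is the relation for the linear parts of the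
  \<open>f x\<^sub>i\<close>.
\<close>

section \<open>Finite linear algebra\<close>

text \<open>Polynomial approximation of an element says nothing about its image under
  \<open>f\<close>, since \<open>f\<close> need not respect norm limits. Only an exact finite
  identity passes through \<open>f\<close>, so the factorization a = c + sum of (x_i - z_i) b_i must
  hold in the closed algebra itself. The obstacle is norm control. An element of order at least N is
  a sum of x_\<mu> a_\<mu> over words \<mu> of length N, but the coefficient of a_\<mu> at \<nu> is
  determined only if \<mu>\<nu> is allowable, and putting zero elsewhere gives no bound. Lifting
  chooses the undetermined coefficients so that the whole column of the a_\<mu> keeps the bound of
  the element. The choice is made for finitely many rows; Fejer averaging turns it into a column of
  polynomials with the same bound in all degrees. Replacing x_\<mu> by its value at z then gains
  |z|^N, while isolating the degrees from N on costs only N + 1. This is where |z| < 1 enters: for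
  large N half of the norm is removed, and iteration makes the identity exact.\<close>

lemma nat_right_inverse:
  fixes A B :: "nat \<Rightarrow> nat \<Rightarrow> complex"
  assumes AB: "\<And>i j. i < m \<Longrightarrow> j < m \<Longrightarrow> (\<Sum>k<n. A i k * B k j) = (if i = j then 1 else 0)"
  shows "m \<le> n"
    and "n = m \<Longrightarrow> i < m \<Longrightarrow> j < m \<Longrightarrow> (\<Sum>k<m. B i k * A k j) = (if i = j then 1 else 0)"
    and "n = m \<Longrightarrow> \<exists>\<sigma>. \<sigma> permutes {..<m} \<and> (\<forall>i<m. A (\<sigma> i) i \<noteq> 0)"
proof -
  \<comment> \<open>Zero padding makes both factors square. If \<open>n < m\<close>, row
    \<open>n\<close> of \<open>B'\<close> is zero, which contradicts that \<open>B' * A'\<close> is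
    the identity.\<close>
  define A' B' where "A' = Matrix.mat m m (\<lambda>(i, k). if k < n then A i k else 0)"
    and "B' = Matrix.mat m m (\<lambda>(k, j). if k < n then B k j else 0)"
  have carr: "A' \<in> carrier_mat m m" "B' \<in> carrier_mat m m" by (auto simp: A'_def B'_def)
  have prod: "A' * B' = 1\<^sub>m m" if "n \<le> m"
  proof (rule eq_matI)
    fix i j assume ij: "i < dim_row (1\<^sub>m m :: complex mat)" "j < dim_col (1\<^sub>m m :: complex mat)"
    have "(A' * B') $$ (i, j) = (\<Sum>k\<in>{0..<m}. if k < n then A i k * B k j else 0)"
      using ij by (auto simp: A'_def B'_def scalar_prod_def intro!: sum.cong)
    also have "\<dots> = (\<Sum>k<n. A i k * B k j)"
      using that by (intro sum.mono_neutral_cong_right) auto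
    finally show "(A' * B') $$ (i, j) = 1\<^sub>m m $$ (i, j)"
      using ij AB by simp
  qed (use carr in auto)
  have prod': "B' * A' = 1\<^sub>m m" if "n \<le> m"
    using mat_mult_left_right_inverse[OF carr prod[OF that]] .
  show "m \<le> n"
  proof (rule ccontr)
    assume "\<not> m \<le> n"
    then have "(B' * A') $$ (n, n) = 1" using prod' by simp
    moreover have "(B' * A') $$ (n, n) = 0"
      using \<open>\<not> m \<le> n\<close> by (auto simp: A'_def B'_def scalar_prod_def)
    ultimately show False by simp
  qed
  show "(\<Sum>k<m. B i k * A k j) = (if i = j then 1 else 0)" if "n = m" "i < m" "j < m"
  proof -
    have "(\<Sum>k<m. B i k * A k j) = (B' * A') $$ (i, j)"
      using that by (auto simp: A'_def B'_def scalar_prod_def intro!: sum.cong)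
    then show ?thesis using prod' that by simp
  qed
  show "\<exists>\<sigma>. \<sigma> permutes {..<m} \<and> (\<forall>i<m. A (\<sigma> i) i \<noteq> 0)" if "n = m"
  proof -
    have "Determinant.det A' * Determinant.det B' = 1" using Determinant.det_mult[OF carr] prod that by simp
    then have "Determinant.det A' \<noteq> 0" by auto
    then have "(\<Sum>p\<in>{p. p permutes {0..<m}}. signof p * (\<Prod>i=0..<m. A' $$ (i, p i))) \<noteq> 0"
      using carr by (simp add: Determinant.det_def')
    then obtain p where p: "p permutes {0..<m}" "(\<Prod>i=0..<m. A' $$ (i, p i)) \<noteq> 0"
      by (metis (mono_tags, lifting) mem_Collect_eq mult_zero_right sum.neutral)
    have lt: "p i < m" if "i < m" for i using permutes_in_image[OF p(1), of i] that by simp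
    have nz: "A i (p i) \<noteq> 0" if "i < m" for i
    proof -
      have "A' $$ (i, p i) \<noteq> 0" using p(2) that by simp
      then show ?thesis using that lt[OF that] \<open>n = m\<close> by (simp add: A'_def)
    qed
    \<comment> \<open>The Leibniz term pairs row \<open>i\<close> with column \<open>p i\<close>;
      the inverse permutation indexes the same entries by columns.\<close>
    have q: "inv_into UNIV p permutes {..<m}" using permutes_inv[OF p(1)] by (simp add: lessThan_atLeast0)
    have "A (inv_into UNIV p i) i \<noteq> 0" if "i < m" for i
      using nz[of "inv_into UNIV p i"] permutes_in_image[OF q, of i] that permutes_inverses(1)[OF p(1)] by simp
    with q show ?thesis by blast
  qed
qed

text \<open>Solutions for all unit vectors form a right inverse, and a right inverse of a square
  matrix is two-sided. The second part is therefore injectivity of the matrix.\<close>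

lemma finite_right_inverse:
  fixes m :: "'b \<Rightarrow> 'a \<Rightarrow> complex"
  assumes fin: "finite S" "finite T"
    and inv: "\<And>t0. t0 \<in> T \<Longrightarrow> \<exists>c. \<forall>t\<in>T. (\<Sum>s\<in>S. m t s * c s) = (if t = t0 then 1 else 0)"
  shows "card T \<le> card S"
    and "card S = card T \<Longrightarrow> (\<And>t. t \<in> T \<Longrightarrow> (\<Sum>s\<in>S. m t s * c s) = 0) \<Longrightarrow> s \<in> S \<Longrightarrow> c s = 0"
proof -
  obtain f where f: "bij_betw f {..<card S} S"
    using ex_bij_betw_nat_finite[OF fin(1)] by (auto simp: lessThan_atLeast0)
  obtain g where g: "bij_betw g {..<card T} T"
    using ex_bij_betw_nat_finite[OF fin(2)] by (auto simp: lessThan_atLeast0)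
  obtain b where b: "\<And>t0 t. t0 \<in> T \<Longrightarrow> t \<in> T \<Longrightarrow> (\<Sum>s\<in>S. m t s * b t0 s) = (if t = t0 then 1 else 0)"
    using inv by metis
  have re: "(\<Sum>k<card S. h (f k)) = (\<Sum>s\<in>S. h s)" for h :: "'a \<Rightarrow> complex"
    by (rule sum.reindex_bij_betw[OF f])
  have gT: "g i \<in> T" if "i < card T" for i using g that by (auto simp: bij_betw_def)
  have eq: "(\<Sum>k<card S. m (g i) (f k) * b (g j) (f k)) = (if i = j then 1 else 0)"
    if "i < card T" "j < card T" for i j
  proof -
    have "g i = g j \<longleftrightarrow> i = j" using g that by (auto simp: bij_betw_def inj_on_def)
    then show ?thesis unfolding re[of "\<lambda>s. m (g i) s * b (g j) s"] using b gT that by simp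
  qed
  show "card T \<le> card S"
    by (rule nat_right_inverse(1)[where A = "\<lambda>i k. m (g i) (f k)" and B = "\<lambda>k j. b (g j) (f k)"]) (rule eq)
  show "c s = 0" if card: "card S = card T" and z: "\<And>t. t \<in> T \<Longrightarrow> (\<Sum>s\<in>S. m t s * c s) = 0" and s: "s \<in> S"
  proof -
    obtain k where k: "k < card S" "s = f k" using f s by (auto simp: bij_betw_def)
    have BA: "(\<Sum>l<card T. b (g l) (f i) * m (g l) (f j)) = (if i = j then 1 else 0)"
      if "i < card T" "j < card T" for i j
      by (rule nat_right_inverse(2)[where A = "\<lambda>i k. m (g i) (f k)" and B = "\<lambda>k j. b (g j) (f k)" and n = "card S"])
        (use eq that card in auto)
    have "c (f k) = (\<Sum>j<card T. (if k = j then 1 else 0) * c (f j))" using k card by (simp add: if_distrib[of "\<lambda>x. x * _"] cong: if_cong)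
    also have "\<dots> = (\<Sum>j<card T. (\<Sum>l<card T. b (g l) (f k) * m (g l) (f j)) * c (f j))"
      using k card by (intro sum.cong refl) (simp add: BA)
    also have "\<dots> = (\<Sum>j<card T. \<Sum>l<card T. b (g l) (f k) * (m (g l) (f j) * c (f j)))"
      by (simp add: sum_distrib_right mult.assoc)
    also have "\<dots> = (\<Sum>l<card T. \<Sum>j<card T. b (g l) (f k) * (m (g l) (f j) * c (f j)))"
      by (rule sum.swap)
    also have "\<dots> = (\<Sum>l<card T. b (g l) (f k) * (\<Sum>j<card S. m (g l) (f j) * c (f j)))"
      using card by (simp add: sum_distrib_left)
    also have "\<dots> = 0"
      by (intro sum.neutral ballI) (simp add: re[of "\<lambda>s. m (g _) s * c s"] z gT)
    finally show ?thesis using k by simp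
  qed
qed

section \<open>Monomial ideals and dominated languages\<close>

lemma words_iff: "w \<in> words d \<longleftrightarrow> set w \<subseteq> {..<d}"
  by (auto simp: words_def)

lemma words_append [simp]: "u @ v \<in> words d \<longleftrightarrow> u \<in> words d \<and> v \<in> words d"
  by (auto simp: words_iff)

lemma words_Cons [simp]: "i # v \<in> words d \<longleftrightarrow> i < d \<and> v \<in> words d"
  by (auto simp: words_iff)

lemma words_Nil [simp]: "[] \<in> words d"
  by (auto simp: words_iff)

lemma finite_words_le: "finite {w \<in> words d. length w \<le> n}"
  using finite_lists_length_le[of "{..<d}" n] by (simp add: words_iff)

lemma finite_words_eq: "finite {w \<in> words d. length w = n}"
  by (rule finite_subset[OF _ finite_words_le[of d n]]) auto

lemma nc_poly_carrier: "f \<in> carrier (nc_poly d) \<longleftrightarrow> finite {w. f w \<noteq> 0} \<and> (\<forall>w. f w \<noteq> 0 \<longrightarrow> w \<in> words d)"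
  by (auto simp: nc_poly_def)

lemma monom_word_carrier: "monom_word \<mu> \<in> carrier (nc_poly d) \<longleftrightarrow> \<mu> \<in> words d"
  by (auto simp: nc_poly_carrier monom_word_def)

lemma nc_poly_a_inv:
  assumes "f \<in> carrier (nc_poly d)"
  shows "\<ominus>\<^bsub>nc_poly d\<^esub> f = (\<lambda>w. - f w)"
proof -
  interpret ring "nc_poly d" by (rule nc_poly_ring)
  show ?thesis
    by (rule minus_equality) (use assms in \<open>auto simp: nc_poly_def\<close>)
qed

lemma ideal_monom_words:
  assumes "ideal I (nc_poly d)" "f \<in> carrier (nc_poly d)" "\<And>w. f w \<noteq> 0 \<Longrightarrow> monom_word w \<in> I"
  shows "f \<in> I"
proof -
  interpret ideal I "nc_poly d" by fact
  have "finite A \<Longrightarrow> A \<subseteq> words d \<Longrightarrow> (\<forall>w\<in>A. monom_word w \<in> I) \<Longrightarrow> (\<lambda>w. if w \<in> A then f w else 0) \<in> I" for A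
  proof (induction rule: finite_induct)
    case empty
    then show ?case using additive_subgroup.zero_closed[OF additive_subgroup_axioms] by (simp add: nc_poly_def)
  next
    case (insert v A)
    \<comment> \<open>An ideal of the ring absorbs ring elements; scalars enter as constant
      polynomials.\<close>
    have "(\<lambda>w. f v * monom_word [] w) \<in> carrier (nc_poly d)"
      by (auto simp: nc_poly_carrier monom_word_def)
    then have "(\<lambda>w. f v * monom_word [] w) \<otimes>\<^bsub>nc_poly d\<^esub> monom_word v \<in> I"
      using insert.prems by (intro I_l_closed) auto
    moreover have "(\<lambda>w. f v * monom_word [] w) \<otimes>\<^bsub>nc_poly d\<^esub> monom_word v = (\<lambda>w. f v * monom_word v w)"
    proof -
      have "nc_mult (\<lambda>w. f v * monom_word [] w) (monom_word v) = (\<lambda>w. f v * nc_mult (monom_word []) (monom_word v) w)"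
        by (simp add: nc_mult_def sum_distrib_left mult.assoc)
      then show ?thesis by (simp add: monom_word_mult nc_poly_def)
    qed
    ultimately have "(\<lambda>w. f v * monom_word v w) \<oplus>\<^bsub>nc_poly d\<^esub> (\<lambda>w. if w \<in> A then f w else 0) \<in> I"
      using insert by (intro additive_subgroup.a_closed[OF additive_subgroup_axioms]) auto
    moreover have "(\<lambda>w. f v * monom_word v w) \<oplus>\<^bsub>nc_poly d\<^esub> (\<lambda>w. if w \<in> A then f w else 0) = (\<lambda>w. if w \<in> insert v A then f w else 0)"
      using insert by (auto simp: nc_poly_def monom_word_def fun_eq_iff)
    ultimately show ?case by simp
  qed
  from this[of "{w. f w \<noteq> 0}"] assms(2,3) have "(\<lambda>w. if w \<in> {w. f w \<noteq> 0} then f w else 0) \<in> I"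
    by (auto simp: nc_poly_carrier)
  moreover have "(\<lambda>w. if w \<in> {w. f w \<noteq> 0} then f w else 0) = f" by auto
  ultimately show ?thesis by simp
qed

text \<open>Applied to the words with a generator as a factor, this gives an explicit ideal that
  bounds the generated one from above.\<close>

lemma factor_support_ideal:
  assumes D: "D \<subseteq> words d" and closed: "\<And>u v w. v \<in> D \<Longrightarrow> u \<in> words d \<Longrightarrow> w \<in> words d \<Longrightarrow> u @ v @ w \<in> D"
  shows "ideal {f \<in> carrier (nc_poly d). \<forall>w. f w \<noteq> 0 \<longrightarrow> w \<in> D} (nc_poly d)" (is "ideal ?X ?R")
proof -
  interpret ring "nc_poly d" by (rule nc_poly_ring)
  have add: "f \<oplus>\<^bsub>?R\<^esub> g = (\<lambda>w. f w + g w)" and mul: "f \<otimes>\<^bsub>?R\<^esub> g = nc_mult f g" and zer: "\<zero>\<^bsub>?R\<^esub> = (\<lambda>w. 0)" for f g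
    by (simp_all add: nc_poly_def)
  show ?thesis
  proof (rule idealI[OF nc_poly_ring])
    show "subgroup ?X (add_monoid ?R)"
    proof (rule group.subgroupI[OF a_group])
      show "?X \<noteq> {}" using zero_closed by (auto simp: zer intro!: exI[of _ "\<lambda>w. 0"])
    next
      fix f assume "f \<in> ?X"
      then show "inv\<^bsub>add_monoid ?R\<^esub> f \<in> ?X"
        using a_inv_closed[of f] by (auto simp: nc_poly_a_inv a_inv_def[symmetric])
    next
      fix f g assume "f \<in> ?X" "g \<in> ?X"
      then show "f \<otimes>\<^bsub>add_monoid ?R\<^esub> g \<in> ?X"
        using a_closed[of f g] by (auto simp: add) (metis add_0)
    qed auto
  next
    fix f g assume fg: "f \<in> ?X" "g \<in> carrier ?R"
    show "g \<otimes>\<^bsub>?R\<^esub> f \<in> ?X"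
    proof -
      have "w \<in> D" if nz: "nc_mult g f w \<noteq> 0" for w
      proof -
        from nz obtain k where "g (take k w) * f (drop k w) \<noteq> 0"
          unfolding nc_mult_def by (auto elim: sum.not_neutral_contains_not_neutral)
        then have "take k w \<in> words d" "drop k w \<in> D" using fg by (auto simp: nc_poly_carrier)
        from closed[OF this(2,1), of "[]"] show ?thesis by simp
      qed
      with fg m_closed[of g f] show ?thesis by (simp add: mul)
    qed
    show "f \<otimes>\<^bsub>?R\<^esub> g \<in> ?X"
    proof -
      have "w \<in> D" if nz: "nc_mult f g w \<noteq> 0" for w
      proof -
        from nz obtain k where "f (take k w) * g (drop k w) \<noteq> 0"
          unfolding nc_mult_def by (auto elim: sum.not_neutral_contains_not_neutral)
        then have "take k w \<in> D" "drop k w \<in> words d" using fg by (auto simp: nc_poly_carrier)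
        from closed[OF this(1) _ this(2), of "[]"] show ?thesis by simp
      qed
      with fg m_closed[of f g] show ?thesis by (simp add: mul)
    qed
  qed
qed

lemma monomial_ideal_is_ideal:
  assumes "monomial_ideal d I"
  shows "ideal I (nc_poly d)"
proof -
  interpret ring "nc_poly d" by (rule nc_poly_ring)
  from assms obtain S where "S \<subseteq> words d" "I = genideal (nc_poly d) (monom_word ` S)"
    by (auto simp: monomial_ideal_def)
  moreover from \<open>S \<subseteq> words d\<close> have "monom_word ` S \<subseteq> carrier (nc_poly d)" by (auto simp: monom_word_carrier)
  ultimately show ?thesis using genideal_ideal by simp
qed

text \<open>The words of a monomial ideal are those with a generator as a factor, and they span it,
  so membership can be read off from the support. From here on only the language of allowable words
  matters.\<close>

lemma monomial_ideal_iff: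
  assumes "monomial_ideal d I"
  shows "f \<in> I \<longleftrightarrow> f \<in> carrier (nc_poly d) \<and> (\<forall>w. f w \<noteq> 0 \<longrightarrow> w \<notin> allowable d I)"
proof -
  interpret ring "nc_poly d" by (rule nc_poly_ring)
  from assms obtain S where S: "S \<subseteq> words d" and I: "I = genideal (nc_poly d) (monom_word ` S)"
    by (auto simp: monomial_ideal_def)
  have ideal: "ideal I (nc_poly d)" by (rule monomial_ideal_is_ideal) fact
  define D where "D = {w \<in> words d. \<exists>u s v. s \<in> S \<and> w = u @ s @ v}"
  have "ideal {f \<in> carrier (nc_poly d). \<forall>w. f w \<noteq> 0 \<longrightarrow> w \<in> D} (nc_poly d)"
  proof (rule factor_support_ideal)
    fix u v w assume "v \<in> D" "u \<in> words d" "w \<in> words d"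
    moreover from \<open>v \<in> D\<close> obtain a s b where "s \<in> S" "v = a @ s @ b" by (auto simp: D_def)
    ultimately have "u @ v @ w \<in> words d" "u @ v @ w = (u @ a) @ s @ (b @ w)" by (auto simp: D_def)
    with \<open>s \<in> S\<close> show "u @ v @ w \<in> D" unfolding D_def by blast
  qed (auto simp: D_def)
  moreover have "\<exists>u s' v. s' \<in> S \<and> s = u @ s' @ v" if "s \<in> S" for s
    using that by (intro exI[of _ "[]"] exI[of _ s]) auto
  then have "monom_word ` S \<subseteq> {f \<in> carrier (nc_poly d). \<forall>w. f w \<noteq> 0 \<longrightarrow> w \<in> D}"
    using S by (auto simp: monom_word_carrier D_def) (auto simp: monom_word_def split: if_splits)
  ultimately have sub: "I \<subseteq> {f \<in> carrier (nc_poly d). \<forall>w. f w \<noteq> 0 \<longrightarrow> w \<in> D}"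
    unfolding I by (rule genideal_minimal)
  have mono: "monom_word w \<in> I" if "w \<in> D" for w
  proof -
    from that obtain u s v where w: "w = u @ s @ v" "s \<in> S" "w \<in> words d" by (auto simp: D_def)
    have "monom_word ` S \<subseteq> carrier (nc_poly d)" using S by (auto simp: monom_word_carrier)
    from subsetD[OF genideal_self[OF this] imageI[OF w(2)]] have "monom_word s \<in> I" unfolding I .
    then have "monom_word u \<otimes>\<^bsub>nc_poly d\<^esub> (monom_word s \<otimes>\<^bsub>nc_poly d\<^esub> monom_word v) \<in> I"
      using ideal.I_r_closed[OF ideal] ideal.I_l_closed[OF ideal] w by (simp add: monom_word_carrier)
    then show ?thesis using w by (simp add: nc_poly_def monom_word_mult)
  qed
  have D: "w \<notin> allowable d I \<longleftrightarrow> w \<in> D" if "w \<in> words d" for w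
  proof
    assume "w \<notin> allowable d I"
    then have "monom_word w \<in> I" using that by (simp add: allowable_def)
    then show "w \<in> D" using sub by (auto simp: monom_word_def)
  qed (use mono in \<open>auto simp: allowable_def\<close>)
  show ?thesis
  proof
    assume "f \<in> I"
    then show "f \<in> carrier (nc_poly d) \<and> (\<forall>w. f w \<noteq> 0 \<longrightarrow> w \<notin> allowable d I)"
      using sub D by (auto simp: nc_poly_carrier)
  next
    assume f: "f \<in> carrier (nc_poly d) \<and> (\<forall>w. f w \<noteq> 0 \<longrightarrow> w \<notin> allowable d I)"
    show "f \<in> I"
      by (rule ideal_monom_words[OF ideal]) (use f in \<open>auto simp: allowable_def nc_poly_carrier\<close>)
  qed
qed

lemma allowable_factor:
  assumes "monomial_ideal d I" "u @ v @ w \<in> allowable d I"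
  shows "v \<in> allowable d I"
proof (rule ccontr)
  note ideal = monomial_ideal_is_ideal[OF assms(1)]
  have w: "u \<in> words d" "v \<in> words d" "w \<in> words d" using assms(2) by (auto simp: allowable_def)
  assume "v \<notin> allowable d I"
  then have "monom_word v \<in> I" using w by (simp add: allowable_def)
  then have "monom_word u \<otimes>\<^bsub>nc_poly d\<^esub> (monom_word v \<otimes>\<^bsub>nc_poly d\<^esub> monom_word w) \<in> I"
    using ideal.I_r_closed[OF ideal] ideal.I_l_closed[OF ideal] w by (simp add: monom_word_carrier)
  then show False using assms(2) by (simp add: nc_poly_def monom_word_mult allowable_def)
qed

text \<open>Distributivity: expanding the product of sums chooses one letter for each position, that
  is, a word.\<close>

lemma sum_words_prod:
  "(\<Sum>s\<in>{s \<in> words d. length s = n}. \<Prod>k<n. g k (s ! k)) = (\<Prod>k<n. \<Sum>i<d. g k i :: complex)"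
proof (induction n arbitrary: g)
  case 0
  have "{s \<in> words d. length s = 0} = {[]}" by auto
  then show ?case by simp
next
  case (Suc n)
  have im: "{s \<in> words d. length s = Suc n} = (\<lambda>(i, s). i # s) ` ({..<d} \<times> {s \<in> words d. length s = n})"
    by (auto simp: length_Suc_conv image_iff)
  have "(\<Sum>s\<in>{s \<in> words d. length s = Suc n}. \<Prod>k<Suc n. g k (s ! k)) =
      (\<Sum>(i, s)\<in>{..<d} \<times> {s \<in> words d. length s = n}. \<Prod>k<Suc n. g k ((i # s) ! k))"
    unfolding im by (subst sum.reindex) (auto simp: inj_on_def intro!: sum.cong)
  also have "\<dots> = (\<Sum>i<d. \<Sum>s\<in>{s \<in> words d. length s = n}. g 0 i * (\<Prod>k<n. g (Suc k) (s ! k)))"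
    by (simp add: sum.cartesian_product prod.lessThan_Suc_shift del: prod.lessThan_Suc)
  also have "\<dots> = (\<Sum>i<d. g 0 i) * (\<Prod>k<n. \<Sum>i<d. g (Suc k) i)"
    by (simp add: sum_distrib_left[symmetric] Suc.IH[of "\<lambda>k. g (Suc k)"] sum_distrib_right)
  also have "\<dots> = (\<Prod>k<Suc n. \<Sum>i<d. g k i)"
    by (simp add: prod.lessThan_Suc_shift del: prod.lessThan_Suc)
  finally show ?case .
qed

text \<open>\<open>A j i\<close> is the coefficient of the \<open>j\<close>-th variable in the image of the \<open>i\<close>-th one under a linear
  substitution with right inverse \<open>B\<close>; the last condition says that words outside \<open>L\<close> are mapped
  to combinations of words outside \<open>L'\<close>.\<close>

definition word_dominates :: "nat \<Rightarrow> nat list set \<Rightarrow> nat \<Rightarrow> nat list set \<Rightarrow> bool" where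
  "word_dominates d L d' L' \<longleftrightarrow> (\<exists>A B :: nat \<Rightarrow> nat \<Rightarrow> complex.
     (\<forall>j<d'. \<forall>j'<d'. (\<Sum>i<d. A j i * B i j') = (if j = j' then 1 else 0)) \<and>
     (\<forall>\<mu>\<in>words d - L. \<forall>\<kappa>\<in>L'. length \<kappa> = length \<mu> \<longrightarrow> (\<Prod>k<length \<mu>. A (\<kappa> ! k) (\<mu> ! k)) = 0))"

text \<open>The \<open>n\<close>-fold tensor powers of \<open>A\<close> and \<open>B\<close> satisfy
  the same right-inverse relation. A word outside \<open>L\<close> has only zero entries in the rows
  from \<open>L'\<close>, so these columns can be discarded without harming the relation on
  \<open>L'\<close>.\<close>

lemma word_dominates_card:
  assumes dom: "word_dominates d L d' L'" and L: "L \<subseteq> words d" "L' \<subseteq> words d'"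
  shows "card {w \<in> L'. length w = n} \<le> card {w \<in> L. length w = n}"
proof -
  from dom obtain A B :: "nat \<Rightarrow> nat \<Rightarrow> complex"
    where AB: "\<And>j j'. j < d' \<Longrightarrow> j' < d' \<Longrightarrow> (\<Sum>i<d. A j i * B i j') = (if j = j' then 1 else 0)"
      and van: "\<And>\<mu> \<kappa>. \<mu> \<in> words d \<Longrightarrow> \<mu> \<notin> L \<Longrightarrow> \<kappa> \<in> L' \<Longrightarrow> length \<kappa> = length \<mu> \<Longrightarrow> (\<Prod>k<length \<mu>. A (\<kappa> ! k) (\<mu> ! k)) = 0"
    unfolding word_dominates_def by blast
  have fin: "finite {w \<in> L. length w = n}" "finite {w \<in> L'. length w = n}"
    by (rule finite_subset[OF _ finite_words_eq[of d n]] finite_subset[OF _ finite_words_eq[of d' n]]; use L in blast)+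
  show ?thesis
  proof (rule finite_right_inverse(1)[OF fin, where m = "\<lambda>t s. \<Prod>k<n. A (t ! k) (s ! k)"])
    fix t0 assume t0: "t0 \<in> {w \<in> L'. length w = n}"
    define c where "c s = (\<Prod>k<n. B (s ! k) (t0 ! k))" for s
    have "(\<Sum>s\<in>{w \<in> L. length w = n}. (\<Prod>k<n. A (t ! k) (s ! k)) * c s) = (if t = t0 then 1 else 0)"
      if t: "t \<in> {w \<in> L'. length w = n}" for t
    proof -
      have lt: "t ! k < d'" "t0 ! k < d'" if "k < n" for k
      proof -
        have "t ! k \<in> set t" "t0 ! k \<in> set t0" using that t t0 by auto
        moreover have "t \<in> words d'" "t0 \<in> words d'" using L(2) t t0 by auto
        then have "set t \<subseteq> {..<d'}" "set t0 \<subseteq> {..<d'}" by (simp_all add: words_iff)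
        ultimately show "t ! k < d'" "t0 ! k < d'" by auto
      qed
      have "(\<Sum>s\<in>{w \<in> L. length w = n}. (\<Prod>k<n. A (t ! k) (s ! k)) * c s) =
          (\<Sum>s\<in>{w \<in> words d. length w = n}. (\<Prod>k<n. A (t ! k) (s ! k)) * c s)"
      proof (rule sum.mono_neutral_left[OF finite_words_eq])
        show "\<forall>s\<in>{w \<in> words d. length w = n} - {w \<in> L. length w = n}. (\<Prod>k<n. A (t ! k) (s ! k)) * c s = 0"
        proof
          fix s assume "s \<in> {w \<in> words d. length w = n} - {w \<in> L. length w = n}"
          then have "s \<in> words d" "s \<notin> L" "length s = n" by blast+
          moreover have "t \<in> L'" "length t = n" using t by blast+
          ultimately have "(\<Prod>k<n. A (t ! k) (s ! k)) = 0" using van[of s t] by simp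
          then show "(\<Prod>k<n. A (t ! k) (s ! k)) * c s = 0" by simp
        qed
      qed (use L in auto)
      also have "\<dots> = (\<Sum>s\<in>{w \<in> words d. length w = n}. \<Prod>k<n. A (t ! k) (s ! k) * B (s ! k) (t0 ! k))"
        by (simp add: c_def prod.distrib)
      also have "\<dots> = (\<Prod>k<n. \<Sum>i<d. A (t ! k) i * B i (t0 ! k))"
        by (rule sum_words_prod)
      also have "\<dots> = (\<Prod>k<n. if t ! k = t0 ! k then 1 else 0)"
        by (intro prod.cong refl AB) (auto simp: lt)
      also have "\<dots> = (if t = t0 then 1 else 0)"
      proof (cases "t = t0")
        case False
        then obtain k where "k < n" "t ! k \<noteq> t0 ! k" using t t0 by (auto simp: list_eq_iff_nth_eq)
        then have "\<exists>k\<in>{..<n}. (if t ! k = t0 ! k then 1 else 0 :: complex) = 0" by auto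
        then show ?thesis using False by (simp add: prod_zero)
      qed simp
      finally show ?thesis .
    qed
    then show "\<exists>c. \<forall>t\<in>{w \<in> L'. length w = n}. (\<Sum>s\<in>{w \<in> L. length w = n}. (\<Prod>k<n. A (t ! k) (s ! k)) * c s) = (if t = t0 then 1 else 0)"
      by blast
  qed
qed

lemma word_dominates_permutation:
  assumes dom: "word_dominates d L d' L'" "word_dominates d' L' d L" and L: "L \<subseteq> words d" "L' \<subseteq> words d'"
  shows "d = d' \<and> (\<exists>\<pi>. \<pi> permutes {..<d} \<and> (\<forall>\<mu>\<in>words d. \<mu> \<in> L \<longleftrightarrow> map \<pi> \<mu> \<in> L'))"
proof -
  from dom(1) obtain A B :: "nat \<Rightarrow> nat \<Rightarrow> complex"
    where AB: "\<And>j j'. j < d' \<Longrightarrow> j' < d' \<Longrightarrow> (\<Sum>i<d. A j i * B i j') = (if j = j' then 1 else 0)"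
      and van: "\<And>\<mu> \<kappa>. \<mu> \<in> words d \<Longrightarrow> \<mu> \<notin> L \<Longrightarrow> \<kappa> \<in> L' \<Longrightarrow> length \<kappa> = length \<mu> \<Longrightarrow> (\<Prod>k<length \<mu>. A (\<kappa> ! k) (\<mu> ! k)) = 0"
    unfolding word_dominates_def by blast
  have "d' \<le> d" using nat_right_inverse(1)[OF AB] .
  moreover have "d \<le> d'"
    using dom(2) nat_right_inverse(1)[of d] unfolding word_dominates_def by blast
  ultimately have d: "d = d'" by simp
  obtain \<pi> where \<pi>: "\<pi> permutes {..<d'}" "\<And>i. i < d' \<Longrightarrow> A (\<pi> i) i \<noteq> 0"
    using nat_right_inverse(3)[where A = A and B = B and m = d' and n = d, OF AB d] by blast
  have map_words: "map \<pi> \<mu> \<in> words d" if "\<mu> \<in> words d" for \<mu>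
    using that permutes_in_image[OF \<pi>(1)] d by (auto simp: words_iff)
  have inj: "inj (map \<pi>)" using permutes_inj[OF \<pi>(1)] by simp
  \<comment> \<open>All entries \<open>A (\<pi> i) i\<close> are nonzero, so the product attached to
    \<open>\<mu>\<close> and \<open>map \<pi> \<mu>\<close> cannot vanish, as it would have to if
    the latter were in \<open>L'\<close>.\<close>
  have N: "map \<pi> \<mu> \<notin> L'" if "\<mu> \<in> words d" "\<mu> \<notin> L" for \<mu>
  proof
    assume "map \<pi> \<mu> \<in> L'"
    from van[OF that this] have "(\<Prod>k<length \<mu>. A (map \<pi> \<mu> ! k) (\<mu> ! k)) = 0" by simp
    then obtain k where "k < length \<mu>" "A (\<pi> (\<mu> ! k)) (\<mu> ! k) = 0" by auto
    moreover from this have "\<mu> ! k < d'" using that(1) d by (auto simp: words_iff subset_iff)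
    ultimately show False using \<pi>(2) by blast
  qed
  have "\<mu> \<in> L \<longleftrightarrow> map \<pi> \<mu> \<in> L'" if \<mu>: "\<mu> \<in> words d" for \<mu>
  proof (rule iffI; rule ccontr)
    assume c: "\<mu> \<in> L" "map \<pi> \<mu> \<notin> L'"
    \<comment> \<open>The two complements have equally many words of length \<open>n\<close>, so the
      injection of one into the other is onto.\<close>
    define n where "n = length \<mu>"
    let ?N = "{w \<in> words d. length w = n} - {w \<in> L. length w = n}"
    let ?N' = "{w \<in> words d. length w = n} - {w \<in> L'. length w = n}"
    have "card {w \<in> L'. length w = n} = card {w \<in> L. length w = n}"
      using word_dominates_card[OF dom(1) L, of n] word_dominates_card[OF dom(2) L(2,1), of n] by simp
    moreover have "finite {w \<in> L. length w = n}" "finite {w \<in> L'. length w = n}"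
      by (rule finite_subset[OF _ finite_words_eq[of d n]]; use L d in blast)+
    ultimately have "card ?N = card ?N'"
      using L d by (subst (1 2) card_Diff_subset) auto
    moreover have "map \<pi> ` ?N \<subseteq> ?N'" using map_words N by auto
    moreover have "card (map \<pi> ` ?N) = card ?N"
      by (rule card_image) (rule inj_on_subset[OF inj], simp)
    moreover have "finite ?N'" using finite_words_eq by simp
    ultimately have im: "map \<pi> ` ?N = ?N'" by (simp add: card_subset_eq)
    have "map \<pi> \<mu> \<in> ?N'" using c map_words[OF \<mu>] by (simp add: n_def)
    then have "map \<pi> \<mu> \<in> map \<pi> ` ?N" unfolding im .
    then obtain \<nu> where "\<nu> \<in> ?N" "map \<pi> \<mu> = map \<pi> \<nu>" by blast
    with inj have "\<mu> = \<nu>" by (auto simp: inj_def)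
    with \<open>\<nu> \<in> ?N\<close> c(1) show False by (auto simp: n_def)
  next
    assume "map \<pi> \<mu> \<in> L'" "\<mu> \<notin> L"
    with N[OF \<mu>] show False by simp
  qed
  with \<pi>(1) d show ?thesis by auto
qed

section \<open>Hahn-Banach and sums of squares\<close>

text \<open>At \<open>s = sqrt b / sqrt a\<close> the bound equals the square of
  \<open>sqrt a + sqrt b\<close>, its minimum over \<open>s\<close>. If \<open>a\<close> or
  \<open>b\<close> is zero, this point moves off to infinity or to 0 and a limit replaces it. The
  lemma turns weighted quadratic estimates into triangle inequalities.\<close>

lemma sqrt_triangle_of_weighted:
  fixes a b X :: real
  assumes ab: "a \<ge> 0" "b \<ge> 0" and X: "\<And>s. s > 0 \<Longrightarrow> X \<le> (1 + s) * a + (1 + 1 / s) * b"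
  shows "sqrt X \<le> sqrt a + sqrt b"
proof -
  have "X \<le> (sqrt a + sqrt b)\<^sup>2"
  proof (cases "a = 0 \<or> b = 0")
    case False
    then have pos: "a > 0" "b > 0" using ab by auto
    define s where "s = sqrt b / sqrt a"
    have "s * a = sqrt a * sqrt b" "(1 / s) * b = sqrt a * sqrt b"
      using pos by (auto simp: s_def field_simps real_sqrt_mult_self)
    moreover have "s > 0" using pos by (simp add: s_def)
    ultimately have "X \<le> a + b + 2 * (sqrt a * sqrt b)"
      using X[of s] by (simp add: algebra_simps)
    then show ?thesis using ab by (simp add: power2_sum)
  next
    case True
    have "X \<le> a + b + e" if e: "e > 0" for e
    proof (cases "a = 0")
      case True
      \<comment> \<open>Adding 1 to \<open>b / e\<close> keeps the weight positive when
        \<open>b\<close> is zero.\<close>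
      have "b / e \<ge> 0" using ab e by simp
      then have "X \<le> (1 + 1 / (b / e + 1)) * b" using X[of "b / e + 1"] True by simp
      moreover have "1 / (b / e + 1) * b \<le> e" using ab e by (simp add: field_simps)
      ultimately show ?thesis using True by (simp add: algebra_simps)
    next
      case False
      then have "b = 0" "a > 0" using \<open>a = 0 \<or> b = 0\<close> ab by auto
      then have "X \<le> (1 + e / a) * a" using X[of "e / a"] e by simp
      moreover have "(1 + e / a) * a = a + e" using \<open>a > 0\<close> by (simp add: field_simps)
      ultimately show ?thesis using \<open>b = 0\<close> by simp
    qed
    then have "X \<le> a + b" by (rule field_le_epsilon)
    then show ?thesis using True ab by auto
  qed
  then have "sqrt X \<le> \<bar>sqrt a + sqrt b\<bar>" by (metis real_sqrt_abs real_sqrt_le_mono)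
  then show ?thesis using ab by simp
qed

text \<open>The defect in the weighted estimate is itself a squared modulus. Having an identity
  instead of an inequality allows one quadratic form to be subtracted from another, as in
  \<open>nsq_difference_triangle\<close>.\<close>

lemma cmod_weighted_parallelogram:
  fixes u v :: complex
  assumes "s > 0"
  shows "(cmod (u + v))\<^sup>2 = (1 + s) * (cmod u)\<^sup>2 + (1 + 1 / s) * (cmod v)\<^sup>2
    - (cmod (complex_of_real (sqrt s) * u - complex_of_real (1 / sqrt s) * v))\<^sup>2"
proof -
  have s: "sqrt s * sqrt s = s" "sqrt s > 0" using assms by auto
  have "(Re u + Re v)\<^sup>2 = (1 + s) * (Re u)\<^sup>2 + (1 + 1 / s) * (Re v)\<^sup>2 - (sqrt s * Re u - (1 / sqrt s) * Re v)\<^sup>2"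
    "(Im u + Im v)\<^sup>2 = (1 + s) * (Im u)\<^sup>2 + (1 + 1 / s) * (Im v)\<^sup>2 - (sqrt s * Im u - (1 / sqrt s) * Im v)\<^sup>2"
    using s assms by (simp_all add: power2_sum power2_diff power_mult_distrib power_divide algebra_simps)
  then show ?thesis by (simp add: cmod_power2 algebra_simps)
qed

text \<open>Extension by one vector: the lower bounds from \<open>u - e\<close> lie below the upper
  bounds from \<open>v + e\<close> because \<open>e\<close> cancels in the sum. Any \<open>r\<close>
  in between works, after rescaling by the absolute value of \<open>t\<close>.\<close>

lemma hahn_banach_step:
  fixes h p :: "('a \<Rightarrow> complex) \<Rightarrow> real"
  assumes W: "(\<lambda>x. 0) \<in> W" "\<And>u v. u \<in> W \<Longrightarrow> v \<in> W \<Longrightarrow> (\<lambda>x. u x + v x) \<in> W"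
      "\<And>u t. u \<in> W \<Longrightarrow> (\<lambda>x. complex_of_real t * u x) \<in> W"
    and h: "\<And>u v. h (\<lambda>x. u x + v x) = h u + h v" "\<And>u t. h (\<lambda>x. complex_of_real t * u x) = t * h u"
    and p: "\<And>u v. p (\<lambda>x. u x + v x) \<le> p u + p v" "\<And>u t. t > 0 \<Longrightarrow> p (\<lambda>x. complex_of_real t * u x) = t * p u"
    and hp: "\<And>u. u \<in> W \<Longrightarrow> h u \<le> p u"
  shows "\<exists>r. \<forall>u\<in>W. \<forall>t. h u + t * r \<le> p (\<lambda>x. u x + complex_of_real t * e x)"
proof -
  have key: "h u - p (\<lambda>x. u x - e x) \<le> p (\<lambda>x. v x + e x) - h v" if "u \<in> W" "v \<in> W" for u v
  proof -
    have "h u + h v \<le> p (\<lambda>x. u x + v x)" using hp[OF W(2)[OF that]] h(1) by simp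
    also have "\<dots> = p (\<lambda>x. (u x - e x) + (v x + e x))" by simp
    also have "\<dots> \<le> p (\<lambda>x. u x - e x) + p (\<lambda>x. v x + e x)" by (rule p(1))
    finally show ?thesis by simp
  qed
  define r where "r = (SUP u\<in>W. h u - p (\<lambda>x. u x - e x))"
  have bdd: "bdd_above ((\<lambda>u. h u - p (\<lambda>x. u x - e x)) ` W)"
    using key[OF _ W(1)] by (intro bdd_aboveI2)
  have lo: "h u - p (\<lambda>x. u x - e x) \<le> r" if "u \<in> W" for u
    unfolding r_def by (rule cSUP_upper[OF that bdd])
  have up: "r \<le> p (\<lambda>x. v x + e x) - h v" if "v \<in> W" for v
    unfolding r_def by (rule cSUP_least) (use W(1) key that in auto)
  have "h u + t * r \<le> p (\<lambda>x. u x + complex_of_real t * e x)" if u: "u \<in> W" for u t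
  proof -
    consider "t = 0" | "t > 0" | "t < 0" by linarith
    then show ?thesis
    proof cases
      case 1
      then show ?thesis using hp[OF u] by simp
    next
      case 2
      have "t * (h (\<lambda>x. complex_of_real (1 / t) * u x) + r) \<le> t * p (\<lambda>x. complex_of_real (1 / t) * u x + e x)"
        using up[OF W(3)[OF u, of "1 / t"]] 2 by (intro mult_left_mono) auto
      also have "\<dots> = p (\<lambda>x. complex_of_real t * (complex_of_real (1 / t) * u x + e x))"
        by (rule p(2)[OF 2, symmetric])
      also have "(\<lambda>x. complex_of_real t * (complex_of_real (1 / t) * u x + e x)) = (\<lambda>x. u x + complex_of_real t * e x)"
        using 2 by (simp add: algebra_simps)
      finally show ?thesis using 2 h(2)[of "1 / t" u] by (simp add: distrib_left)
    next
      case 3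
      define s where "s = - t"
      have s: "s > 0" "t = - s" using 3 by (simp_all add: s_def)
      have "s * (h (\<lambda>x. complex_of_real (1 / s) * u x) - r) \<le> s * p (\<lambda>x. complex_of_real (1 / s) * u x - e x)"
        using lo[OF W(3)[OF u, of "1 / s"]] s by (intro mult_left_mono) auto
      also have "\<dots> = p (\<lambda>x. complex_of_real s * (complex_of_real (1 / s) * u x - e x))"
        by (rule p(2)[OF s(1), symmetric])
      also have "(\<lambda>x. complex_of_real s * (complex_of_real (1 / s) * u x - e x)) = (\<lambda>x. u x + complex_of_real t * e x)"
        using s by (simp add: algebra_simps)
      finally show ?thesis using s h(2)[of "1 / s" u] by (simp add: right_diff_distrib)
    qed
  qed
  then show ?thesis by blast
qed

text \<open>On the hyperplane \<open>u e = 0\<close> the functional is dominated by assumption. It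
  is extended first over the real, then over the imaginary multiples of the coordinate vector; since
  \<open>D\<close> vanishes there, the two real parameters found are all that is added.\<close>

lemma hahn_banach_coordinate:
  fixes D :: "('a \<Rightarrow> complex) \<Rightarrow> complex" and p :: "('a \<Rightarrow> complex) \<Rightarrow> real"
  assumes D: "\<And>u v. D (\<lambda>x. u x + v x) = D u + D v" "\<And>c u. D (\<lambda>x. c * u x) = c * D u"
    and p: "\<And>u v. p (\<lambda>x. u x + v x) \<le> p u + p v" "\<And>c u. p (\<lambda>x. c * u x) = cmod c * p u"
    and De: "D (\<lambda>x. if x = e then 1 else 0) = 0"
    and Dp: "\<And>u. u e = 0 \<Longrightarrow> cmod (D u) \<le> p u"
  shows "\<exists>x. \<forall>u. cmod (D u + x * u e) \<le> p u"
proof -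
  let ?e = "\<lambda>x. if x = e then 1 else 0 :: complex"
  have D0: "D (\<lambda>x. u x + c * ?e x) = D u" for u c
    unfolding D(1) using D(2)[of c ?e] De by simp
  have "\<exists>r. \<forall>u\<in>{u. u e = 0}. \<forall>t. Re (D u) + t * r \<le> p (\<lambda>x. u x + complex_of_real t * ?e x)"
    using complex_Re_le_cmod Dp
    by (intro hahn_banach_step) (auto simp: D p intro: order_trans)
  then obtain r where r: "\<And>u t. u e = 0 \<Longrightarrow> Re (D u) + t * r \<le> p (\<lambda>x. u x + complex_of_real t * ?e x)"
    by blast
  have r': "Re (D u) + Re (u e) * r \<le> p u" if "Im (u e) = 0" for u
  proof -
    have eq: "(\<lambda>x. (u x + (- u e) * ?e x) + complex_of_real (Re (u e)) * ?e x) = u"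
      using that by (auto simp: complex_eq_iff)
    have "Re (D (\<lambda>x. u x + (- u e) * ?e x)) + Re (u e) * r \<le> p u"
      using r[of "\<lambda>x. u x + (- u e) * ?e x" "Re (u e)"] unfolding eq by simp
    then show ?thesis unfolding D0 .
  qed
  have "\<exists>s. \<forall>u\<in>{u. Im (u e) = 0}. \<forall>t. (Re (D u) + Re (u e) * r) + t * s \<le> p (\<lambda>x. u x + complex_of_real t * (\<i> * ?e x))"
    using r' by (intro hahn_banach_step) (auto simp: D p distrib_left distrib_right mult.assoc)
  then obtain s where s: "\<And>u t. Im (u e) = 0 \<Longrightarrow> Re (D u) + Re (u e) * r + t * s \<le> p (\<lambda>x. u x + complex_of_real t * (\<i> * ?e x))"
    by blast
  \<comment> \<open>With this sign the real part of \<open>x * u e\<close> is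
    \<open>r * Re (u e) + s * Im (u e)\<close>.\<close>
  define x where "x = Complex r (- s)"
  have re: "Re (D u + x * u e) \<le> p u" for u
  proof -
    have eq: "(\<lambda>x. (u x + (- \<i> * Im (u e)) * ?e x) + complex_of_real (Im (u e)) * (\<i> * ?e x)) = u"
      by (auto simp: complex_eq_iff)
    have "Re (D (\<lambda>x. u x + (- \<i> * Im (u e)) * ?e x)) + Re (u e) * r + Im (u e) * s \<le> p u"
      using s[of "\<lambda>x. u x + (- \<i> * Im (u e)) * ?e x" "Im (u e)"] unfolding eq by simp
    then show ?thesis unfolding D0 by (simp add: x_def algebra_simps)
  qed
  have "cmod (D u + x * u e) \<le> p u" for u
  proof (cases "D u + x * u e = 0")
    case True
    have "0 \<le> p (\<lambda>x. 0 * u x)" by (subst p(2)) simp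
    moreover have "p (\<lambda>x. 0 * u x) \<le> p u + p (\<lambda>x. (-1) * u x)" using p(1)[of u "\<lambda>x. (-1) * u x"] by simp
    ultimately have "0 \<le> p u" unfolding p(2) by simp
    then show ?thesis using True by simp
  next
    case False
    define z where "z = D u + x * u e"
    \<comment> \<open>A unimodular factor rotates the value onto the positive real axis, where the
      bound on the real part bounds the modulus.\<close>
    define c where "c = cnj z / cmod z"
    have "D (\<lambda>x. c * u x) + x * (c * u e) = c * z" by (simp add: D(2) z_def algebra_simps)
    also have "c * z = cmod z"
      using False complex_norm_square[of z] by (simp add: c_def z_def[symmetric] mult.commute[of "cnj z"] power2_eq_square divide_eq_eq)
    finally have "Re (complex_of_real (cmod z)) \<le> p (\<lambda>x. c * u x)" using re[of "\<lambda>x. c * u x"] by simp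
    moreover have "cmod c = 1" using False by (simp add: c_def z_def[symmetric] norm_divide)
    ultimately show ?thesis by (simp add: p(2) z_def)
  qed
  then show ?thesis by blast
qed

section \<open>Square sums over finitely many coordinates\<close>

definition nsq :: "'a set \<Rightarrow> ('a \<Rightarrow> complex) \<Rightarrow> real" where
  "nsq A \<xi> = (\<Sum>w\<in>A. (cmod (\<xi> w))\<^sup>2)"

lemma nsq_nonneg [simp]: "0 \<le> nsq A \<xi>"
  by (simp add: nsq_def sum_nonneg)

lemma nsq_insert: "finite A \<Longrightarrow> x \<notin> A \<Longrightarrow> nsq (insert x A) \<xi> = (cmod (\<xi> x))\<^sup>2 + nsq A \<xi>"
  by (simp add: nsq_def)

lemma nsq_mono: "finite B \<Longrightarrow> A \<subseteq> B \<Longrightarrow> nsq A \<xi> \<le> nsq B \<xi>"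
  unfolding nsq_def by (rule sum_mono2) auto

lemma nsq_cong: "(\<And>w. w \<in> A \<Longrightarrow> \<xi> w = \<eta> w) \<Longrightarrow> nsq A \<xi> = nsq A \<eta>"
  unfolding nsq_def by (rule sum.cong) auto

lemma nsq_scale: "nsq A (\<lambda>w. c * \<xi> w) = (cmod c)\<^sup>2 * nsq A \<xi>"
  by (simp add: nsq_def norm_mult power_mult_distrib sum_distrib_left)

lemma nsq_weighted:
  assumes "s > 0"
  shows "nsq A (\<lambda>w. \<xi> w + \<eta> w) = (1 + s) * nsq A \<xi> + (1 + 1 / s) * nsq A \<eta>
    - nsq A (\<lambda>w. complex_of_real (sqrt s) * \<xi> w - complex_of_real (1 / sqrt s) * \<eta> w)"
  unfolding nsq_def cmod_weighted_parallelogram[OF assms]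
  by (simp add: sum.distrib sum_subtractf sum_distrib_left)

lemma nsq_triangle: "sqrt (nsq A (\<lambda>w. \<xi> w + \<eta> w)) \<le> sqrt (nsq A \<xi>) + sqrt (nsq A \<eta>)"
  using nsq_weighted[of _ A \<xi> \<eta>] by (intro sqrt_triangle_of_weighted) auto

lemma nc_mult_add_right: "nc_mult a (\<lambda>w. \<xi> w + \<eta> w) = (\<lambda>w. nc_mult a \<xi> w + nc_mult a \<eta> w)"
  by (simp add: nc_mult_def algebra_simps sum.distrib)

lemma nc_mult_scale_right: "nc_mult a (\<lambda>w. c * \<xi> w) = (\<lambda>w. c * nc_mult a \<xi> w)"
  by (simp add: nc_mult_def algebra_simps sum_distrib_left)

lemma nc_mult_diff_right: "nc_mult a (\<lambda>w. \<xi> w - \<eta> w) = (\<lambda>w. nc_mult a \<xi> w - nc_mult a \<eta> w)"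
  by (simp add: nc_mult_def algebra_simps sum_subtractf)

lemma nc_mult_add_left: "nc_mult (\<lambda>w. \<xi> w + \<eta> w) a = (\<lambda>w. nc_mult \<xi> a w + nc_mult \<eta> a w)"
  by (simp add: nc_mult_def algebra_simps sum.distrib)

lemma nc_mult_diff_left: "nc_mult (\<lambda>w. \<xi> w - \<eta> w) a = (\<lambda>w. nc_mult \<xi> a w - nc_mult \<eta> a w)"
  by (simp add: nc_mult_def algebra_simps sum_subtractf)

lemma nc_mult_scale_left: "nc_mult (\<lambda>w. c * \<xi> w) a = (\<lambda>w. c * nc_mult \<xi> a w)"
  by (simp add: nc_mult_def algebra_simps sum_distrib_left)

text \<open>By \<open>pos\<close> the difference of the two quadratic forms is positive
  semidefinite. Its weighted parallelogram defect is the same difference at one more vector, hence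
  nonnegative.\<close>

lemma nsq_difference_triangle:
  assumes pos: "\<And>\<xi>. nsq R (nc_mult f \<xi>) \<le> C * nsq A \<xi>"
  shows "sqrt (C * nsq A (\<lambda>w. \<xi> w + \<eta> w) - nsq R (nc_mult f (\<lambda>w. \<xi> w + \<eta> w)))
    \<le> sqrt (C * nsq A \<xi> - nsq R (nc_mult f \<xi>)) + sqrt (C * nsq A \<eta> - nsq R (nc_mult f \<eta>))"
proof (rule sqrt_triangle_of_weighted)
  fix s :: real assume s: "s > 0"
  let ?\<zeta> = "\<lambda>w. complex_of_real (sqrt s) * \<xi> w - complex_of_real (1 / sqrt s) * \<eta> w"
  have "nc_mult f ?\<zeta> = (\<lambda>w. complex_of_real (sqrt s) * nc_mult f \<xi> w - complex_of_real (1 / sqrt s) * nc_mult f \<eta> w)"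
    by (simp only: nc_mult_diff_right nc_mult_scale_right)
  then have "nsq R (\<lambda>w. complex_of_real (sqrt s) * nc_mult f \<xi> w - complex_of_real (1 / sqrt s) * nc_mult f \<eta> w) \<le> C * nsq A ?\<zeta>"
    using pos[of ?\<zeta>] by simp
  then show "C * nsq A (\<lambda>w. \<xi> w + \<eta> w) - nsq R (nc_mult f (\<lambda>w. \<xi> w + \<eta> w)) \<le>
      (1 + s) * (C * nsq A \<xi> - nsq R (nc_mult f \<xi>)) + (1 + 1 / s) * (C * nsq A \<eta> - nsq R (nc_mult f \<eta>))"
    unfolding nc_mult_add_right nsq_weighted[OF s] by (simp only: algebra_simps)
qed (use pos in auto)

section \<open>Lifting truncated multipliers\<close>

lemma nc_mult_eqI:
  assumes "\<And>k. k \<le> length w \<Longrightarrow> a (take k w) * \<xi> (drop k w) = b (take k w) * \<eta> (drop k w)"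
  shows "nc_mult a \<xi> w = nc_mult b \<eta> w"
  unfolding nc_mult_def by (rule sum.cong) (use assms in auto)

locale word_lang =
  fixes d :: nat and L :: "nat list set"
  assumes L_words: "L \<subseteq> words d" and L_factor: "u @ v @ w \<in> L \<Longrightarrow> v \<in> L"
begin

lemma L_append1: "u @ v \<in> L \<Longrightarrow> u \<in> L"
  using L_factor[of "[]" u v] by simp

lemma L_append2: "u @ v \<in> L \<Longrightarrow> v \<in> L"
  using L_factor[of u v "[]"] by simp

lemma L_take: "w \<in> L \<Longrightarrow> take k w \<in> L"
  using L_append1[of "take k w" "drop k w"] by simp

lemma L_drop: "w \<in> L \<Longrightarrow> drop k w \<in> L"
  using L_append2[of "take k w" "drop k w"] by simp

definition Lw :: "nat \<Rightarrow> nat list set" where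
  "Lw M = {w \<in> L. length w \<le> M}"

lemma finite_Lw [simp]: "finite (Lw M)"
proof (rule finite_subset)
  show "Lw M \<subseteq> {w. set w \<subseteq> {..<d} \<and> length w \<le> M}"
    using L_words by (auto simp: Lw_def words_def)
qed (simp add: finite_lists_length_le)

text \<open>The word \<open>\<mu> @ \<nu>\<close> with \<open>\<mu>\<close> of length \<open>N\<close> indexes the entry \<open>\<nu>\<close> of the component \<open>\<mu>\<close> of a column
  operator; the word itself need not be in \<open>L\<close>.\<close>

definition rows :: "nat \<Rightarrow> nat \<Rightarrow> nat list set" where
  "rows N M = {\<kappa>. N \<le> length \<kappa> \<and> length \<kappa> \<le> N + M \<and> take N \<kappa> \<in> L \<and> drop N \<kappa> \<in> L}"

lemma finite_rows [simp]: "finite (rows N M)"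
proof (rule finite_subset)
  show "rows N M \<subseteq> {w. set w \<subseteq> {..<d} \<and> length w \<le> N + M}"
  proof
    fix w assume w: "w \<in> rows N M"
    then have "take N w \<in> words d" "drop N w \<in> words d" using L_words by (auto simp: rows_def)
    then have "take N w @ drop N w \<in> words d" unfolding words_append by simp
    then show "w \<in> {w. set w \<subseteq> {..<d} \<and> length w \<le> N + M}" using w by (auto simp: rows_def words_iff)
  qed
qed (simp add: finite_lists_length_le)

lemma rows_take:
  assumes "\<kappa> \<in> rows N M" "N \<le> k" "k \<le> N + M'"
  shows "take k \<kappa> \<in> rows N M'"
proof -
  have "drop N (take k \<kappa>) \<in> L" using assms L_take[of "drop N \<kappa>" "k - N"] by (simp add: rows_def drop_take)
  then show ?thesis using assms by (auto simp: rows_def min_def)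
qed

lemma rows_drop:
  assumes "\<kappa> \<in> rows N M" "N \<le> k"
  shows "drop k \<kappa> \<in> Lw M"
proof -
  have "drop k \<kappa> \<in> L" using assms L_drop[of "drop N \<kappa>" "k - N"] by (simp add: rows_def)
  then show ?thesis using assms by (auto simp: rows_def Lw_def)
qed

text \<open>Prefixes shorter than \<open>N\<close> contribute nothing, and the suffix left by a
  longer prefix of a row lies in \<open>Lw M\<close>.\<close>

lemma nc_mult_rows_cong:
  assumes "\<kappa> \<in> rows N M" "\<And>w. length w < N \<Longrightarrow> f w = 0" "\<And>w. w \<in> Lw M \<Longrightarrow> \<xi> w = \<eta> w"
  shows "nc_mult f \<xi> \<kappa> = nc_mult f \<eta> \<kappa>"
proof (rule nc_mult_eqI)
  fix k assume "k \<le> length \<kappa>"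
  then show "f (take k \<kappa>) * \<xi> (drop k \<kappa>) = f (take k \<kappa>) * \<eta> (drop k \<kappa>)"
    using assms(2)[of "take k \<kappa>"] assms(3)[OF rows_drop[OF assms(1)], of k] by (cases "N \<le> k") auto
qed

text \<open>Multiplication on the left does not see the last \<open>s\<close> letters:
  \<open>\<xi>\<close> splits orthogonally according to them, and each part is multiplied like a
  vector of words shorter by \<open>s\<close>. A bound for the rows in \<open>R\<close> thus covers
  all rows that land in \<open>R\<close> when \<open>s\<close> letters are removed. It serves with
  \<open>s = 1\<close> in the extension step and with the windows of degrees in the
  averaging.\<close>

lemma suffix_split_bound:
  assumes fin: "finite A" "finite R" "finite X" and C: "C \<ge> 0"
    and f: "\<And>w. length w < N \<Longrightarrow> f w = 0"
    and \<xi>: "\<And>w. length w < s \<Longrightarrow> \<xi> w = 0" "\<And>w. w \<notin> X \<Longrightarrow> \<xi> w = 0"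
    and AR: "\<And>\<kappa>. \<kappa> \<in> A \<Longrightarrow> N + s \<le> length \<kappa> \<Longrightarrow> take (length \<kappa> - s) \<kappa> \<in> R"
    and bound: "\<And>\<xi>. nsq R (nc_mult f \<xi>) \<le> C * nsq (Lw M) \<xi>"
  shows "nsq A (nc_mult f \<xi>) \<le> C * nsq X \<xi>"
proof -
  define A' where "A' = {\<kappa> \<in> A. N + s \<le> length \<kappa>}"
  define B where "B = (\<lambda>\<kappa>. drop (length \<kappa> - s) \<kappa>) ` A'"
  have fin': "finite A'" "finite B" using fin by (auto simp: A'_def B_def)
  have lenB: "length \<beta> = s" if "\<beta> \<in> B" for \<beta> using that by (auto simp: B_def A'_def)
  have zero: "nc_mult f \<xi> \<kappa> = 0" if "length \<kappa> < N + s" for \<kappa>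
    unfolding nc_mult_def
  proof (intro sum.neutral ballI)
    fix k assume "k \<in> {..length \<kappa>}"
    then show "f (take k \<kappa>) * \<xi> (drop k \<kappa>) = 0"
      using f[of "take k \<kappa>"] \<xi>(1)[of "drop k \<kappa>"] that by (cases "k < N") auto
  qed
  have zero': "N + s \<le> length \<kappa>" if "nc_mult f \<xi> \<kappa> \<noteq> 0" for \<kappa>
    using zero that by (meson not_le)
  \<comment> \<open>A cut inside \<open>\<beta>\<close> leaves a suffix shorter than
    \<open>s\<close>, where \<open>\<xi>\<close> vanishes.\<close>
  have split: "nc_mult f \<xi> (\<kappa> @ \<beta>) = nc_mult f (\<lambda>w. \<xi> (w @ \<beta>)) \<kappa>" if "length \<beta> = s" for \<kappa> \<beta>
  proof -
    have "nc_mult f \<xi> (\<kappa> @ \<beta>) = (\<Sum>k\<le>length \<kappa>. f (take k (\<kappa> @ \<beta>)) * \<xi> (drop k (\<kappa> @ \<beta>)))"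
      unfolding nc_mult_def by (rule sum.mono_neutral_right) (use \<xi>(1) that in auto)
    also have "\<dots> = nc_mult f (\<lambda>w. \<xi> (w @ \<beta>)) \<kappa>"
      unfolding nc_mult_def by (rule sum.cong) auto
    finally show ?thesis .
  qed
  have "nsq A (nc_mult f \<xi>) = nsq A' (nc_mult f \<xi>)"
    unfolding nsq_def by (rule sum.mono_neutral_right) (use fin zero' in \<open>auto simp: A'_def\<close>)
  also have "\<dots> = (\<Sum>(\<beta>, \<kappa>)\<in>(\<lambda>\<kappa>. (drop (length \<kappa> - s) \<kappa>, take (length \<kappa> - s) \<kappa>)) ` A'.
      (cmod (nc_mult f (\<lambda>w. \<xi> (w @ \<beta>)) \<kappa>))\<^sup>2)"
  proof (subst sum.reindex)
    show "inj_on (\<lambda>\<kappa>. (drop (length \<kappa> - s) \<kappa>, take (length \<kappa> - s) \<kappa>)) A'"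
      by (rule inj_onI) (metis append_take_drop_id prod.inject)
    show "nsq A' (nc_mult f \<xi>) = sum ((\<lambda>(\<beta>, \<kappa>). (cmod (nc_mult f (\<lambda>w. \<xi> (w @ \<beta>)) \<kappa>))\<^sup>2) \<circ>
        (\<lambda>\<kappa>. (drop (length \<kappa> - s) \<kappa>, take (length \<kappa> - s) \<kappa>))) A'"
      unfolding nsq_def
    proof (rule sum.cong)
      fix \<kappa> assume "\<kappa> \<in> A'"
      then have "length (drop (length \<kappa> - s) \<kappa>) = s" by (simp add: A'_def)
      from split[OF this, of "take (length \<kappa> - s) \<kappa>"]
      show "(cmod (nc_mult f \<xi> \<kappa>))\<^sup>2 = ((\<lambda>(\<beta>, \<kappa>). (cmod (nc_mult f (\<lambda>w. \<xi> (w @ \<beta>)) \<kappa>))\<^sup>2) \<circ>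
        (\<lambda>\<kappa>. (drop (length \<kappa> - s) \<kappa>, take (length \<kappa> - s) \<kappa>))) \<kappa>" by simp
    qed simp
  qed
  also have "\<dots> \<le> (\<Sum>(\<beta>, \<kappa>)\<in>B \<times> R. (cmod (nc_mult f (\<lambda>w. \<xi> (w @ \<beta>)) \<kappa>))\<^sup>2)"
    using fin fin' AR by (intro sum_mono2) (auto simp: B_def A'_def)
  also have "\<dots> = (\<Sum>\<beta>\<in>B. nsq R (nc_mult f (\<lambda>w. \<xi> (w @ \<beta>))))"
    by (simp add: nsq_def sum.cartesian_product)
  also have "\<dots> \<le> (\<Sum>\<beta>\<in>B. C * nsq (Lw M) (\<lambda>w. \<xi> (w @ \<beta>)))"
    by (intro sum_mono bound)
  also have "\<dots> = C * (\<Sum>(\<beta>, w)\<in>B \<times> Lw M. (cmod (\<xi> (w @ \<beta>)))\<^sup>2)"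
    by (simp add: nsq_def sum.cartesian_product sum_distrib_left case_prod_unfold)
  also have "(\<Sum>(\<beta>, w)\<in>B \<times> Lw M. (cmod (\<xi> (w @ \<beta>)))\<^sup>2) = sum ((\<lambda>w. (cmod (\<xi> w))\<^sup>2) \<circ> (\<lambda>(\<beta>, w). w @ \<beta>)) (B \<times> Lw M)"
    by (rule sum.cong) auto
  also have "\<dots> = (\<Sum>w\<in>(\<lambda>(\<beta>, w). w @ \<beta>) ` (B \<times> Lw M). (cmod (\<xi> w))\<^sup>2)"
    by (rule sum.reindex[symmetric]) (use lenB in \<open>auto simp: inj_on_def\<close>)
  also have "\<dots> = (\<Sum>w\<in>(\<lambda>(\<beta>, w). w @ \<beta>) ` (B \<times> Lw M) \<inter> X. (cmod (\<xi> w))\<^sup>2)"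
    by (rule sum.mono_neutral_right) (use fin fin' \<xi>(2) in \<open>auto\<close>)
  also have "\<dots> \<le> nsq X \<xi>"
    unfolding nsq_def by (rule sum_mono2) (use fin in auto)
  finally show ?thesis using C by (simp add: mult_left_mono)
qed

text \<open>The free coefficient \<open>f \<mu>\<close> only acts through \<open>\<xi> []\<close>. On vectors with \<open>\<xi> [] = 0\<close>, splitting
  off the last letter reduces the bound for the new row to the bound for the old ones, and the
  functional given by the new row extends with respect to the seminorm
  \<open>p\<close> (Parrott's lemma for a scalar corner).\<close>

lemma lift_step:
  assumes R: "R \<subseteq> rows N M" and \<mu>: "\<mu> \<in> rows N M" "\<mu> \<notin> R" "N < length \<mu>" and C: "C \<ge> 0"
    and closed: "\<And>\<kappa> k. \<kappa> \<in> insert \<mu> R \<Longrightarrow> N \<le> k \<Longrightarrow> k < length \<kappa> \<Longrightarrow> take k \<kappa> \<in> R"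
    and f: "\<And>w. length w < N \<Longrightarrow> f w = 0"
    and bound: "\<And>\<xi>. nsq R (nc_mult f \<xi>) \<le> C * nsq (Lw M) \<xi>"
  shows "\<exists>x. \<forall>\<xi>. nsq (insert \<mu> R) (nc_mult (f(\<mu> := x)) \<xi>) \<le> C * nsq (Lw M) \<xi>"
proof -
  have finR: "finite R" using R finite_rows finite_subset by blast
  \<comment> \<open>No row of \<open>R\<close> has \<open>\<mu>\<close> as a prefix, since
    \<open>R\<close> contains the relevant prefixes of its rows but not \<open>\<mu>\<close>. The
    old rows therefore ignore the new coefficient.\<close>
  have upd: "nc_mult (f(\<mu> := x)) \<xi> \<kappa> = nc_mult f \<xi> \<kappa>" if "\<kappa> \<in> R" for \<kappa> x \<xi>
  proof (rule nc_mult_eqI)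
    fix k assume k: "k \<le> length \<kappa>"
    have "take k \<kappa> \<noteq> \<mu>"
    proof
      assume eq: "take k \<kappa> = \<mu>"
      then have "N \<le> k" using \<mu>(3) by auto
      show False
      proof (cases "k < length \<kappa>")
        case True
        then show ?thesis using closed[of \<kappa> k] that \<open>N \<le> k\<close> eq \<mu>(2) by auto
      next
        case False
        then show ?thesis using that eq \<mu>(2) by auto
      qed
    qed
    then show "(f(\<mu> := x)) (take k \<kappa>) * \<xi> (drop k \<kappa>) = f (take k \<kappa>) * \<xi> (drop k \<kappa>)" by simp
  qed
  have upd_nsq: "nsq R (nc_mult (f(\<mu> := x)) \<xi>) = nsq R (nc_mult f \<xi>)" for x \<xi>
    by (rule nsq_cong) (rule upd)
  define D where "D \<xi> = nc_mult (f(\<mu> := 0)) \<xi> \<mu>" for \<xi>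
  define p where "p \<xi> = sqrt (C * nsq (Lw M) \<xi> - nsq R (nc_mult f \<xi>))" for \<xi>
  have f': "(f(\<mu> := x)) w = 0" if "length w < N" for w x using f that \<mu>(3) by auto
  have row: "nc_mult (f(\<mu> := x)) \<xi> \<mu> = D \<xi> + x * \<xi> []" for x \<xi>
  proof -
    have "f(\<mu> := x) = (\<lambda>w. (f(\<mu> := 0)) w + x * monom_word \<mu> w)" by (auto simp: monom_word_def)
    moreover have "nc_mult (monom_word \<mu>) \<xi> \<mu> = \<xi> []"
    proof -
      have "nc_mult (monom_word \<mu>) \<xi> \<mu> = (\<Sum>k\<in>{length \<mu>}. monom_word \<mu> (take k \<mu>) * \<xi> (drop k \<mu>))"
        unfolding nc_mult_def
        by (rule sum.mono_neutral_right) (auto simp: monom_word_def take_all_iff dest!: arg_cong[where f = length])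
      then show ?thesis by (simp add: monom_word_def)
    qed
    ultimately show ?thesis by (simp only: nc_mult_add_left nc_mult_scale_left D_def)
  qed
  have "\<exists>x. \<forall>u. cmod (D u + x * u []) \<le> p u"
  proof (rule hahn_banach_coordinate)
    show "D (\<lambda>x. u x + v x) = D u + D v" "D (\<lambda>x. c * u x) = c * D u" for u v c
      by (simp_all only: D_def nc_mult_add_right nc_mult_scale_right)
    show "p (\<lambda>x. u x + v x) \<le> p u + p v" for u v
      unfolding p_def by (rule nsq_difference_triangle[OF bound])
    show "p (\<lambda>x. c * u x) = cmod c * p u" for c u
    proof -
      have "C * nsq (Lw M) (\<lambda>x. c * u x) - nsq R (nc_mult f (\<lambda>x. c * u x)) =
          (cmod c)\<^sup>2 * (C * nsq (Lw M) u - nsq R (nc_mult f u))"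
        by (simp add: nc_mult_scale_right nsq_scale algebra_simps)
      then show ?thesis by (simp add: p_def real_sqrt_mult)
    qed
    show "D (\<lambda>x. if x = [] then 1 else 0) = 0"
      unfolding D_def nc_mult_def by (auto intro!: sum.neutral)
    show "cmod (D u) \<le> p u" if u: "u [] = 0" for u
    proof -
      \<comment> \<open>Truncation to \<open>Lw M\<close> provides the finite support that
        \<open>suffix_split_bound\<close> asks for; the rows considered do not notice it.\<close>
      define u' where "u' = (\<lambda>w. if w \<in> Lw M then u w else 0)"
      have cong: "nc_mult (f(\<mu> := 0)) u \<kappa> = nc_mult (f(\<mu> := 0)) u' \<kappa>" if "\<kappa> \<in> rows N M" for \<kappa>
        by (rule nc_mult_rows_cong[OF that]) (rule f', assumption, simp add: u'_def)
      have "nsq (insert \<mu> R) (nc_mult (f(\<mu> := 0)) u) = nsq (insert \<mu> R) (nc_mult (f(\<mu> := 0)) u')"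
        by (rule nsq_cong) (use R \<mu>(1) cong in auto)
      also have "\<dots> \<le> C * nsq (Lw M) u'"
      proof (rule suffix_split_bound[OF _ finR _ C, where N = N and s = 1 and M = M])
        show "nsq R (nc_mult (f(\<mu> := 0)) \<xi>) \<le> C * nsq (Lw M) \<xi>" for \<xi> unfolding upd_nsq by (rule bound)
        show "take (length \<kappa> - 1) \<kappa> \<in> R" if "\<kappa> \<in> insert \<mu> R" "N + 1 \<le> length \<kappa>" for \<kappa>
          using closed[OF that(1), of "length \<kappa> - 1"] that(2) by simp
      qed (use finR f' u in \<open>auto simp: u'_def\<close>)
      also have "nsq (Lw M) u' = nsq (Lw M) u" by (rule nsq_cong) (simp add: u'_def)
      finally have "(cmod (D u))\<^sup>2 + nsq R (nc_mult f u) \<le> C * nsq (Lw M) u"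
        unfolding nsq_insert[OF finR \<mu>(2)] upd_nsq D_def .
      then have "(cmod (D u))\<^sup>2 \<le> C * nsq (Lw M) u - nsq R (nc_mult f u)" by simp
      from real_sqrt_le_mono[OF this] show ?thesis by (simp add: p_def)
    qed
  qed
  then obtain x where x: "\<And>u. cmod (D u + x * u []) \<le> p u" by blast
  have "nsq (insert \<mu> R) (nc_mult (f(\<mu> := x)) \<xi>) \<le> C * nsq (Lw M) \<xi>" for \<xi>
  proof -
    have "(cmod (D \<xi> + x * \<xi> []))\<^sup>2 \<le> (p \<xi>)\<^sup>2" using x by (intro power_mono) auto
    also have "\<dots> = C * nsq (Lw M) \<xi> - nsq R (nc_mult f \<xi>)" using bound[of \<xi>] by (simp add: p_def)
    finally show ?thesis
      unfolding nsq_insert[OF finR \<mu>(2)] upd_nsq row by simp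
  qed
  then show ?thesis by blast
qed

text \<open>Missing rows are filled in order of increasing length, so that the proper prefixes of
  length at least \<open>N\<close> of the current word are already present.\<close>

lemma lift_rows:
  assumes "R \<subseteq> rows N M" and "{\<kappa> \<in> rows N M. \<kappa> \<in> L} \<subseteq> R" and C: "C \<ge> 0"
    and "\<And>\<kappa> k. \<kappa> \<in> R \<Longrightarrow> N \<le> k \<Longrightarrow> k < length \<kappa> \<Longrightarrow> take k \<kappa> \<in> R"
    and "\<And>w. length w < N \<Longrightarrow> f w = 0"
    and "\<And>\<xi>. nsq R (nc_mult f \<xi>) \<le> C * nsq (Lw M) \<xi>"
  shows "\<exists>F. (\<forall>\<kappa>\<in>R. F \<kappa> = f \<kappa>) \<and> (\<forall>w. length w < N \<longrightarrow> F w = 0) \<and>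
    (\<forall>\<xi>. nsq (rows N M) (nc_mult F \<xi>) \<le> C * nsq (Lw M) \<xi>)"
  using assms(1,2,4-)
proof (induction "card (rows N M - R)" arbitrary: R f rule: less_induct)
  case less
  show ?case
  proof (cases "R = rows N M")
    case True
    then show ?thesis using less.prems by (intro exI[of _ f]) auto
  next
    case False
    then have "\<exists>\<mu>. \<mu> \<in> rows N M - R" using less.prems(1) by blast
    then obtain \<mu> where \<mu>: "\<mu> \<in> rows N M - R" "\<And>\<nu>. \<nu> \<in> rows N M - R \<Longrightarrow> length \<mu> \<le> length \<nu>"
      using ex_has_least_nat[of "\<lambda>\<mu>. \<mu> \<in> rows N M - R" _ length] by blast
    \<comment> \<open>A row of length \<open>N\<close> is itself a word of \<open>L\<close> and so
      was never missing; the strict inequality leaves a letter to split off.\<close>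
    have N: "N < length \<mu>"
    proof (rule ccontr)
      assume "\<not> N < length \<mu>"
      then have "\<mu> \<in> L" using \<mu>(1) by (simp add: rows_def)
      then show False using \<mu>(1) less.prems(2) by blast
    qed
    have cl: "take k \<kappa> \<in> R" if "\<kappa> \<in> insert \<mu> R" "N \<le> k" "k < length \<kappa>" for \<kappa> k
    proof (cases "\<kappa> = \<mu>")
      case True
      have "take k \<mu> \<in> rows N M" using \<mu>(1) that True by (intro rows_take[of \<mu> N M]) (auto simp: rows_def)
      then show ?thesis using \<mu>(2)[of "take k \<mu>"] that True by auto
    next
      case False
      then show ?thesis using that less.prems(3) by blast
    qed
    obtain x where x: "\<And>\<xi>. nsq (insert \<mu> R) (nc_mult (f(\<mu> := x)) \<xi>) \<le> C * nsq (Lw M) \<xi>"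
      using lift_step[OF less.prems(1) _ _ N C cl less.prems(4,5)] \<mu>(1) by blast
    have "\<exists>F. (\<forall>\<kappa>\<in>insert \<mu> R. F \<kappa> = (f(\<mu> := x)) \<kappa>) \<and> (\<forall>w. length w < N \<longrightarrow> F w = 0) \<and>
      (\<forall>\<xi>. nsq (rows N M) (nc_mult F \<xi>) \<le> C * nsq (Lw M) \<xi>)"
    proof (rule less.hyps)
      show "card (rows N M - insert \<mu> R) < card (rows N M - R)"
        using \<mu>(1) by (intro psubset_card_mono) auto
      show "take k \<kappa> \<in> insert \<mu> R" if "\<kappa> \<in> insert \<mu> R" "N \<le> k" "k < length \<kappa>" for \<kappa> k
        using cl[OF that] by simp
      show "nsq (insert \<mu> R) (nc_mult (f(\<mu> := x)) \<xi>) \<le> C * nsq (Lw M) \<xi>" for \<xi> by (rule x)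
    qed (use \<mu> N less.prems in auto)
    then show ?thesis using \<mu>(1) by (metis DiffD2 fun_upd_other insertI2)
  qed
qed

text \<open>The rows that are words of \<open>L\<close> are coordinates of a product with
  \<open>a\<close> and inherit its bound. The other rows belong to coefficients that the quotient
  does not see, so they are free to be chosen.\<close>

lemma lift_truncated:
  assumes C: "C \<ge> 0" and a: "\<And>w. a w \<noteq> 0 \<Longrightarrow> N \<le> length w"
    and bound: "\<And>M \<xi>. nsq (Lw M) (nc_mult a \<xi>) \<le> C * nsq (Lw M) \<xi>"
  shows "\<exists>F. (\<forall>\<kappa>\<in>rows N M. \<kappa> \<in> L \<longrightarrow> F \<kappa> = a \<kappa>) \<and> (\<forall>w. length w < N \<longrightarrow> F w = 0) \<and>
    (\<forall>\<xi>. nsq (rows N M) (nc_mult F \<xi>) \<le> C * nsq (Lw M) \<xi>)"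
proof -
  define R where "R = {\<kappa> \<in> rows N M. \<kappa> \<in> L}"
  have a0: "a w = 0" if "length w < N" for w using a[of w] that by auto
  have "nsq R (nc_mult a \<xi>) \<le> C * nsq (Lw M) \<xi>" for \<xi>
  proof -
    define \<xi>' where "\<xi>' = (\<lambda>w. if w \<in> Lw M then \<xi> w else 0)"
    have "nsq R (nc_mult a \<xi>) = nsq R (nc_mult a \<xi>')"
    proof (rule nsq_cong)
      fix \<kappa> assume "\<kappa> \<in> R"
      then show "nc_mult a \<xi> \<kappa> = nc_mult a \<xi>' \<kappa>"
        by (intro nc_mult_rows_cong[where N = N and M = M]) (auto simp: R_def \<xi>'_def a0)
    qed
    also have "\<dots> \<le> nsq (Lw (N + M)) (nc_mult a \<xi>')"
      by (rule nsq_mono[OF finite_Lw]) (auto simp: R_def Lw_def rows_def)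
    also have "\<dots> \<le> C * nsq (Lw (N + M)) \<xi>'" by (rule bound)
    also have "nsq (Lw (N + M)) \<xi>' = nsq (Lw M) \<xi>"
      unfolding nsq_def by (rule sum.mono_neutral_cong_right, rule finite_Lw) (auto simp: \<xi>'_def Lw_def)
    finally show ?thesis .
  qed
  moreover have "take k \<kappa> \<in> R" if "\<kappa> \<in> R" "N \<le> k" "k < length \<kappa>" for \<kappa> k
    using that rows_take[of \<kappa> N M k M] L_take[of \<kappa> k] by (auto simp: R_def rows_def)
  ultimately have "\<exists>F. (\<forall>\<kappa>\<in>R. F \<kappa> = a \<kappa>) \<and> (\<forall>w. length w < N \<longrightarrow> F w = 0) \<and>
    (\<forall>\<xi>. nsq (rows N M) (nc_mult F \<xi>) \<le> C * nsq (Lw M) \<xi>)"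
    by (intro lift_rows[OF _ _ C _ a0]) (auto simp: R_def)
  then show ?thesis by (auto simp: R_def)
qed

text \<open>The Fejer weights arise by averaging the truncations of the operator to the windows of
  \<open>M + 1\<close> consecutive degrees; each window satisfies the bound of the truncated lift.\<close>

lemma fejer_lift:
  assumes C: "C \<ge> 0" and a: "\<And>w. a w \<noteq> 0 \<Longrightarrow> N \<le> length w"
    and bound: "\<And>M \<xi>. nsq (Lw M) (nc_mult a \<xi>) \<le> C * nsq (Lw M) \<xi>"
  shows "\<exists>G. (\<forall>w. G w \<noteq> 0 \<longrightarrow> w \<in> rows N M) \<and>
    (\<forall>\<kappa>\<in>L. N \<le> length \<kappa> \<longrightarrow> length \<kappa> \<le> N + M \<longrightarrow>
      G \<kappa> = of_real (1 - real (length \<kappa> - N) / real (M + 1)) * a \<kappa>) \<and>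
    (\<forall>M' \<xi>. nsq (rows N M') (nc_mult G \<xi>) \<le> C * nsq (Lw M') \<xi>)"
proof -
  obtain F where F: "\<And>\<kappa>. \<kappa> \<in> rows N M \<Longrightarrow> \<kappa> \<in> L \<Longrightarrow> F \<kappa> = a \<kappa>" "\<And>w. length w < N \<Longrightarrow> F w = 0"
      "\<And>\<xi>. nsq (rows N M) (nc_mult F \<xi>) \<le> C * nsq (Lw M) \<xi>"
    using lift_truncated[OF C a bound, of M] by blast
  define G where "G \<kappa> = (if \<kappa> \<in> rows N M then of_real (1 - real (length \<kappa> - N) / real (M + 1)) * F \<kappa> else 0)" for \<kappa>
  have "G \<kappa> = of_real (1 - real (length \<kappa> - N) / real (M + 1)) * a \<kappa>"
    if "\<kappa> \<in> L" "N \<le> length \<kappa>" "length \<kappa> \<le> N + M" for \<kappa>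
  proof -
    have "\<kappa> \<in> rows N M" using that L_take[of \<kappa> N] L_drop[of \<kappa> N] by (simp add: rows_def)
    then show ?thesis using F(1) that by (simp add: G_def)
  qed
  moreover have "nsq (rows N M') (nc_mult G \<xi>0) \<le> C * nsq (Lw M') \<xi>0" for M' \<xi>0
  proof -
    define \<xi> where "\<xi> w = (if w \<in> Lw M' then \<xi>0 w else 0)" for w
    define \<xi>t where "\<xi>t t w = (if length w \<le> t \<and> t \<le> length w + M then \<xi> w else 0)" for t w
    \<comment> \<open>A row of degree j beyond \<open>N\<close> meets the \<open>M + 1\<close>
      windows t from j to j + \<open>M\<close>. A coefficient of degree i beyond \<open>N\<close>
      survives in \<open>M + 1\<close> - i of them, which is \<open>M + 1\<close> times its Fejer
      weight.\<close>
    have win: "of_nat (M + 1) * nc_mult G \<xi> \<kappa> = (\<Sum>t\<in>{length \<kappa> - N..length \<kappa> - N + M}. nc_mult F (\<xi>t t) \<kappa>)"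
      if \<kappa>: "\<kappa> \<in> rows N M'" for \<kappa>
    proof -
      have "of_nat (M + 1) * (G (take k \<kappa>) * \<xi> (drop k \<kappa>)) =
          (\<Sum>t\<in>{length \<kappa> - N..length \<kappa> - N + M}. F (take k \<kappa>) * \<xi>t t (drop k \<kappa>))" if k: "k \<le> length \<kappa>" for k
      proof (cases "N \<le> k")
        case False
        then have "F (take k \<kappa>) = 0" using F(2) by simp
        then show ?thesis by (simp add: G_def)
      next
        case True
        have "(\<Sum>t\<in>{length \<kappa> - N..length \<kappa> - N + M}. F (take k \<kappa>) * \<xi>t t (drop k \<kappa>)) =
            (\<Sum>t\<in>{length \<kappa> - N..length \<kappa> - k + M}. F (take k \<kappa>) * \<xi> (drop k \<kappa>))"
          by (rule sum.mono_neutral_cong_right) (use True k in \<open>auto simp: \<xi>t_def\<close>)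
        also have "\<dots> = of_nat (Suc (length \<kappa> - k + M) - (length \<kappa> - N)) * (F (take k \<kappa>) * \<xi> (drop k \<kappa>))"
          by simp
        also have "\<dots> = of_nat (M + 1) * (G (take k \<kappa>) * \<xi> (drop k \<kappa>))"
        proof (cases "k \<le> N + M")
          case kM: True
          have "Suc (length \<kappa> - k + M) - (length \<kappa> - N) = M + 1 - (k - N)" using True k by simp
          moreover have "of_nat (M + 1 - (k - N)) = (of_nat (M + 1) * of_real (1 - real (k - N) / real (M + 1)) :: complex)"
          proof -
            have "real (M + 1 - (k - N)) = real (M + 1) * (1 - real (k - N) / real (M + 1))"
              using kM True by (simp add: of_nat_diff field_simps)
            then have "complex_of_real (real (M + 1 - (k - N))) = complex_of_real (real (M + 1) * (1 - real (k - N) / real (M + 1)))"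
              by (simp only:)
            then show ?thesis by (simp only: of_real_mult of_real_of_nat_eq)
          qed
          moreover have "take k \<kappa> \<in> rows N M" using rows_take[OF \<kappa> True] kM by simp
          ultimately show ?thesis using k by (simp only: G_def if_True length_take min.absorb2 mult.assoc)
        next
          case False
          then have "take k \<kappa> \<notin> rows N M" using k by (simp add: rows_def)
          then have "G (take k \<kappa>) = 0" by (simp add: G_def)
          moreover have "Suc (length \<kappa> - k + M) - (length \<kappa> - N) = 0" using False k True by simp
          ultimately show ?thesis by simp
        qed
        finally show ?thesis ..
      qed
      then have "(\<Sum>k\<le>length \<kappa>. of_nat (M + 1) * (G (take k \<kappa>) * \<xi> (drop k \<kappa>))) =
          (\<Sum>k\<le>length \<kappa>. \<Sum>t\<in>{length \<kappa> - N..length \<kappa> - N + M}. F (take k \<kappa>) * \<xi>t t (drop k \<kappa>))"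
        by (intro sum.cong) auto
      then show ?thesis unfolding nc_mult_def sum_distrib_left by (subst sum.swap) simp
    qed
    \<comment> \<open>Cauchy-Schwarz over the \<open>M + 1\<close> windows; one of the two factors
      \<open>M + 1\<close> cancels.\<close>
    have row: "real (M + 1) * (cmod (nc_mult G \<xi> \<kappa>))\<^sup>2 \<le> (\<Sum>t\<in>{length \<kappa> - N..length \<kappa> - N + M}. (cmod (nc_mult F (\<xi>t t) \<kappa>))\<^sup>2)"
      if \<kappa>: "\<kappa> \<in> rows N M'" for \<kappa>
    proof -
      have "real (M + 1) * cmod (nc_mult G \<xi> \<kappa>) = cmod (of_nat (M + 1) * nc_mult G \<xi> \<kappa>)"
        by (simp only: norm_mult norm_of_nat)
      also have "\<dots> \<le> (\<Sum>t\<in>{length \<kappa> - N..length \<kappa> - N + M}. cmod (nc_mult F (\<xi>t t) \<kappa>))"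
        unfolding win[OF \<kappa>] by (rule norm_sum)
      finally have "(real (M + 1) * cmod (nc_mult G \<xi> \<kappa>))\<^sup>2 \<le> (\<Sum>t\<in>{length \<kappa> - N..length \<kappa> - N + M}. cmod (nc_mult F (\<xi>t t) \<kappa>))\<^sup>2"
        by (intro power_mono) auto
      also have "\<dots> \<le> (\<Sum>t\<in>{length \<kappa> - N..length \<kappa> - N + M}. (cmod (nc_mult F (\<xi>t t) \<kappa>))\<^sup>2) * card {length \<kappa> - N..length \<kappa> - N + M}"
        by (rule sum_squared_le_sum_of_squares)
      finally have "real (M + 1) * (real (M + 1) * (cmod (nc_mult G \<xi> \<kappa>))\<^sup>2) \<le> real (M + 1) * (\<Sum>t\<in>{length \<kappa> - N..length \<kappa> - N + M}. (cmod (nc_mult F (\<xi>t t) \<kappa>))\<^sup>2)"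
        by (simp add: power2_eq_square algebra_simps)
      then show ?thesis by (rule mult_left_le_imp_le) simp
    qed
    \<comment> \<open>These are the rows that meet window \<open>t\<close>. Removing their last
      \<open>t - M\<close> letters leaves at most \<open>M\<close> letters beyond \<open>N\<close>,
      the range in which the truncated lift is bounded.\<close>
    define A where "A t = {\<kappa> \<in> rows N M'. length \<kappa> - N \<le> t \<and> t \<le> length \<kappa> - N + M}" for t
    have "real (M + 1) * nsq (rows N M') (nc_mult G \<xi>) \<le>
        (\<Sum>\<kappa>\<in>rows N M'. \<Sum>t\<in>{length \<kappa> - N..length \<kappa> - N + M}. (cmod (nc_mult F (\<xi>t t) \<kappa>))\<^sup>2)"
      unfolding nsq_def sum_distrib_left by (intro sum_mono row)
    also have "\<dots> = (\<Sum>\<kappa>\<in>rows N M'. \<Sum>t\<le>M + M'. if \<kappa> \<in> A t then (cmod (nc_mult F (\<xi>t t) \<kappa>))\<^sup>2 else 0)"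
    proof (rule sum.cong[OF refl])
      fix \<kappa> assume \<kappa>: "\<kappa> \<in> rows N M'"
      then have "length \<kappa> - N \<le> M'" by (simp add: rows_def le_diff_conv add.commute)
      with \<kappa> show "(\<Sum>t\<in>{length \<kappa> - N..length \<kappa> - N + M}. (cmod (nc_mult F (\<xi>t t) \<kappa>))\<^sup>2) =
          (\<Sum>t\<le>M + M'. if \<kappa> \<in> A t then (cmod (nc_mult F (\<xi>t t) \<kappa>))\<^sup>2 else 0)"
        by (intro sum.mono_neutral_cong_left) (auto simp: A_def)
    qed
    also have "\<dots> = (\<Sum>t\<le>M + M'. nsq (A t) (nc_mult F (\<xi>t t)))"
    proof (subst sum.swap, rule sum.cong[OF refl])
      fix t
      show "(\<Sum>\<kappa>\<in>rows N M'. if \<kappa> \<in> A t then (cmod (nc_mult F (\<xi>t t) \<kappa>))\<^sup>2 else 0) = nsq (A t) (nc_mult F (\<xi>t t))"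
        unfolding nsq_def by (rule sum.mono_neutral_cong_right) (auto simp: A_def)
    qed
    also have "\<dots> \<le> (\<Sum>t\<le>M + M'. C * nsq (Lw M') (\<xi>t t))"
    proof (intro sum_mono)
      fix t
      show "nsq (A t) (nc_mult F (\<xi>t t)) \<le> C * nsq (Lw M') (\<xi>t t)"
      proof (rule suffix_split_bound[OF _ finite_rows finite_Lw C F(2) _ _ _ F(3), where s = "t - M"])
        show "finite (A t)" by (simp add: A_def)
        show "take (length \<kappa> - (t - M)) \<kappa> \<in> rows N M" if "\<kappa> \<in> A t" "N + (t - M) \<le> length \<kappa>" for \<kappa>
          using that by (intro rows_take[of \<kappa> N M']) (auto simp: A_def)
      qed (auto simp: \<xi>t_def \<xi>_def)
    qed
    also have "\<dots> = C * (\<Sum>w\<in>Lw M'. \<Sum>t\<le>M + M'. (cmod (\<xi>t t w))\<^sup>2)"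
      unfolding nsq_def sum_distrib_left by (rule sum.swap)
    \<comment> \<open>Each coordinate lies in at most \<open>M + 1\<close> windows, which
      compensates the factor on the left.\<close>
    also have "\<dots> \<le> C * (\<Sum>w\<in>Lw M'. real (M + 1) * (cmod (\<xi> w))\<^sup>2)"
    proof (rule mult_left_mono[OF sum_mono C])
      fix w assume w: "w \<in> Lw M'"
      have "(\<Sum>t\<le>M + M'. (cmod (\<xi>t t w))\<^sup>2) = (\<Sum>t\<in>{..M + M'} \<inter> {length w..length w + M}. (cmod (\<xi> w))\<^sup>2)"
        by (rule sum.mono_neutral_cong_right) (auto simp: \<xi>t_def)
      also have "\<dots> \<le> (\<Sum>t\<in>{length w..length w + M}. (cmod (\<xi> w))\<^sup>2)"
        by (rule sum_mono2) auto
      finally show "(\<Sum>t\<le>M + M'. (cmod (\<xi>t t w))\<^sup>2) \<le> real (M + 1) * (cmod (\<xi> w))\<^sup>2" by simp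
    qed
    also have "\<dots> = real (M + 1) * (C * nsq (Lw M') \<xi>)"
      by (simp only: nsq_def sum_distrib_left mult.left_commute)
    finally have "real (M + 1) * nsq (rows N M') (nc_mult G \<xi>) \<le> real (M + 1) * (C * nsq (Lw M') \<xi>)" .
    then have "nsq (rows N M') (nc_mult G \<xi>) \<le> C * nsq (Lw M') \<xi>" by (rule mult_left_le_imp_le) simp
    moreover have "nsq (rows N M') (nc_mult G \<xi>) = nsq (rows N M') (nc_mult G \<xi>0)"
    proof (rule nsq_cong)
      fix \<kappa> assume "\<kappa> \<in> rows N M'"
      then show "nc_mult G \<xi> \<kappa> = nc_mult G \<xi>0 \<kappa>"
        by (rule nc_mult_rows_cong) (auto simp: G_def F(2) \<xi>_def)
    qed
    moreover have "nsq (Lw M') \<xi> = nsq (Lw M') \<xi>0" by (rule nsq_cong) (simp add: \<xi>_def)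
    ultimately show ?thesis by simp
  qed
  ultimately show ?thesis by (intro exI[of _ G]) (auto simp: G_def)
qed

end

section \<open>The Banach algebra of a factorial language\<close>

text \<open>Cauchy-Schwarz in every coordinate. It bounds a scalar row applied to a column of
  multipliers by the column norm.\<close>

lemma nsq_linear_combination: "nsq A (\<lambda>w. \<Sum>s\<in>S. c s * f s w) \<le> (\<Sum>s\<in>S. (cmod (c s))\<^sup>2) * (\<Sum>s\<in>S. nsq A (f s))"
proof -
  have "(cmod (\<Sum>s\<in>S. c s * f s w))\<^sup>2 \<le> (\<Sum>s\<in>S. (cmod (c s))\<^sup>2) * (\<Sum>s\<in>S. (cmod (f s w))\<^sup>2)" for w
  proof -
    have "cmod (\<Sum>s\<in>S. c s * f s w) \<le> (\<Sum>s\<in>S. cmod (c s) * cmod (f s w))"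
      by (rule order_trans[OF norm_sum]) (simp add: norm_mult)
    then have "(cmod (\<Sum>s\<in>S. c s * f s w))\<^sup>2 \<le> (\<Sum>s\<in>S. cmod (c s) * cmod (f s w))\<^sup>2"
      by (intro power_mono) auto
    also have "\<dots> \<le> (\<Sum>s\<in>S. (cmod (c s))\<^sup>2) * (\<Sum>s\<in>S. (cmod (f s w))\<^sup>2)"
      by (rule Cauchy_Schwarz_ineq_sum)
    finally show ?thesis .
  qed
  then have "nsq A (\<lambda>w. \<Sum>s\<in>S. c s * f s w) \<le> (\<Sum>w\<in>A. (\<Sum>s\<in>S. (cmod (c s))\<^sup>2) * (\<Sum>s\<in>S. (cmod (f s w))\<^sup>2))"
    unfolding nsq_def by (rule sum_mono)
  also have "\<dots> = (\<Sum>s\<in>S. (cmod (c s))\<^sup>2) * (\<Sum>s\<in>S. nsq A (f s))"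
    unfolding nsq_def sum_distrib_left[symmetric] by (subst sum.swap) simp
  finally show ?thesis .
qed

lemma nc_mult_sum_right: "nc_mult a (\<lambda>w. \<Sum>s\<in>S. f s w) = (\<lambda>w. \<Sum>s\<in>S. nc_mult a (f s) w)"
  unfolding nc_mult_def sum_distrib_left by (subst sum.swap) simp

lemma nc_mult_sum_left: "nc_mult (\<lambda>w. \<Sum>s\<in>S. f s w) a = (\<lambda>w. \<Sum>s\<in>S. nc_mult (f s) a w)"
  unfolding nc_mult_def sum_distrib_right by (subst sum.swap) simp

lemma nc_mult_monom_append: "nc_mult (monom_word \<mu>) \<xi> (\<mu> @ v) = \<xi> v"
proof -
  have "nc_mult (monom_word \<mu>) \<xi> (\<mu> @ v) = (\<Sum>k\<in>{length \<mu>}. monom_word \<mu> (take k (\<mu> @ v)) * \<xi> (drop k (\<mu> @ v)))"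
    unfolding nc_mult_def
  proof (rule sum.mono_neutral_right)
    show "\<forall>k\<in>{..length (\<mu> @ v)} - {length \<mu>}. monom_word \<mu> (take k (\<mu> @ v)) * \<xi> (drop k (\<mu> @ v)) = 0"
    proof
      fix k assume "k \<in> {..length (\<mu> @ v)} - {length \<mu>}"
      then have "length (take k (\<mu> @ v)) \<noteq> length \<mu>" by (auto simp del: take_append)
      then have "take k (\<mu> @ v) \<noteq> \<mu>" by metis
      then show "monom_word \<mu> (take k (\<mu> @ v)) * \<xi> (drop k (\<mu> @ v)) = 0" by (simp add: monom_word_def)
    qed
  qed auto
  then show ?thesis by (simp add: monom_word_def)
qed

lemma nc_mult_monom_not_prefix:
  assumes "\<And>v. w \<noteq> \<mu> @ v"
  shows "nc_mult (monom_word \<mu>) \<xi> w = 0"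
proof -
  have "take k w \<noteq> \<mu>" for k using assms by (metis append_take_drop_id)
  then show ?thesis unfolding nc_mult_def by (intro sum.neutral) (auto simp: monom_word_def)
qed

context word_lang
begin

text \<open>The bound \<open>C\<close> for the norm of multiplication by \<open>a\<close>; truncations suffice, because coordinates
  up to length \<open>M\<close> of a product only depend on coordinates up to length \<open>M\<close> of the argument.\<close>

definition nb :: "real \<Rightarrow> (nat list \<Rightarrow> complex) \<Rightarrow> bool" where
  "nb C a \<longleftrightarrow> 0 \<le> C \<and> (\<forall>M \<xi>. nsq (Lw M) (nc_mult a \<xi>) \<le> C\<^sup>2 * nsq (Lw M) \<xi>)"

definition cv :: "(nat list \<Rightarrow> complex) \<Rightarrow> (nat list \<Rightarrow> complex) \<Rightarrow> nat list \<Rightarrow> complex" where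
  "cv a b = (\<lambda>w. if w \<in> L then nc_mult a b w else 0)"

definition polys :: "(nat list \<Rightarrow> complex) set" where
  "polys = {p. finite {w. p w \<noteq> 0} \<and> {w. p w \<noteq> 0} \<subseteq> L}"

definition alg :: "(nat list \<Rightarrow> complex) set" where
  "alg = {a. (\<forall>w. a w \<noteq> 0 \<longrightarrow> w \<in> L) \<and> (\<forall>\<epsilon>>0. \<exists>p\<in>polys. nb \<epsilon> (\<lambda>w. a w - p w))}"

lemma nb_nonneg: "nb C a \<Longrightarrow> 0 \<le> C"
  by (simp add: nb_def)

lemma nb_bound: "nb C a \<Longrightarrow> nsq (Lw M) (nc_mult a \<xi>) \<le> C\<^sup>2 * nsq (Lw M) \<xi>"
  by (simp add: nb_def)

lemma nb_sqrt: "nb C a \<longleftrightarrow> 0 \<le> C \<and> (\<forall>M \<xi>. sqrt (nsq (Lw M) (nc_mult a \<xi>)) \<le> C * sqrt (nsq (Lw M) \<xi>))"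
proof (cases "0 \<le> C")
  case True
  have "C * sqrt (nsq A \<xi>) = sqrt (C\<^sup>2 * nsq A \<xi>)" for A and \<xi> :: "nat list \<Rightarrow> complex"
    using True by (simp add: real_sqrt_mult)
  then show ?thesis using True by (simp add: nb_def)
qed (simp add: nb_def)

lemma nb_mono: "nb C a \<Longrightarrow> C \<le> D \<Longrightarrow> nb D a"
  unfolding nb_sqrt by (meson mult_right_mono nsq_nonneg order_trans real_sqrt_ge_zero)

lemma nb_add:
  assumes a: "nb C a" and b: "nb D b"
  shows "nb (C + D) (\<lambda>w. a w + b w)"
proof -
  have "sqrt (nsq (Lw M) (nc_mult (\<lambda>w. a w + b w) \<xi>)) \<le> (C + D) * sqrt (nsq (Lw M) \<xi>)" for M \<xi>
  proof -
    have "sqrt (nsq (Lw M) (nc_mult (\<lambda>w. a w + b w) \<xi>)) \<le> sqrt (nsq (Lw M) (nc_mult a \<xi>)) + sqrt (nsq (Lw M) (nc_mult b \<xi>))"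
      unfolding nc_mult_add_left by (rule nsq_triangle)
    also have "\<dots> \<le> C * sqrt (nsq (Lw M) \<xi>) + D * sqrt (nsq (Lw M) \<xi>)"
      using a b by (intro add_mono) (simp_all add: nb_sqrt)
    finally show ?thesis by (simp add: distrib_right)
  qed
  then show ?thesis using nb_nonneg[OF a] nb_nonneg[OF b] by (simp add: nb_sqrt)
qed

lemma nb_scale: "nb C a \<Longrightarrow> nb (cmod c * C) (\<lambda>w. c * a w)"
  unfolding nb_def nc_mult_scale_left nsq_scale by (simp add: power_mult_distrib mult_left_mono mult.assoc)

lemma nb_uminus: "nb C a \<Longrightarrow> nb C (\<lambda>w. - a w)"
  using nb_scale[of C a "-1"] by simp

lemma nb_diff: "nb C a \<Longrightarrow> nb D b \<Longrightarrow> nb (C + D) (\<lambda>w. a w - b w)"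
  using nb_add[OF _ nb_uminus, of C a D b] by simp

lemma nb_zero: "nb 0 (\<lambda>w. 0)"
  by (simp add: nb_def nc_mult_def nsq_def)

lemma nb_sum: "finite S \<Longrightarrow> (\<And>s. s \<in> S \<Longrightarrow> nb (C s) (f s)) \<Longrightarrow> nb (\<Sum>s\<in>S. C s) (\<lambda>w. \<Sum>s\<in>S. f s w)"
proof (induction rule: finite_induct)
  case empty
  show ?case by (simp add: nb_zero)
next
  case (insert x F)
  then show ?case using nb_add[of "C x" "f x"] by simp
qed

text \<open>Prefixes of a word of \<open>L\<close> lie in \<open>L\<close>, so the truncation in
  \<open>cv\<close> is invisible at such a word.\<close>

lemma nc_mult_cv: "w \<in> L \<Longrightarrow> nc_mult (cv a b) \<xi> w = nc_mult a (nc_mult b \<xi>) w"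
proof -
  assume "w \<in> L"
  then have "nc_mult (cv a b) \<xi> w = nc_mult (nc_mult a b) \<xi> w"
    by (intro nc_mult_eqI) (auto simp: cv_def L_take)
  then show ?thesis by (simp add: nc_mult_assoc)
qed

lemma nb_cv: "nb C a \<Longrightarrow> nb D b \<Longrightarrow> nb (C * D) (cv a b)"
proof -
  assume ab: "nb C a" "nb D b"
  have "nsq (Lw M) (nc_mult (cv a b) \<xi>) \<le> (C * D)\<^sup>2 * nsq (Lw M) \<xi>" for M \<xi>
  proof -
    have "nsq (Lw M) (nc_mult (cv a b) \<xi>) = nsq (Lw M) (nc_mult a (nc_mult b \<xi>))"
      by (rule nsq_cong) (simp add: nc_mult_cv Lw_def)
    also have "\<dots> \<le> C\<^sup>2 * nsq (Lw M) (nc_mult b \<xi>)" by (rule nb_bound[OF ab(1)])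
    also have "\<dots> \<le> C\<^sup>2 * (D\<^sup>2 * nsq (Lw M) \<xi>)" by (intro mult_left_mono nb_bound[OF ab(2)]) simp
    finally show ?thesis by (simp add: power_mult_distrib mult.assoc)
  qed
  then show ?thesis using ab by (simp add: nb_def)
qed

lemma nsq_unit: "nsq (Lw M) (monom_word []) \<le> 1"
proof -
  have "nsq (Lw M) (monom_word []) = nsq (Lw M \<inter> {[]}) (monom_word [])"
    unfolding nsq_def by (rule sum.mono_neutral_right) (auto simp: monom_word_def)
  also have "\<dots> \<le> nsq {[]} (monom_word [])" by (rule nsq_mono) auto
  finally show ?thesis by (simp add: nsq_def monom_word_def)
qed

lemma nb_nsq: "nb C a \<Longrightarrow> nsq (Lw M) a \<le> C\<^sup>2"
proof -
  assume "nb C a"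
  then have "nsq (Lw M) (nc_mult a (monom_word [])) \<le> C\<^sup>2 * nsq (Lw M) (monom_word [])" by (rule nb_bound)
  also have "\<dots> \<le> C\<^sup>2 * 1" by (intro mult_left_mono nsq_unit) simp
  finally show ?thesis by (simp add: nc_mult_one(2))
qed

lemma nb_coef: "nb C a \<Longrightarrow> w \<in> L \<Longrightarrow> cmod (a w) \<le> C"
proof -
  assume a: "nb C a" and w: "w \<in> L"
  have "(cmod (a w))\<^sup>2 \<le> nsq (Lw (length w)) a"
    unfolding nsq_def by (rule member_le_sum[of w "Lw (length w)" "\<lambda>w. (cmod (a w))\<^sup>2"]) (use w finite_Lw[of "length w"] in \<open>auto simp: Lw_def\<close>)
  also have "\<dots> \<le> C\<^sup>2" by (rule nb_nsq[OF a])
  finally show ?thesis by (rule power2_le_imp_le) (rule nb_nonneg[OF a])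
qed

text \<open>A coordinate of the product involves only one prefix of length \<open>k\<close>, so a
  homogeneous multiplier is bounded by the square norm of its coefficients. Applying
  \<open>a\<close> to the vacuum bounds that norm by \<open>C\<close>.\<close>

lemma nb_homogeneous:
  assumes a: "nb C a"
  shows "nb C (\<lambda>w. if length w = k then a w else 0)"
proof -
  let ?a = "\<lambda>w. if length w = k then a w else 0"
  have row: "nc_mult ?a \<xi> w = (if k \<le> length w then a (take k w) * \<xi> (drop k w) else 0)" for \<xi> w
  proof -
    have "nc_mult ?a \<xi> w = (\<Sum>j\<le>length w. if j = k then a (take k w) * \<xi> (drop k w) else 0)"
      unfolding nc_mult_def by (rule sum.cong) auto
    then show ?thesis by simp
  qed
  have "nsq (Lw M) (nc_mult ?a \<xi>) \<le> C\<^sup>2 * nsq (Lw M) \<xi>" for M \<xi>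
  proof -
    have "nsq (Lw M) (nc_mult ?a \<xi>) \<le> (\<Sum>(u, v)\<in>Lw k \<times> Lw M. (cmod (a u))\<^sup>2 * (cmod (\<xi> v))\<^sup>2)"
      unfolding nsq_def
    proof (rule sum_le_included[where i = "\<lambda>(u, v). u @ v"])
      show "\<forall>w\<in>Lw M. \<exists>uv\<in>Lw k \<times> Lw M. (case uv of (u, v) \<Rightarrow> u @ v) = w \<and>
          (cmod (nc_mult ?a \<xi> w))\<^sup>2 \<le> (case uv of (u, v) \<Rightarrow> (cmod (a u))\<^sup>2 * (cmod (\<xi> v))\<^sup>2)"
      proof
        fix w assume w: "w \<in> Lw M"
        then have "(take k w, drop k w) \<in> Lw k \<times> Lw M" by (auto simp: Lw_def L_take L_drop)
        then show "\<exists>uv\<in>Lw k \<times> Lw M. (case uv of (u, v) \<Rightarrow> u @ v) = w \<and>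
          (cmod (nc_mult ?a \<xi> w))\<^sup>2 \<le> (case uv of (u, v) \<Rightarrow> (cmod (a u))\<^sup>2 * (cmod (\<xi> v))\<^sup>2)"
          by (rule rev_bexI) (simp add: row norm_mult power_mult_distrib)
      qed
    qed auto
    also have "\<dots> = nsq (Lw k) a * nsq (Lw M) \<xi>"
      by (simp add: nsq_def sum_product sum.cartesian_product)
    also have "\<dots> \<le> C\<^sup>2 * nsq (Lw M) \<xi>"
      by (intro mult_right_mono nb_nsq[OF a]) simp
    finally show ?thesis .
  qed
  then show ?thesis using a by (simp add: nb_def)
qed

text \<open>Prefixing a fixed word is injective, and suffixes of words of \<open>L\<close> stay in
  \<open>L\<close>; truncation only removes coordinates.\<close>

lemma nb_monom: "nb 1 (monom_word \<mu>)"
proof -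
  have "nsq (Lw M) (nc_mult (monom_word \<mu>) \<xi>) \<le> nsq (Lw M) \<xi>" for M \<xi>
  proof -
    have "nsq (Lw M) (nc_mult (monom_word \<mu>) \<xi>) = nsq (Lw M \<inter> range ((@) \<mu>)) (nc_mult (monom_word \<mu>) \<xi>)"
      unfolding nsq_def
      by (rule sum.mono_neutral_right) (auto intro!: nc_mult_monom_not_prefix)
    also have "\<dots> \<le> nsq (Lw M) \<xi>"
      unfolding nsq_def
    proof (rule sum_le_included[where i = "(@) \<mu>"])
      show "\<forall>w\<in>Lw M \<inter> range ((@) \<mu>). \<exists>v\<in>Lw M. \<mu> @ v = w \<and> (cmod (nc_mult (monom_word \<mu>) \<xi> w))\<^sup>2 \<le> (cmod (\<xi> v))\<^sup>2"
      proof
        fix w assume "w \<in> Lw M \<inter> range ((@) \<mu>)"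
        then obtain v where v: "w = \<mu> @ v" "\<mu> @ v \<in> L" "length (\<mu> @ v) \<le> M" by (auto simp: Lw_def)
        then have "v \<in> Lw M" using L_append2[OF v(2)] by (simp add: Lw_def)
        then show "\<exists>v\<in>Lw M. \<mu> @ v = w \<and> (cmod (nc_mult (monom_word \<mu>) \<xi> w))\<^sup>2 \<le> (cmod (\<xi> v))\<^sup>2"
          by (rule rev_bexI) (simp add: v(1) nc_mult_monom_append)
      qed
    qed auto
    finally show ?thesis .
  qed
  then show ?thesis by (simp add: nb_def)
qed

lemma nb_finite_support:
  assumes "finite S" "\<And>w. p w \<noteq> 0 \<Longrightarrow> w \<in> S"
  shows "nb (\<Sum>w\<in>S. cmod (p w)) p"
proof -
  have "p = (\<lambda>w. \<Sum>\<mu>\<in>S. p \<mu> * monom_word \<mu> w)"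
  proof
    fix w
    have "(\<Sum>\<mu>\<in>S. p \<mu> * monom_word \<mu> w) = (\<Sum>\<mu>\<in>S. if \<mu> = w then p w else 0)"
      by (rule sum.cong) (auto simp: monom_word_def)
    then show "p w = (\<Sum>\<mu>\<in>S. p \<mu> * monom_word \<mu> w)" using assms by auto
  qed
  moreover have "nb (\<Sum>\<mu>\<in>S. cmod (p \<mu>)) (\<lambda>w. \<Sum>\<mu>\<in>S. p \<mu> * monom_word \<mu> w)"
    using nb_scale[OF nb_monom] by (intro nb_sum assms(1)) simp
  ultimately show ?thesis by simp
qed

lemma nb_polys: "p \<in> polys \<Longrightarrow> \<exists>C. nb C p"
  using nb_finite_support[of "{w. p w \<noteq> 0}" p] by (auto simp: polys_def)

text \<open>Each truncated inequality involves finitely many coefficients at words of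
  \<open>L\<close>, so convergence of every coefficient suffices.\<close>

lemma nb_limit:
  assumes nb: "\<And>n. nb C (a n)" and lim: "\<And>w. w \<in> L \<Longrightarrow> (\<lambda>n. a n w) \<longlonglongrightarrow> b w"
  shows "nb C b"
proof -
  have "nsq (Lw M) (nc_mult b \<xi>) \<le> C\<^sup>2 * nsq (Lw M) \<xi>" for M \<xi>
  proof -
    have "(\<lambda>n. nsq (Lw M) (nc_mult (a n) \<xi>)) \<longlonglongrightarrow> nsq (Lw M) (nc_mult b \<xi>)"
      unfolding nsq_def nc_mult_def
      by (intro tendsto_sum tendsto_power tendsto_norm tendsto_mult tendsto_const lim) (auto simp: Lw_def L_take)
    then show ?thesis by (rule LIMSEQ_le_const2) (use nb_bound[OF nb] in blast)
  qed
  then show ?thesis using nb_nonneg[OF nb] by (simp add: nb_def)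
qed

lemma algD: "a \<in> alg \<Longrightarrow> a w \<noteq> 0 \<Longrightarrow> w \<in> L"
  by (simp add: alg_def)

lemma alg_zeroD: "a \<in> alg \<Longrightarrow> w \<notin> L \<Longrightarrow> a w = 0"
  using algD by blast

lemma alg_approx: "a \<in> alg \<Longrightarrow> \<epsilon> > 0 \<Longrightarrow> \<exists>p\<in>polys. nb \<epsilon> (\<lambda>w. a w - p w)"
  by (simp add: alg_def)

lemma polys_alg: "p \<in> polys \<Longrightarrow> p \<in> alg"
  using nb_mono[OF nb_zero] by (auto simp: alg_def polys_def intro!: bexI[of _ p])

lemma nb_alg: "a \<in> alg \<Longrightarrow> \<exists>C>0. nb C a"
proof -
  assume "a \<in> alg"
  then obtain p where p: "p \<in> polys" "nb 1 (\<lambda>w. a w - p w)" using alg_approx[of a 1] by auto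
  obtain C where "nb C p" using nb_polys[OF p(1)] ..
  from nb_add[OF p(2) this] have "nb (1 + C) a" by simp
  moreover have "1 + C > 0" using nb_nonneg[OF \<open>nb C p\<close>] by simp
  ultimately show ?thesis by blast
qed

lemma polys_add: "p \<in> polys \<Longrightarrow> q \<in> polys \<Longrightarrow> (\<lambda>w. p w + q w) \<in> polys"
proof -
  assume pq: "p \<in> polys" "q \<in> polys"
  have un: "{w. p w + q w \<noteq> 0} \<subseteq> {w. p w \<noteq> 0} \<union> {w. q w \<noteq> 0}" by auto
  have fin: "finite ({w. p w \<noteq> 0} \<union> {w. q w \<noteq> 0})" and sub: "{w. p w \<noteq> 0} \<union> {w. q w \<noteq> 0} \<subseteq> L"
    using pq by (simp_all add: polys_def)
  show ?thesis using finite_subset[OF un fin] order_trans[OF un sub] by (simp add: polys_def)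
qed

lemma polys_scale: "p \<in> polys \<Longrightarrow> (\<lambda>w. c * p w) \<in> polys"
proof -
  assume p: "p \<in> polys"
  have "finite {w. c * p w \<noteq> 0}" by (rule finite_subset[of _ "{w. p w \<noteq> 0}"]) (use p in \<open>auto simp: polys_def\<close>)
  then show ?thesis using p by (auto simp: polys_def)
qed

lemma polys_zero: "(\<lambda>w. 0) \<in> polys"
  by (simp add: polys_def)

lemma polys_sum: "finite S \<Longrightarrow> (\<And>s. s \<in> S \<Longrightarrow> f s \<in> polys) \<Longrightarrow> (\<lambda>w. \<Sum>s\<in>S. f s w) \<in> polys"
  by (induction rule: finite_induct) (auto simp: polys_zero intro: polys_add)

lemma polys_cv: "p \<in> polys \<Longrightarrow> q \<in> polys \<Longrightarrow> cv p q \<in> polys"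
proof -
  assume pq: "p \<in> polys" "q \<in> polys"
  have "finite {w. nc_mult p q w \<noteq> 0}"
    using pq by (intro nc_mult_finite_support(1)) (auto simp: polys_def)
  then have "finite {w. cv p q w \<noteq> 0}" by (rule rev_finite_subset) (auto simp: cv_def)
  then show ?thesis by (auto simp: polys_def cv_def)
qed

lemma polys_monom: "\<mu> \<in> L \<Longrightarrow> monom_word \<mu> \<in> polys"
  by (auto simp: polys_def monom_word_def)

lemma polys_expand: "p \<in> polys \<Longrightarrow> p = (\<lambda>w. \<Sum>\<mu>\<in>{\<mu>. p \<mu> \<noteq> 0}. p \<mu> * monom_word \<mu> w)"
proof
  fix w assume p: "p \<in> polys"
  have "(\<Sum>\<mu>\<in>{\<mu>. p \<mu> \<noteq> 0}. p \<mu> * monom_word \<mu> w) = (\<Sum>\<mu>\<in>{\<mu>. p \<mu> \<noteq> 0}. if \<mu> = w then p w else 0)"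
    by (rule sum.cong) (auto simp: monom_word_def)
  then show "p w = (\<Sum>\<mu>\<in>{\<mu>. p \<mu> \<noteq> 0}. p \<mu> * monom_word \<mu> w)" using p by (auto simp: polys_def)
qed

lemma alg_add: "a \<in> alg \<Longrightarrow> b \<in> alg \<Longrightarrow> (\<lambda>w. a w + b w) \<in> alg"
proof -
  assume ab: "a \<in> alg" "b \<in> alg"
  have "\<exists>p\<in>polys. nb \<epsilon> (\<lambda>w. (a w + b w) - p w)" if e: "\<epsilon> > 0" for \<epsilon>
  proof -
    obtain p q where pq: "p \<in> polys" "nb (\<epsilon>/2) (\<lambda>w. a w - p w)" "q \<in> polys" "nb (\<epsilon>/2) (\<lambda>w. b w - q w)"
      using alg_approx[OF ab(1), of "\<epsilon>/2"] alg_approx[OF ab(2), of "\<epsilon>/2"] e by auto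
    have "nb (\<epsilon>/2 + \<epsilon>/2) (\<lambda>w. (a w - p w) + (b w - q w))" by (rule nb_add) (rule pq)+
    then show ?thesis using polys_add[OF pq(1,3)] by (intro bexI[of _ "\<lambda>w. p w + q w"]) (simp_all add: algebra_simps)
  qed
  moreover have "w \<in> L" if "a w + b w \<noteq> 0" for w using that algD[OF ab(1), of w] algD[OF ab(2), of w] by (cases "a w = 0") auto
  ultimately show ?thesis by (simp add: alg_def)
qed

lemma alg_scale: "a \<in> alg \<Longrightarrow> (\<lambda>w. c * a w) \<in> alg"
proof -
  assume a: "a \<in> alg"
  have "\<exists>p\<in>polys. nb \<epsilon> (\<lambda>w. c * a w - p w)" if e: "\<epsilon> > 0" for \<epsilon>
  proof -
    obtain p where p: "p \<in> polys" "nb (\<epsilon> / (cmod c + 1)) (\<lambda>w. a w - p w)"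
      using alg_approx[OF a, of "\<epsilon> / (cmod c + 1)"] e by (auto simp: add_nonneg_pos)
    have "nb (cmod c * (\<epsilon> / (cmod c + 1))) (\<lambda>w. c * (a w - p w))" by (rule nb_scale) (rule p)
    moreover have "0 < cmod c + 1" by (simp add: add_nonneg_pos)
    then have "cmod c * (\<epsilon> / (cmod c + 1)) \<le> \<epsilon>" using e by (simp add: pos_divide_le_eq distrib_left)
    ultimately have "nb \<epsilon> (\<lambda>w. c * (a w - p w))" by (rule nb_mono)
    then show ?thesis using polys_scale[OF p(1)] by (intro bexI[of _ "\<lambda>w. c * p w"]) (simp_all add: algebra_simps)
  qed
  then show ?thesis using a by (auto simp: alg_def)
qed

lemma alg_diff: "a \<in> alg \<Longrightarrow> b \<in> alg \<Longrightarrow> (\<lambda>w. a w - b w) \<in> alg"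
  using alg_add[of a "\<lambda>w. (-1) * b w"] alg_scale[of b "-1"] by simp

lemma alg_sum: "finite S \<Longrightarrow> (\<And>s. s \<in> S \<Longrightarrow> f s \<in> alg) \<Longrightarrow> (\<lambda>w. \<Sum>s\<in>S. f s w) \<in> alg"
  by (induction rule: finite_induct) (auto simp: polys_alg[OF polys_zero] intro: alg_add)

lemma cv_add_right: "cv c (\<lambda>w. a w + b w) = (\<lambda>w. cv c a w + cv c b w)"
  by (auto simp: cv_def nc_mult_add_right)

lemma cv_diff_left: "cv (\<lambda>w. a w - b w) c = (\<lambda>w. cv a c w - cv b c w)"
  by (auto simp: cv_def nc_mult_diff_left)

lemma cv_diff_right: "cv c (\<lambda>w. a w - b w) = (\<lambda>w. cv c a w - cv c b w)"
  by (auto simp: cv_def nc_mult_diff_right)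

lemma cv_scale_left: "cv (\<lambda>w. k * a w) c = (\<lambda>w. k * cv a c w)"
  by (auto simp: cv_def nc_mult_scale_left)

lemma cv_scale_right: "cv c (\<lambda>w. k * a w) = (\<lambda>w. k * cv c a w)"
  by (auto simp: cv_def nc_mult_scale_right)

lemma cv_sum_left: "cv (\<lambda>w. \<Sum>s\<in>S. f s w) c = (\<lambda>w. \<Sum>s\<in>S. cv (f s) c w)"
  by (auto simp: cv_def nc_mult_sum_left)

lemma cv_sum_right: "cv c (\<lambda>w. \<Sum>s\<in>S. f s w) = (\<lambda>w. \<Sum>s\<in>S. cv c (f s) w)"
  by (auto simp: cv_def nc_mult_sum_right)

text \<open>Suffixes of a word of \<open>L\<close> lie in \<open>L\<close>, so discarding other
  words inside the right factor changes nothing at that word.\<close>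

lemma cv_assoc: "cv (cv a b) c = cv a (cv b c)"
proof
  fix w
  have "nc_mult a (nc_mult b c) w = nc_mult a (cv b c) w" if "w \<in> L"
    using that by (intro nc_mult_eqI) (auto simp: cv_def L_drop)
  then show "cv (cv a b) c w = cv a (cv b c) w"
    by (cases "w \<in> L") (simp_all add: cv_def nc_mult_cv[unfolded cv_def])
qed

lemma cv_unit_left: "a \<in> alg \<Longrightarrow> cv (monom_word []) a = a"
  by (auto simp: cv_def nc_mult_one(1) alg_zeroD)

lemma cv_monom: "cv (monom_word \<mu>) (monom_word \<nu>) = (\<lambda>w. if \<mu> @ \<nu> \<in> L then monom_word (\<mu> @ \<nu>) w else 0)"
  unfolding cv_def monom_word_mult by (auto simp: monom_word_def)

lemma alg_cv: "a \<in> alg \<Longrightarrow> b \<in> alg \<Longrightarrow> cv a b \<in> alg"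
proof -
  assume ab: "a \<in> alg" "b \<in> alg"
  obtain B where B: "B > 0" "nb B b" using nb_alg[OF ab(2)] by blast
  have "\<exists>p\<in>polys. nb \<epsilon> (\<lambda>w. cv a b w - p w)" if e: "\<epsilon> > 0" for \<epsilon>
  proof -
    obtain p where p: "p \<in> polys" "nb (\<epsilon> / 2 / B) (\<lambda>w. a w - p w)"
      using alg_approx[OF ab(1), of "\<epsilon>/2/B"] e B by auto
    obtain P where P: "nb P p" using nb_polys[OF p(1)] ..
    then have P0: "P \<ge> 0" by (rule nb_nonneg)
    obtain q where q: "q \<in> polys" "nb (\<epsilon> / 2 / (P + 1)) (\<lambda>w. b w - q w)"
      using alg_approx[OF ab(2), of "\<epsilon>/2/(P+1)"] e P0 by auto
    have "nb (\<epsilon> / 2 / B * B + P * (\<epsilon> / 2 / (P + 1))) (\<lambda>w. cv (\<lambda>w. a w - p w) b w + cv p (\<lambda>w. b w - q w) w)"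
      by (intro nb_add nb_cv p q P B)
    moreover have "\<epsilon> / 2 / B * B + P * (\<epsilon> / 2 / (P + 1)) \<le> \<epsilon>"
      using e B P0 by (simp add: field_simps)
    ultimately have "nb \<epsilon> (\<lambda>w. cv (\<lambda>w. a w - p w) b w + cv p (\<lambda>w. b w - q w) w)" by (rule nb_mono)
    then have "nb \<epsilon> (\<lambda>w. cv a b w - cv p q w)" by (simp add: cv_diff_left cv_diff_right)
    then show ?thesis using polys_cv[OF p(1) q(1)] by blast
  qed
  then show ?thesis by (auto simp: alg_def cv_def)
qed

text \<open>A tail is a coordinatewise limit of finite sums bounded by the tail of \<open>C\<close>,
  and the initial segment is approximated by a polynomial. This takes the place of completeness in
  the constructions below.\<close>

lemma alg_series:
  assumes a: "\<And>k. a k \<in> alg" "\<And>k. nb (C k) (a k)" and C: "summable C"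
  shows "summable (\<lambda>k. a k w)" and "nb (\<Sum>k. C k) (\<lambda>w. \<Sum>k. a k w)" and "(\<lambda>w. \<Sum>k. a k w) \<in> alg"
proof -
  have C0: "C k \<ge> 0" for k using nb_nonneg[OF a(2)] .
  show sw: "summable (\<lambda>k. a k w)" for w
  proof (rule summable_comparison_test'[OF C])
    show "norm (a k w) \<le> C k" for k
      by (cases "w \<in> L") (auto simp: nb_coef[OF a(2)] alg_zeroD[OF a(1)] C0)
  qed
  have nbs: "nb (\<Sum>k. C (k + m)) (\<lambda>w. \<Sum>k. a (k + m) w)" for m
  proof (rule nb_limit)
    fix n
    have "nb (\<Sum>k<n. C (k + m)) (\<lambda>w. \<Sum>k<n. a (k + m) w)"
      by (intro nb_sum a) auto
    moreover have "(\<Sum>k<n. C (k + m)) \<le> (\<Sum>k. C (k + m))"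
      by (rule sum_le_suminf[OF summable_ignore_initial_segment[OF C]]) (auto simp: C0)
    ultimately show "nb (\<Sum>k. C (k + m)) (\<lambda>w. \<Sum>k<n. a (k + m) w)" by (rule nb_mono)
  next
    fix w
    show "(\<lambda>n. \<Sum>k<n. a (k + m) w) \<longlonglongrightarrow> (\<Sum>k. a (k + m) w)"
      by (rule summable_LIMSEQ[OF summable_ignore_initial_segment[OF sw]])
  qed
  from nbs[of 0] show "nb (\<Sum>k. C k) (\<lambda>w. \<Sum>k. a k w)" by simp
  have "\<exists>p\<in>polys. nb \<epsilon> (\<lambda>w. (\<Sum>k. a k w) - p w)" if e: "\<epsilon> > 0" for \<epsilon>
  proof -
    have "(\<lambda>m. \<Sum>k. C (k + m)) \<longlonglongrightarrow> 0" by (rule suminf_exist_split2[OF C])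
    then have "\<forall>\<^sub>F m in sequentially. (\<Sum>k. C (k + m)) < \<epsilon> / 2"
      by (rule order_tendstoD(2)) (use e in simp)
    then obtain m where m: "(\<Sum>k. C (k + m)) < \<epsilon> / 2" by (auto simp: eventually_sequentially)
    have "(\<lambda>w. \<Sum>k<m. a k w) \<in> alg" by (intro alg_sum a) auto
    then obtain p where p: "p \<in> polys" "nb (\<epsilon> / 2) (\<lambda>w. (\<Sum>k<m. a k w) - p w)"
      using alg_approx[of _ "\<epsilon>/2"] e by (metis half_gt_zero)
    have "nb ((\<Sum>k. C (k + m)) + \<epsilon> / 2) (\<lambda>w. (\<Sum>k. a (k + m) w) + ((\<Sum>k<m. a k w) - p w))"
      by (rule nb_add[OF nbs p(2)])
    moreover have "(\<Sum>k. a (k + m) w) + (\<Sum>k<m. a k w) = (\<Sum>k. a k w)" for w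
      by (rule suminf_split_initial_segment[OF sw, symmetric])
    ultimately have "nb ((\<Sum>k. C (k + m)) + \<epsilon> / 2) (\<lambda>w. (\<Sum>k. a k w) - p w)"
      by (simp add: add_diff_eq)
    from nb_mono[OF this, of \<epsilon>] m have "nb \<epsilon> (\<lambda>w. (\<Sum>k. a k w) - p w)" by simp
    with p(1) show ?thesis by blast
  qed
  moreover have "w \<in> L" if "(\<Sum>k. a k w) \<noteq> 0" for w
    using that alg_zeroD[OF a(1), of w] by (cases "w \<in> L") auto
  ultimately show "(\<lambda>w. \<Sum>k. a k w) \<in> alg" by (simp add: alg_def)
qed

lemma cv_suminf:
  assumes "\<And>w. summable (\<lambda>k. a k w)"
  shows "cv b (\<lambda>w. \<Sum>k. a k w) = (\<lambda>w. \<Sum>k. cv b (a k) w)"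
    and "summable (\<lambda>k. cv b (a k) w)"
proof -
  have s: "summable (\<lambda>k. nc_mult b (a k) w)" for w
    unfolding nc_mult_def by (intro summable_sum summable_mult assms)
  then show "summable (\<lambda>k. cv b (a k) w)" by (cases "w \<in> L") (simp_all add: cv_def)
  have "nc_mult b (\<lambda>w. \<Sum>k. a k w) w = (\<Sum>k. nc_mult b (a k) w)" for w
    unfolding nc_mult_def
    by (subst suminf_sum) (auto simp: suminf_mult[OF assms] intro!: summable_mult assms)
  then show "cv b (\<lambda>w. \<Sum>k. a k w) = (\<lambda>w. \<Sum>k. cv b (a k) w)"
    by (auto simp: cv_def)
qed

end

section \<open>Factorization through shifted letters\<close>

text \<open>Quotients in noncommutative division of the word x_\<kappa> by the x_i - z_i on the
  left, with remainder its value z_\<kappa>. The recursion is x_j x_\<kappa> - z_j z_\<kappa> = (x_j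
  - z_j) x_\<kappa> + z_j (x_\<kappa> - z_\<kappa>).\<close>

primrec letter_quotient :: "(nat \<Rightarrow> complex) \<Rightarrow> nat list \<Rightarrow> nat \<Rightarrow> nat list \<Rightarrow> complex" where
  "letter_quotient z [] i = (\<lambda>w. 0)"
| "letter_quotient z (j # \<kappa>) i = (\<lambda>w. (if i = j then monom_word \<kappa> w else 0) + z j * letter_quotient z \<kappa> i w)"

definition shifted_letter :: "(nat \<Rightarrow> complex) \<Rightarrow> nat \<Rightarrow> nat list \<Rightarrow> complex" where
  "shifted_letter z i = (\<lambda>w. monom_word [i] w - z i * monom_word [] w)"

text \<open>The values on words of length \<open>N\<close> are the coordinates of the
  \<open>N\<close>-fold tensor power of \<open>z\<close>.\<close>

lemma sum_norm_words:
  "(\<Sum>\<mu>\<in>{\<mu> \<in> words d. length \<mu> = N}. (cmod (prod_list (map z \<mu>)))\<^sup>2) = (\<Sum>i<d. (cmod (z i))\<^sup>2) ^ N"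
proof (induction N)
  case 0
  have "{\<mu> \<in> words d. length \<mu> = 0} = {[]}" by auto
  then show ?case by simp
next
  case (Suc N)
  have im: "{s \<in> words d. length s = Suc N} = (\<lambda>(i, s). i # s) ` ({..<d} \<times> {s \<in> words d. length s = N})"
    by (auto simp: length_Suc_conv image_iff)
  have "(\<Sum>\<mu>\<in>{\<mu> \<in> words d. length \<mu> = Suc N}. (cmod (prod_list (map z \<mu>)))\<^sup>2) =
      (\<Sum>(i, \<mu>)\<in>{..<d} \<times> {s \<in> words d. length s = N}. (cmod (z i))\<^sup>2 * (cmod (prod_list (map z \<mu>)))\<^sup>2)"
    unfolding im by (subst sum.reindex) (auto simp: inj_on_def norm_mult power_mult_distrib intro!: sum.cong)
  also have "\<dots> = (\<Sum>i<d. (cmod (z i))\<^sup>2) * (\<Sum>\<mu>\<in>{s \<in> words d. length s = N}. (cmod (prod_list (map z \<mu>)))\<^sup>2)"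
    by (simp add: sum_product sum.cartesian_product)
  finally show ?case by (simp add: Suc.IH)
qed

locale pointed_lang = word_lang +
  assumes nil: "[] \<in> L" and letters: "i < d \<Longrightarrow> [i] \<in> L"
begin

lemma cv_zero_right: "cv a (\<lambda>w. 0) = (\<lambda>w. 0)"
  by (auto simp: cv_def nc_mult_def)

lemma shifted_letter_polys: "i < d \<Longrightarrow> shifted_letter z i \<in> polys"
  unfolding shifted_letter_def
  using polys_add[OF polys_monom[OF letters] polys_scale[OF polys_monom[OF nil], of "- z i"]] by simp

lemma letter_quotient_polys: "\<kappa> \<in> L \<Longrightarrow> letter_quotient z \<kappa> i \<in> polys"
proof (induction \<kappa>)
  case Nil
  then show ?case by (simp add: polys_zero)
next
  case (Cons j \<kappa>)
  then have "\<kappa> \<in> L" using L_append2[of "[j]" \<kappa>] by simp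
  then have "(\<lambda>w. if i = j then monom_word \<kappa> w else 0) \<in> polys"
    by (cases "i = j") (simp_all add: polys_zero polys_monom)
  then show ?case using polys_add polys_scale Cons.IH[OF \<open>\<kappa> \<in> L\<close>] by simp
qed

lemma letter_quotient_sum:
  "\<kappa> \<in> L \<Longrightarrow> (\<Sum>i<d. cv (shifted_letter z i) (letter_quotient z \<kappa> i) w) =
    monom_word \<kappa> w - prod_list (map z \<kappa>) * monom_word [] w"
proof (induction \<kappa> arbitrary: w)
  case Nil
  then show ?case by (simp add: cv_zero_right)
next
  case (Cons j \<kappa>)
  have \<kappa>: "\<kappa> \<in> L" using Cons.prems L_append2[of "[j]" \<kappa>] by simp
  have j: "j < d" using Cons.prems L_words by auto
  have cvj: "cv (shifted_letter z j) (monom_word \<kappa>) w = monom_word (j # \<kappa>) w - z j * monom_word \<kappa> w"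
    unfolding shifted_letter_def cv_diff_left cv_scale_left
    using Cons.prems \<kappa> by (simp add: cv_monom)
  have "(\<Sum>i<d. cv (shifted_letter z i) (letter_quotient z (j # \<kappa>) i) w) =
      (\<Sum>i<d. (if i = j then cv (shifted_letter z j) (monom_word \<kappa>) w else 0) + z j * cv (shifted_letter z i) (letter_quotient z \<kappa> i) w)"
    by (rule sum.cong) (auto simp: cv_add_right cv_scale_right cv_zero_right)
  also have "\<dots> = (monom_word (j # \<kappa>) w - z j * monom_word \<kappa> w) + z j * (monom_word \<kappa> w - prod_list (map z \<kappa>) * monom_word [] w)"
    using j by (simp add: sum.distrib sum_distrib_left[symmetric] Cons.IH[OF \<kappa>] cvj)
  finally show ?case by (simp add: algebra_simps)
qed

text \<open>Up to a summand of half the norm, \<open>a\<close> factors. A lifted column \<open>G\<close> of \<open>a\<close> in degrees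
  at least \<open>N\<close> has norm at most \<open>N + 1\<close> times that of \<open>a\<close>, and evaluating its left factors at \<open>z\<close>
  multiplies the norm by \<open>s ^ N\<close>.\<close>

lemma factor_step:
  assumes r: "(\<Sum>i<d. (cmod (z i))\<^sup>2) < 1"
  shows "\<exists>K\<ge>0. \<forall>a\<in>alg. \<forall>C>0. nb C a \<longrightarrow> (\<exists>c b. cmod c \<le> K * C \<and> (\<forall>i. b i \<in> polys \<and> nb (K * C) (b i)) \<and>
    nb (C / 2) (\<lambda>w. a w - c * monom_word [] w - (\<Sum>i<d. cv (shifted_letter z i) (b i) w)))"
proof -
  define s where "s = sqrt (\<Sum>i<d. (cmod (z i))\<^sup>2)"
  have s: "0 \<le> s" "s < 1" "s\<^sup>2 = (\<Sum>i<d. (cmod (z i))\<^sup>2)"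
    using r by (auto simp: s_def sum_nonneg)
  \<comment> \<open>The choice of \<open>N\<close> brings \<open>s ^ N\<close> times
    \<open>N + 1\<close> below 2/9. The part of degree at least \<open>N\<close> has norm at most
    \<open>N + 1\<close> times 9/8 of \<open>C\<close>, so evaluated at \<open>z\<close> it
    contributes at most C/4. With two errors of C/8 the total is C/2.\<close>
  have "(\<lambda>n. of_nat n * s ^ n + s ^ n) \<longlonglongrightarrow> 0 + 0"
    using s by (intro tendsto_add powser_times_n_limit_0 LIMSEQ_power_zero) auto
  then have "\<forall>\<^sub>F n in sequentially. of_nat n * s ^ n + s ^ n < 2 / 9"
    by (intro order_tendstoD(2)) auto
  then obtain N where N: "real N * s ^ N + s ^ N < 2 / 9" by (auto simp: eventually_sequentially)
  define LN where "LN = {\<mu> \<in> L. length \<mu> = N}"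
  define LL where "LL = {\<kappa> \<in> L. length \<kappa> < N}"
  have fin: "finite LN" "finite LL"
    by (rule finite_subset[OF _ finite_Lw[of N]]; auto simp: LN_def LL_def Lw_def)+
  define E' where "E' \<kappa> i = (SOME e. nb e (letter_quotient z \<kappa> i))" for \<kappa> i
  have E': "nb (E' \<kappa> i) (letter_quotient z \<kappa> i)" if "\<kappa> \<in> LN \<union> LL" for \<kappa> i
  proof -
    have "\<kappa> \<in> L" using that by (auto simp: LN_def LL_def)
    from nb_polys[OF letter_quotient_polys[OF this]] show ?thesis unfolding E'_def by (rule someI_ex)
  qed
  have E'0: "0 \<le> E' \<kappa> i" if "\<kappa> \<in> LN \<union> LL" for \<kappa> i
    using nb_nonneg[OF E'[OF that]] .
  \<comment> \<open>The bound for \<open>b i\<close> is stated for every index \<open>i\<close>;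
    beyond the alphabet the quotients vanish.\<close>
  have zero_quot: "letter_quotient z \<kappa> i = (\<lambda>w. 0)" if "\<kappa> \<in> L" "\<not> i < d" for \<kappa> i
    using that
  proof (induction \<kappa>)
    case (Cons j \<kappa>)
    then have "\<kappa> \<in> L" "j < d" using L_append2[of "[j]" \<kappa>] L_words by auto
    then show ?case using Cons by auto
  qed simp
  define E where "E = (\<Sum>\<kappa>\<in>LN \<union> LL. \<Sum>i<d. E' \<kappa> i)"
  have E0: "0 \<le> E" unfolding E_def by (intro sum_nonneg E'0)
  have E: "nb E (letter_quotient z \<kappa> i)" if "\<kappa> \<in> LN \<union> LL" for \<kappa> i
  proof (cases "i < d")
    case True
    have "E' \<kappa> i \<le> (\<Sum>i<d. E' \<kappa> i)"
      using True E'[OF that] nb_nonneg by (intro member_le_sum) auto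
    also have "\<dots> \<le> E"
      unfolding E_def using that fin
      by (intro member_le_sum[of \<kappa> _ "\<lambda>\<kappa>. \<Sum>i<d. E' \<kappa> i"]) (auto intro!: sum_nonneg E'0)
    finally show ?thesis using E'[OF that] nb_mono by blast
  next
    case False
    then show ?thesis using zero_quot[of \<kappa> i] that nb_mono[OF nb_zero E0] by (auto simp: LN_def LL_def)
  qed
  \<comment> \<open>Everything here comes from words of length at most \<open>N\<close>, so
    \<open>K\<close> is independent of the element to be factored.\<close>
  define K where "K = (\<Sum>\<kappa>\<in>LL. 9 / 8 * cmod (prod_list (map z \<kappa>))) + (\<Sum>\<kappa>\<in>LL. 9 / 8 * E) + (\<Sum>\<mu>\<in>LN. E * ((real N + 1) * (9 / 8)))"
  have K0: "0 \<le> K" unfolding K_def using E0 by (intro add_nonneg_nonneg sum_nonneg) auto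
  have "\<exists>c b. cmod c \<le> K * C \<and> (\<forall>i. b i \<in> polys \<and> nb (K * C) (b i)) \<and>
    nb (C / 2) (\<lambda>w. a w - c * monom_word [] w - (\<Sum>i<d. cv (shifted_letter z i) (b i) w))"
    if a: "a \<in> alg" and C: "C > 0" and nba: "nb C a" for a C
  proof -
    \<comment> \<open>The averaging works with finite support, so a polynomial replaces
      \<open>a\<close>. This is the first error of C/8 and raises the bound to 9/8 of
      \<open>C\<close>.\<close>
    obtain p where p: "p \<in> polys" and ap: "nb (C / 8) (\<lambda>w. a w - p w)"
      using alg_approx[OF a, of "C / 8"] C by auto
    define C' where "C' = 9 / 8 * C"
    have nbp: "nb C' p"
      using nb_diff[OF nba ap] by (simp add: C'_def algebra_simps)
    \<comment> \<open>Words shorter than \<open>N\<close> can be divided exactly one by one.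
      Subtracting their \<open>N\<close> homogeneous components costs the factor
      \<open>N + 1\<close>.\<close>
    define q where "q w = (if N \<le> length w then p w else 0)" for w
    define C1 where "C1 = (real N + 1) * C'"
    have C1: "0 \<le> C1" "0 \<le> C'" using C by (auto simp: C1_def C'_def)
    have nbq: "nb C1 q"
    proof -
      have "nb (C' + (\<Sum>k<N. C')) (\<lambda>w. p w - (\<Sum>k<N. if length w = k then p w else 0))"
        by (intro nb_diff nbp nb_sum nb_homogeneous) auto
      moreover have "(\<lambda>w. p w - (\<Sum>k<N. if length w = k then p w else 0)) = q"
        by (auto simp: q_def)
      ultimately show ?thesis by (simp add: C1_def algebra_simps)
    qed
    have q: "q \<in> polys"
    proof -
      have "finite {w. q w \<noteq> 0}" by (rule finite_subset[of _ "{w. p w \<noteq> 0}"]) (use p in \<open>auto simp: polys_def q_def\<close>)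
      then show ?thesis using p by (auto simp: polys_def q_def split: if_splits)
    qed
    define Q where "Q = {w. q w \<noteq> 0}"
    have Q: "finite Q" "Q \<subseteq> L" using q by (auto simp: polys_def Q_def)
    define S where "S = (\<Sum>w\<in>Q. cmod (q w) * length w)"
    obtain M1 where M1: "\<forall>w\<in>Q. length w \<le> M1"
      using Q(1) by (metis finite_imageI finite_nat_set_iff_bounded_le imageI)
    obtain M2 where M2: "S / (C / 8) < real M2" using reals_Archimedean2 by blast
    \<comment> \<open>\<open>M1\<close> bounds the degrees of \<open>q\<close>, and
      \<open>M2\<close> makes the Fejer error at most C/8.\<close>
    define M where "M = max M1 M2"
    have MS: "S / (real M + 1) \<le> C / 8"
    proof -
      have "S / (C / 8) \<le> real M + 1" using M2 by (simp add: M_def)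
      then have "S \<le> (real M + 1) * (C / 8)" using C by (simp add: pos_divide_le_eq)
      then show ?thesis by (simp add: pos_divide_le_eq mult.commute)
    qed
    have qN: "N \<le> length w" if "q w \<noteq> 0" for w using that by (simp add: q_def split: if_splits)
    obtain G where G: "\<And>w. G w \<noteq> 0 \<Longrightarrow> w \<in> rows N M"
        "\<And>\<kappa>. \<kappa> \<in> L \<Longrightarrow> N \<le> length \<kappa> \<Longrightarrow> length \<kappa> \<le> N + M \<Longrightarrow> G \<kappa> = of_real (1 - real (length \<kappa> - N) / real (M + 1)) * q \<kappa>"
        "\<And>M' \<xi>. nsq (rows N M') (nc_mult G \<xi>) \<le> C1\<^sup>2 * nsq (Lw M') \<xi>"
      using fejer_lift[OF zero_le_power2 qN nb_bound[OF nbq], of M] by blast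
    define Gm where "Gm \<mu> \<nu> = G (\<mu> @ \<nu>)" for \<mu> \<nu>
    have rows_LN: "rows N M' = (\<lambda>(\<mu>, \<nu>). \<mu> @ \<nu>) ` (LN \<times> Lw M')" for M'
    proof (intro equalityI subsetI)
      fix \<kappa> assume \<kappa>: "\<kappa> \<in> rows N M'"
      then have "(take N \<kappa>, drop N \<kappa>) \<in> LN \<times> Lw M'" by (auto simp: rows_def LN_def Lw_def)
      then have "(\<lambda>(\<mu>, \<nu>). \<mu> @ \<nu>) (take N \<kappa>, drop N \<kappa>) \<in> (\<lambda>(\<mu>, \<nu>). \<mu> @ \<nu>) ` (LN \<times> Lw M')" by (rule imageI)
      then show "\<kappa> \<in> (\<lambda>(\<mu>, \<nu>). \<mu> @ \<nu>) ` (LN \<times> Lw M')" by simp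
    qed (auto simp: rows_def LN_def Lw_def)
    have Gm_polys: "Gm \<mu> \<in> polys" if "\<mu> \<in> LN" for \<mu>
    proof -
      have "\<nu> \<in> Lw M" if "Gm \<mu> \<nu> \<noteq> 0" for \<nu>
        using G(1)[of "\<mu> @ \<nu>"] that \<open>\<mu> \<in> LN\<close> by (auto simp: Gm_def rows_def LN_def Lw_def)
      then have "{\<nu>. Gm \<mu> \<nu> \<noteq> 0} \<subseteq> Lw M" by auto
      moreover have "Lw M \<subseteq> L" by (auto simp: Lw_def)
      ultimately show ?thesis unfolding polys_def by (auto intro: finite_subset[OF _ finite_Lw])
    qed
    have split: "nc_mult G \<xi> (\<mu> @ \<nu>) = nc_mult (Gm \<mu>) \<xi> \<nu>" if "\<mu> \<in> LN" for \<mu> \<nu> \<xi>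
    proof -
      have len: "length \<mu> = N" using that by (simp add: LN_def)
      have "nc_mult G \<xi> (\<mu> @ \<nu>) = (\<Sum>k\<in>(+) N ` {..length \<nu>}. G (take k (\<mu> @ \<nu>)) * \<xi> (drop k (\<mu> @ \<nu>)))"
        unfolding nc_mult_def
      proof (rule sum.mono_neutral_right)
        show "\<forall>k\<in>{..length (\<mu> @ \<nu>)} - (+) N ` {..length \<nu>}. G (take k (\<mu> @ \<nu>)) * \<xi> (drop k (\<mu> @ \<nu>)) = 0"
        proof
          fix k assume k: "k \<in> {..length (\<mu> @ \<nu>)} - (+) N ` {..length \<nu>}"
          have "k < N"
          proof (rule ccontr)
            assume "\<not> k < N"
            then have "k = N + (k - N)" "k - N \<le> length \<nu>" using k len by auto
            then show False using k by blast
          qed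
          then have "take k (\<mu> @ \<nu>) \<notin> rows N M" using len by (auto simp: rows_def)
          then show "G (take k (\<mu> @ \<nu>)) * \<xi> (drop k (\<mu> @ \<nu>)) = 0" using G(1) by auto
        qed
      qed (use len in auto)
      also have "\<dots> = nc_mult (Gm \<mu>) \<xi> \<nu>"
        unfolding nc_mult_def Gm_def by (subst sum.reindex) (auto simp: len)
      finally show ?thesis .
    qed
    have col: "(\<Sum>\<mu>\<in>LN. nsq (Lw M') (nc_mult (Gm \<mu>) \<xi>)) \<le> C1\<^sup>2 * nsq (Lw M') \<xi>" for M' \<xi>
    proof -
      have "(\<Sum>\<mu>\<in>LN. nsq (Lw M') (nc_mult (Gm \<mu>) \<xi>)) = (\<Sum>(\<mu>, \<nu>)\<in>LN \<times> Lw M'. (cmod (nc_mult G \<xi> (\<mu> @ \<nu>)))\<^sup>2)"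
        by (simp add: nsq_def sum.cartesian_product[symmetric] split)
      also have "\<dots> = nsq (rows N M') (nc_mult G \<xi>)"
        unfolding nsq_def rows_LN
        by (subst sum.reindex) (auto simp: inj_on_def LN_def intro!: sum.cong)
      also have "\<dots> \<le> C1\<^sup>2 * nsq (Lw M') \<xi>" by (rule G(3))
      finally show ?thesis .
    qed
    have nbG: "nb C1 (Gm \<mu>)" if "\<mu> \<in> LN" for \<mu>
    proof -
      have "nsq (Lw M') (nc_mult (Gm \<mu>) \<xi>) \<le> (\<Sum>\<mu>\<in>LN. nsq (Lw M') (nc_mult (Gm \<mu>) \<xi>))" for M' \<xi>
        using that fin by (intro member_le_sum[of \<mu> LN "\<lambda>\<mu>. nsq (Lw M') (nc_mult (Gm \<mu>) \<xi>)"]) auto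
      then show ?thesis using col C1 unfolding nb_def by (meson order_trans)
    qed
    \<comment> \<open>What remains of the high degrees after division: each prefix of length
      \<open>N\<close> is replaced by its value at \<open>z\<close>. Cauchy-Schwarz against the
      column bound gives the factor \<open>s ^ N\<close>.\<close>
    define zG where "zG w = (\<Sum>\<mu>\<in>LN. prod_list (map z \<mu>) * Gm \<mu> w)" for w
    have nbz: "nb (s ^ N * C1) zG"
    proof -
      have "nsq (Lw M') (nc_mult zG \<xi>) \<le> (s ^ N * C1)\<^sup>2 * nsq (Lw M') \<xi>" for M' \<xi>
      proof -
        have "nc_mult zG \<xi> = (\<lambda>w. \<Sum>\<mu>\<in>LN. prod_list (map z \<mu>) * nc_mult (Gm \<mu>) \<xi> w)"
          unfolding zG_def nc_mult_sum_left nc_mult_scale_left ..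
        then have "nsq (Lw M') (nc_mult zG \<xi>) \<le> (\<Sum>\<mu>\<in>LN. (cmod (prod_list (map z \<mu>)))\<^sup>2) * (\<Sum>\<mu>\<in>LN. nsq (Lw M') (nc_mult (Gm \<mu>) \<xi>))"
          using nsq_linear_combination by metis
        also have "(\<Sum>\<mu>\<in>LN. (cmod (prod_list (map z \<mu>)))\<^sup>2) \<le> (\<Sum>\<mu>\<in>{\<mu> \<in> words d. length \<mu> = N}. (cmod (prod_list (map z \<mu>)))\<^sup>2)"
          using L_words by (intro sum_mono2 finite_words_eq) (auto simp: LN_def)
        also have "\<dots> = (s ^ N)\<^sup>2" unfolding sum_norm_words s(3)[symmetric] by (simp add: power_mult[symmetric] mult.commute)
        also have "(s ^ N)\<^sup>2 * (\<Sum>\<mu>\<in>LN. nsq (Lw M') (nc_mult (Gm \<mu>) \<xi>)) \<le> (s ^ N)\<^sup>2 * (C1\<^sup>2 * nsq (Lw M') \<xi>)"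
          by (intro mult_left_mono col) simp
        finally show ?thesis by (simp add: mult_right_mono sum_nonneg power_mult_distrib mult.assoc)
      qed
      then show ?thesis using C1 s by (simp add: nb_def)
    qed
    define err where "err w = q w - (\<Sum>\<mu>\<in>LN. cv (monom_word \<mu>) (Gm \<mu>) w)" for w
    \<comment> \<open>The column agrees with \<open>q\<close> on \<open>L\<close> up to the Fejer
      weights, whose distance from 1 is the factor shown.\<close>
    have err: "err w = of_real (real (length w - N) / real (M + 1)) * q w" for w
    proof (cases "w \<in> L \<and> N \<le> length w")
      case True
      have "(\<Sum>\<mu>\<in>LN. cv (monom_word \<mu>) (Gm \<mu>) w) = (\<Sum>\<mu>\<in>LN. if \<mu> = take N w then G w else 0)"
      proof (rule sum.cong[OF refl])
        fix \<mu> assume \<mu>: "\<mu> \<in> LN"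
        show "cv (monom_word \<mu>) (Gm \<mu>) w = (if \<mu> = take N w then G w else 0)"
        proof (cases "\<mu> = take N w")
          case True
          then have "w = \<mu> @ drop N w" by simp
          then have "nc_mult (monom_word \<mu>) (Gm \<mu>) w = Gm \<mu> (drop N w)" by (metis nc_mult_monom_append)
          then show ?thesis using True \<open>w \<in> L \<and> N \<le> length w\<close> by (simp add: cv_def Gm_def)
        next
          case False
          then have "w \<noteq> \<mu> @ v" for v using \<mu> by (auto simp: LN_def)
          then show ?thesis using False by (simp add: cv_def nc_mult_monom_not_prefix)
        qed
      qed
      also have "\<dots> = G w" using True fin by (simp add: LN_def L_take)
      finally have e: "err w = q w - G w" by (simp add: err_def)
      show ?thesis
      proof (cases "length w \<le> N + M")
        case le: True
        have "of_real (real (length w - N) / real (M + 1)) * q w = q w - of_real (1 - real (length w - N) / real (M + 1)) * q w"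
          by (simp only: of_real_diff of_real_1 left_diff_distrib) simp
        then show ?thesis unfolding e using G(2)[of w] True le by (simp only:)
      next
        case False
        then have "w \<notin> Q" using M1 by (auto simp: M_def)
        then have "q w = 0" by (simp add: Q_def)
        moreover have "G w = 0" using G(1)[of w] False by (auto simp: rows_def)
        ultimately show ?thesis using e by simp
      qed
    next
      case False
      have "q w = 0"
      proof (cases "w \<in> L")
        case True
        then show ?thesis using False by (simp add: q_def)
      next
        case False
        then show ?thesis using Q(2) unfolding Q_def by blast
      qed
      moreover have "cv (monom_word \<mu>) (Gm \<mu>) w = 0" if "\<mu> \<in> LN" for \<mu>
      proof (cases "w \<in> L")
        case True
        then have "w \<noteq> \<mu> @ v" for v using that False by (auto simp: LN_def)
        then show ?thesis by (simp add: cv_def nc_mult_monom_not_prefix)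
      qed (simp add: cv_def)
      ultimately show ?thesis by (simp add: err_def)
    qed
    have nberr: "nb (C / 8) err"
    proof (rule nb_mono)
      show "nb (\<Sum>w\<in>Q. cmod (err w)) err"
        by (rule nb_finite_support[OF Q(1)]) (auto simp: err Q_def)
      have "(\<Sum>w\<in>Q. cmod (err w)) \<le> (\<Sum>w\<in>Q. cmod (q w) * length w / (real M + 1))"
      proof (rule sum_mono)
        fix w
        have "cmod (err w) = real (length w - N) / (real M + 1) * cmod (q w)"
          unfolding err norm_mult norm_of_real by simp
        also have "\<dots> \<le> real (length w) / (real M + 1) * cmod (q w)"
          by (intro mult_right_mono divide_right_mono) auto
        finally show "cmod (err w) \<le> cmod (q w) * length w / (real M + 1)" by (simp add: mult.commute)
      qed
      also have "\<dots> = S / (real M + 1)" by (simp add: S_def sum_divide_distrib)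
      also note MS
      finally show "(\<Sum>w\<in>Q. cmod (err w)) \<le> C / 8" .
    qed
    \<comment> \<open>Short words are divided completely and leave the constant \<open>c\<close>.
      Longer words are divided only in their prefix of length \<open>N\<close>, which multiplies a
      column entry by a letter quotient in \<open>b\<close>.\<close>
    define c where "c = (\<Sum>\<kappa>\<in>LL. p \<kappa> * prod_list (map z \<kappa>))"
    define b where "b i w = (\<Sum>\<kappa>\<in>LL. p \<kappa> * letter_quotient z \<kappa> i w) + (\<Sum>\<mu>\<in>LN. cv (letter_quotient z \<mu> i) (Gm \<mu>) w)" for i w
    have pk: "cmod (p \<kappa>) \<le> C'" if "\<kappa> \<in> LL" for \<kappa> using nb_coef[OF nbp] that by (simp add: LL_def)
    have c: "cmod c \<le> K * C"
    proof -
      have "cmod c \<le> (\<Sum>\<kappa>\<in>LL. C' * cmod (prod_list (map z \<kappa>)))"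
        unfolding c_def by (rule order_trans[OF norm_sum]) (auto simp: norm_mult intro!: sum_mono mult_right_mono pk)
      also have "\<dots> = (\<Sum>\<kappa>\<in>LL. 9 / 8 * cmod (prod_list (map z \<kappa>))) * C"
        unfolding C'_def sum_distrib_right by (rule sum.cong) auto
      also have "\<dots> \<le> K * C" unfolding K_def using C E0 by (intro mult_right_mono) (auto intro!: add_nonneg_nonneg sum_nonneg)
      finally show ?thesis .
    qed
    have b_polys: "b i \<in> polys" for i
      unfolding b_def
      by (intro polys_add polys_sum fin polys_scale letter_quotient_polys polys_cv Gm_polys) (auto simp: LL_def LN_def)
    have b_nb: "nb (K * C) (b i)" for i
    proof (rule nb_mono)
      show "nb ((\<Sum>\<kappa>\<in>LL. cmod (p \<kappa>) * E) + (\<Sum>\<mu>\<in>LN. E * C1)) (b i)"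
        unfolding b_def by (intro nb_add nb_sum fin nb_scale nb_cv E nbG) auto
      have "(\<Sum>\<kappa>\<in>LL. cmod (p \<kappa>) * E) \<le> (\<Sum>\<kappa>\<in>LL. 9 / 8 * E) * C"
        unfolding sum_distrib_right
      proof (rule sum_mono)
        fix \<kappa> assume "\<kappa> \<in> LL"
        then have "cmod (p \<kappa>) * E \<le> C' * E" by (intro mult_right_mono pk E0)
        then show "cmod (p \<kappa>) * E \<le> 9 / 8 * E * C" by (simp add: C'_def algebra_simps)
      qed
      moreover have "(\<Sum>\<mu>\<in>LN. E * C1) = (\<Sum>\<mu>\<in>LN. E * ((real N + 1) * (9 / 8))) * C"
        by (simp add: C1_def C'_def)
      moreover have "0 \<le> (\<Sum>\<kappa>\<in>LL. 9 / 8 * cmod (prod_list (map z \<kappa>))) * C" using C by (intro mult_nonneg_nonneg sum_nonneg) auto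
      ultimately show "(\<Sum>\<kappa>\<in>LL. cmod (p \<kappa>) * E) + (\<Sum>\<mu>\<in>LN. E * C1) \<le> K * C"
        unfolding K_def distrib_right by linarith
    qed
    have pexp: "p w = (\<Sum>\<kappa>\<in>LL. p \<kappa> * monom_word \<kappa> w) + q w" for w
    proof -
      have "(\<Sum>\<kappa>\<in>LL. p \<kappa> * monom_word \<kappa> w) = (\<Sum>\<kappa>\<in>LL. if \<kappa> = w then p w else 0)"
        by (rule sum.cong) (auto simp: monom_word_def)
      moreover have "p w = 0" if "w \<notin> L" using p that by (auto simp: polys_def)
      ultimately show ?thesis using fin by (auto simp: LL_def q_def)
    qed
    have sumb: "(\<Sum>i<d. cv (shifted_letter z i) (b i) w) =
        (\<Sum>\<kappa>\<in>LL. p \<kappa> * (monom_word \<kappa> w - prod_list (map z \<kappa>) * monom_word [] w)) +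
        (\<Sum>\<mu>\<in>LN. cv (monom_word \<mu>) (Gm \<mu>) w - prod_list (map z \<mu>) * Gm \<mu> w)" for w
    proof -
      have "(\<Sum>i<d. cv (shifted_letter z i) (b i) w) =
        (\<Sum>i<d. \<Sum>\<kappa>\<in>LL. p \<kappa> * cv (shifted_letter z i) (letter_quotient z \<kappa> i) w) +
        (\<Sum>i<d. \<Sum>\<mu>\<in>LN. cv (cv (shifted_letter z i) (letter_quotient z \<mu> i)) (Gm \<mu>) w)"
        unfolding b_def cv_add_right cv_sum_right cv_scale_right cv_assoc by (rule sum.distrib)
      also have "\<dots> = (\<Sum>\<kappa>\<in>LL. p \<kappa> * (\<Sum>i<d. cv (shifted_letter z i) (letter_quotient z \<kappa> i) w)) +
        (\<Sum>\<mu>\<in>LN. \<Sum>i<d. cv (cv (shifted_letter z i) (letter_quotient z \<mu> i)) (Gm \<mu>) w)"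
        by (subst (1 2) sum.swap) (simp add: sum_distrib_left)
      also have "(\<Sum>\<kappa>\<in>LL. p \<kappa> * (\<Sum>i<d. cv (shifted_letter z i) (letter_quotient z \<kappa> i) w)) =
          (\<Sum>\<kappa>\<in>LL. p \<kappa> * (monom_word \<kappa> w - prod_list (map z \<kappa>) * monom_word [] w))"
        by (rule sum.cong) (auto simp: letter_quotient_sum LL_def)
      also have "(\<Sum>\<mu>\<in>LN. \<Sum>i<d. cv (cv (shifted_letter z i) (letter_quotient z \<mu> i)) (Gm \<mu>) w) =
          (\<Sum>\<mu>\<in>LN. cv (monom_word \<mu>) (Gm \<mu>) w - prod_list (map z \<mu>) * Gm \<mu> w)"
      proof (rule sum.cong[OF refl])
        fix \<mu> assume \<mu>: "\<mu> \<in> LN"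
        then have "\<mu> \<in> L" by (simp add: LN_def)
        have "(\<Sum>i<d. cv (cv (shifted_letter z i) (letter_quotient z \<mu> i)) (Gm \<mu>) w) =
            cv (\<lambda>w. \<Sum>i<d. cv (shifted_letter z i) (letter_quotient z \<mu> i) w) (Gm \<mu>) w"
          unfolding cv_sum_left ..
        also have "\<dots> = cv (monom_word \<mu>) (Gm \<mu>) w - prod_list (map z \<mu>) * cv (monom_word []) (Gm \<mu>) w"
          unfolding letter_quotient_sum[OF \<open>\<mu> \<in> L\<close>] cv_diff_left cv_scale_left ..
        finally show "(\<Sum>i<d. cv (cv (shifted_letter z i) (letter_quotient z \<mu> i)) (Gm \<mu>) w) =
            cv (monom_word \<mu>) (Gm \<mu>) w - prod_list (map z \<mu>) * Gm \<mu> w"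
          by (simp add: cv_unit_left[OF polys_alg[OF Gm_polys[OF \<mu>]]])
      qed
      finally show ?thesis .
    qed
    have fin_eq: "a w - c * monom_word [] w - (\<Sum>i<d. cv (shifted_letter z i) (b i) w) = (a w - p w) + (err w + zG w)" for w
    proof -
      have "(\<Sum>\<kappa>\<in>LL. p \<kappa> * (monom_word \<kappa> w - prod_list (map z \<kappa>) * monom_word [] w)) =
          (\<Sum>\<kappa>\<in>LL. p \<kappa> * monom_word \<kappa> w) - c * monom_word [] w"
        by (simp add: c_def right_diff_distrib sum_subtractf sum_distrib_right mult.assoc)
      then show ?thesis
        unfolding sumb using pexp[of w] by (simp add: err_def zG_def sum_subtractf)
    qed
    have "nb (C / 8 + (C / 8 + s ^ N * C1)) (\<lambda>w. (a w - p w) + (err w + zG w))"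
      by (intro nb_add ap nberr nbz)
    moreover have "C / 8 + (C / 8 + s ^ N * C1) \<le> C / 2"
    proof -
      have "s ^ N * C1 = (real N * s ^ N + s ^ N) * (9 / 8 * C)" by (simp add: C1_def C'_def algebra_simps)
      also have "\<dots> \<le> 2 / 9 * (9 / 8 * C)" using N C by (intro mult_right_mono) auto
      finally show ?thesis by simp
    qed
    ultimately have "nb (C / 2) (\<lambda>w. a w - c * monom_word [] w - (\<Sum>i<d. cv (shifted_letter z i) (b i) w))"
      unfolding fin_eq by (rule nb_mono)
    with c b_polys b_nb show ?thesis by blast
  qed
  then show ?thesis using K0 by blast
qed

end

section \<open>Characters\<close>

context pointed_lang
begin

text \<open>Applying \<open>factor_step\<close> to successive remainders halves the bound each time,
  so constants and coefficients are dominated by geometric series. In the limit no error is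
  left.\<close>

theorem alg_factor:
  assumes r: "(\<Sum>i<d. (cmod (z i))\<^sup>2) < 1" and a: "a \<in> alg"
  shows "\<exists>c b. (\<forall>i. b i \<in> alg) \<and> (\<forall>w. a w = c * monom_word [] w + (\<Sum>i<d. cv (shifted_letter z i) (b i) w))"
proof -
  obtain K where K: "K \<ge> 0" and step: "\<forall>a C. a \<in> alg \<and> C > 0 \<and> nb C a \<longrightarrow> (\<exists>c b. cmod c \<le> K * C \<and> (\<forall>i. b i \<in> polys \<and> nb (K * C) (b i)) \<and>
    nb (C / 2) (\<lambda>w. a w - c * monom_word [] w - (\<Sum>i<d. cv (shifted_letter z i) (b i) w)))"
    using factor_step[OF r] by blast
  define good where "good a C cb \<longleftrightarrow> cmod (fst cb) \<le> K * C \<and> (\<forall>i. snd cb i \<in> polys \<and> nb (K * C) (snd cb i)) \<and>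
    nb (C / 2) (\<lambda>w. a w - fst cb * monom_word [] w - (\<Sum>i<d. cv (shifted_letter z i) (snd cb i) w))" for a C cb
  define cf bf where "cf a C = fst (SOME cb. good a C cb)" and "bf a C = snd (SOME cb. good a C cb)" for a C
  have cb: "cmod (cf a C) \<le> K * C \<and> (\<forall>i. bf a C i \<in> polys \<and> nb (K * C) (bf a C i)) \<and>
    nb (C / 2) (\<lambda>w. a w - cf a C * monom_word [] w - (\<Sum>i<d. cv (shifted_letter z i) (bf a C i) w))"
    if "a \<in> alg" "C > 0" "nb C a" for a C
  proof -
    from step that obtain c b where "good a C (c, b)" unfolding good_def fst_conv snd_conv by blast
    then have "good a C (SOME cb. good a C cb)" by (rule someI)
    then show ?thesis unfolding good_def cf_def bf_def .
  qed
  obtain C where C: "C > 0" "nb C a" using nb_alg[OF a] by blast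
  define next_term where "next_term a C = (\<lambda>w. a w - cf a C * monom_word [] w - (\<Sum>i<d. cv (shifted_letter z i) (bf a C i) w))" for a C
  define A where "A = rec_nat a (\<lambda>n f. next_term f (C / 2 ^ n))"
  have A0: "A 0 = a" and AS: "\<And>n. A (Suc n) = next_term (A n) (C / 2 ^ n)" by (simp_all add: A_def)
  have Cn: "C / 2 ^ n > 0" for n using C by simp
  have inv: "A n \<in> alg \<and> nb (C / 2 ^ n) (A n)" for n
  proof (induction n)
    case 0
    then show ?case using a C A0 by simp
  next
    case (Suc n)
    note cb' = cb[of "A n" "C / 2 ^ n"]
    have "A (Suc n) \<in> alg"
      unfolding AS next_term_def using Suc cb' Cn
      by (intro alg_diff alg_sum alg_cv alg_scale polys_alg[OF polys_monom[OF nil]] polys_alg[OF shifted_letter_polys]) (auto intro: polys_alg)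
    moreover have "nb (C / 2 ^ n / 2) (A (Suc n))"
      unfolding AS next_term_def using Suc cb' Cn by blast
    ultimately show ?case by (simp add: field_simps)
  qed
  define c b where "c n = cf (A n) (C / 2 ^ n)" and "b n i = bf (A n) (C / 2 ^ n) i" for n i
  have cn: "cmod (c n) \<le> K * (C / 2 ^ n)" and bn: "b n i \<in> alg" "nb (K * (C / 2 ^ n)) (b n i)" for n i
    using cb[of "A n" "C / 2 ^ n"] inv Cn by (auto simp: c_def b_def intro: polys_alg)
  have "summable (\<lambda>n. (1 / 2 :: real) ^ n)" by (rule summable_geometric) simp
  from summable_mult[OF this, of "K * C"] have sumK: "summable (\<lambda>n. K * (C / 2 ^ n))"
    by (simp add: power_divide)
  have sc: "summable c" by (rule summable_comparison_test'[OF sumK]) (rule cn)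
  have sb: "summable (\<lambda>n. b n i w)" "(\<lambda>w. \<Sum>n. b n i w) \<in> alg" for i w
    using alg_series[where a = "\<lambda>n. b n i", OF bn sumK] by blast+
  define f where "f n w = c n * monom_word [] w + (\<Sum>i<d. cv (shifted_letter z i) (b n i) w)" for n w
  have An: "A n w = a w - (\<Sum>k<n. f k w)" for n w
  proof (induction n)
    case (Suc n)
    then show ?case by (simp add: AS next_term_def f_def c_def b_def)
  qed (simp add: A0)
  have "(\<lambda>n. f n w) sums a w" for w
  proof -
    have "(\<lambda>n. A n w) \<longlonglongrightarrow> 0"
    proof (rule Lim_null_comparison)
      show "\<forall>\<^sub>F n in sequentially. norm (A n w) \<le> C * (1 / 2) ^ n"
      proof (rule always_eventually, rule allI)
        fix n
        have "cmod (A n w) \<le> C / 2 ^ n"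
          using inv[of n] C by (cases "w \<in> L") (auto simp: nb_coef alg_zeroD)
        then show "norm (A n w) \<le> C * (1 / 2) ^ n" by (simp add: power_divide)
      qed
      show "(\<lambda>n. C * (1 / 2) ^ n) \<longlonglongrightarrow> 0"
        by (rule tendsto_mult_right_zero) (rule LIMSEQ_power_zero, simp)
    qed
    then have "(\<lambda>n. a w - A n w) \<longlonglongrightarrow> a w - 0" by (intro tendsto_diff tendsto_const)
    then show ?thesis by (simp add: sums_def An)
  qed
  moreover have "(\<lambda>n. f n w) sums ((\<Sum>n. c n) * monom_word [] w + (\<Sum>i<d. cv (shifted_letter z i) (\<lambda>w. \<Sum>n. b n i w) w))" for w
    unfolding f_def
  proof (intro sums_add sums_mult2 sums_sum)
    show "c sums (\<Sum>n. c n)" using sc by (rule summable_sums)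
    show "(\<lambda>n. cv (shifted_letter z i) (b n i) w) sums cv (shifted_letter z i) (\<lambda>w. \<Sum>n. b n i w) w" for i
      unfolding cv_suminf(1)[OF sb(1)] by (rule summable_sums[OF cv_suminf(2)[OF sb(1)]])
  qed
  ultimately have "a w = (\<Sum>n. c n) * monom_word [] w + (\<Sum>i<d. cv (shifted_letter z i) (\<lambda>w. \<Sum>n. b n i w) w)" for w
    by (rule sums_unique2)
  then show ?thesis using sb(2) by (intro exI[of _ "\<Sum>n. c n"] exI[of _ "\<lambda>i w. \<Sum>n. b n i w"]) blast
qed

section \<open>Characters and their points in the unit ball\<close>

definition character :: "((nat list \<Rightarrow> complex) \<Rightarrow> complex) \<Rightarrow> bool" where
  "character \<tau> \<longleftrightarrow> \<tau> (monom_word []) = 1 \<and>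
    (\<forall>a\<in>alg. \<forall>b\<in>alg. \<tau> (\<lambda>w. a w + b w) = \<tau> a + \<tau> b \<and> \<tau> (cv a b) = \<tau> a * \<tau> b) \<and>
    (\<forall>c. \<forall>a\<in>alg. \<tau> (\<lambda>w. c * a w) = c * \<tau> a)"

lemma characterD:
  assumes "character \<tau>"
  shows "\<tau> (monom_word []) = 1"
    and "a \<in> alg \<Longrightarrow> b \<in> alg \<Longrightarrow> \<tau> (\<lambda>w. a w + b w) = \<tau> a + \<tau> b"
    and "a \<in> alg \<Longrightarrow> b \<in> alg \<Longrightarrow> \<tau> (cv a b) = \<tau> a * \<tau> b"
    and "a \<in> alg \<Longrightarrow> \<tau> (\<lambda>w. c * a w) = c * \<tau> a"
  using assms by (auto simp: character_def)

lemma character_diff: "character \<tau> \<Longrightarrow> a \<in> alg \<Longrightarrow> b \<in> alg \<Longrightarrow> \<tau> (\<lambda>w. a w - b w) = \<tau> a - \<tau> b"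
  using characterD(2)[of \<tau> a "\<lambda>w. (-1) * b w"] characterD(4)[of \<tau> b "-1"] alg_scale[of b "-1"] by simp

lemma character_zero: "character \<tau> \<Longrightarrow> \<tau> (\<lambda>w. 0) = 0"
  using characterD(4)[of \<tau> "\<lambda>w. 0" 0] polys_alg[OF polys_zero] by simp

lemma character_sum:
  assumes "character \<tau>"
  shows "finite S \<Longrightarrow> (\<And>s. s \<in> S \<Longrightarrow> f s \<in> alg) \<Longrightarrow> \<tau> (\<lambda>w. \<Sum>s\<in>S. f s w) = (\<Sum>s\<in>S. \<tau> (f s))"
proof (induction rule: finite_induct)
  case empty
  then show ?case by (simp add: character_zero[OF assms])
next
  case (insert x F)
  then show ?case
    using characterD(2)[OF assms, of "f x" "\<lambda>w. \<Sum>s\<in>F. f s w"] by (simp add: alg_sum)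
qed

lemma unit_alg: "monom_word [] \<in> alg"
  by (rule polys_alg[OF polys_monom[OF nil]])

text \<open>No continuity is assumed: if \<open>\<tau> a\<close> were larger than \<open>C\<close>, a Neumann series would invert \<open>\<tau> a - a\<close>.\<close>

lemma character_bound:
  assumes \<tau>: "character \<tau>" and a: "a \<in> alg" "nb C a"
  shows "cmod (\<tau> a) \<le> C"
proof (rule ccontr)
  assume "\<not> cmod (\<tau> a) \<le> C"
  then have lt: "C < cmod (\<tau> a)" by simp
  have C0: "0 \<le> C" by (rule nb_nonneg[OF a(2)])
  define b where "b = (\<lambda>w. (1 / \<tau> a) * a w)"
  define \<rho> where "\<rho> = C / cmod (\<tau> a)"
  have \<rho>: "0 \<le> \<rho>" "\<rho> < 1" using lt C0 by (auto simp: \<rho>_def divide_less_eq)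
  have b: "b \<in> alg" unfolding b_def by (rule alg_scale[OF a(1)])
  have "nb (cmod (1 / \<tau> a) * C) b" unfolding b_def by (rule nb_scale[OF a(2)])
  then have nbb: "nb \<rho> b" by (simp add: \<rho>_def norm_divide)
  have "\<tau> b = (1 / \<tau> a) * \<tau> a" unfolding b_def by (rule characterD(4)[OF \<tau> a(1)])
  then have \<tau>b: "\<tau> b = 1" using lt C0 by auto
  define pw where "pw n = ((cv b) ^^ n) (monom_word [])" for n
  have pw: "pw n \<in> alg \<and> nb (\<rho> ^ n) (pw n)" for n
  proof (induction n)
    case 0
    then show ?case using unit_alg nb_monom by (simp add: pw_def)
  next
    case (Suc n)
    then show ?case using alg_cv[OF b] nb_cv[OF nbb] by (simp add: pw_def)
  qed
  have "summable (\<lambda>n. \<rho> ^ n)" using \<rho> by (intro summable_geometric) simp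
  note s = alg_series[OF conjunct1[OF pw] conjunct2[OF pw] this]
  define s0 where "s0 = (\<lambda>w. \<Sum>n. pw n w)"
  have "cv b s0 = (\<lambda>w. \<Sum>n. pw (Suc n) w)"
    unfolding s0_def cv_suminf(1)[OF s(1)] by (simp add: pw_def)
  also have "\<dots> = (\<lambda>w. s0 w - monom_word [] w)"
    unfolding s0_def by (subst suminf_split_head[OF s(1)]) (simp add: pw_def)
  finally have "\<tau> (cv b s0) = \<tau> s0 - 1"
    using character_diff[OF \<tau> _ unit_alg, of s0] s(3) characterD(1)[OF \<tau>] by (simp add: s0_def)
  moreover have "\<tau> (cv b s0) = \<tau> s0"
    using characterD(3)[OF \<tau> b, of s0] s(3) \<tau>b by (simp add: s0_def)
  ultimately show False by simp
qed

text \<open>The class of a word in the quotient, zero outside \<open>L\<close>; words then multiply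
  without any case distinction, see \<open>cv_xword\<close>.\<close>

definition xword :: "nat list \<Rightarrow> nat list \<Rightarrow> complex" where
  "xword \<mu> = (\<lambda>w. if \<mu> \<in> L then monom_word \<mu> w else 0)"

lemma xword_alg: "xword \<mu> \<in> alg"
  unfolding xword_def by (cases "\<mu> \<in> L") (auto intro: polys_alg polys_monom polys_zero)

lemma cv_xword: "cv (xword \<mu>) (xword \<nu>) = xword (\<mu> @ \<nu>)"
proof (cases "\<mu> \<in> L \<and> \<nu> \<in> L")
  case True
  then show ?thesis by (simp add: xword_def cv_monom)
next
  case False
  then have "\<mu> @ \<nu> \<notin> L" using L_append1[of \<mu> \<nu>] L_append2[of \<mu> \<nu>] by blast
  moreover have "xword \<mu> = (\<lambda>w. 0) \<or> xword \<nu> = (\<lambda>w. 0)" using False by (auto simp: xword_def)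
  then have "cv (xword \<mu>) (xword \<nu>) = (\<lambda>w. 0)" by (auto simp: cv_def nc_mult_def)
  ultimately show ?thesis by (simp add: xword_def)
qed

lemma character_xword:
  assumes "character \<tau>" "\<mu> \<in> words d"
  shows "\<tau> (xword \<mu>) = prod_list (map (\<lambda>i. \<tau> (monom_word [i])) \<mu>)"
  using assms(2)
proof (induction \<mu>)
  case Nil
  then show ?case using characterD(1)[OF assms(1)] nil by (simp add: xword_def)
next
  case (Cons i \<mu>)
  have "\<tau> (xword (i # \<mu>)) = \<tau> (xword [i]) * \<tau> (xword \<mu>)"
    using characterD(3)[OF assms(1) xword_alg xword_alg, of "[i]" \<mu>] by (simp add: cv_xword)
  then show ?case using Cons letters by (simp add: xword_def)
qed

text \<open>A letter with a power outside \<open>L\<close> is nilpotent, and characters vanish on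
  nilpotent elements.\<close>

lemma character_support:
  assumes "character \<tau>" "i < d" "\<tau> (monom_word [i]) \<noteq> 0"
  shows "replicate k i \<in> L"
proof (rule ccontr)
  assume "replicate k i \<notin> L"
  then have "xword (replicate k i) = (\<lambda>w. 0)" by (simp add: xword_def)
  moreover have "replicate k i \<in> words d" using assms(2) by (auto simp: words_iff)
  ultimately have "prod_list (map (\<lambda>i. \<tau> (monom_word [i])) (replicate k i)) = 0"
    using character_xword[OF assms(1), of "replicate k i"] character_zero[OF assms(1)] by simp
  then show False using assms(3) by (simp add: prod_list_zero_iff)
qed

text \<open>Multiplicativity and linearity settle polynomials; \<open>character_bound\<close> makes
  both characters small on the error of a polynomial approximation.\<close>

lemma character_eq:
  assumes \<tau>: "character \<tau>" "character \<tau>'" and eq: "\<And>i. i < d \<Longrightarrow> \<tau> (monom_word [i]) = \<tau>' (monom_word [i])"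
    and a: "a \<in> alg"
  shows "\<tau> a = \<tau>' a"
proof -
  have m: "\<tau> (xword \<mu>) = \<tau>' (xword \<mu>)" if "\<mu> \<in> words d" for \<mu>
    unfolding character_xword[OF \<tau>(1) that] character_xword[OF \<tau>(2) that]
    using that eq by (intro arg_cong[where f = prod_list] map_cong) (auto simp: words_iff)
  have p: "\<tau> p = \<tau>' p" if p: "p \<in> polys" for p
  proof -
    have fin: "finite {\<mu>. p \<mu> \<noteq> 0}" using p by (simp add: polys_def)
    have inL: "\<mu> \<in> L" if "p \<mu> \<noteq> 0" for \<mu> using p that by (auto simp: polys_def)
    have "(\<lambda>w. \<Sum>\<mu>\<in>{\<mu>. p \<mu> \<noteq> 0}. p \<mu> * monom_word \<mu> w) = (\<lambda>w. \<Sum>\<mu>\<in>{\<mu>. p \<mu> \<noteq> 0}. p \<mu> * xword \<mu> w)"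
      by (intro ext sum.cong refl) (simp add: xword_def inL)
    then have expand: "p = (\<lambda>w. \<Sum>\<mu>\<in>{\<mu>. p \<mu> \<noteq> 0}. p \<mu> * xword \<mu> w)"
      using polys_expand[OF p] by (rule trans[rotated])
    have "\<psi> p = (\<Sum>\<mu>\<in>{\<mu>. p \<mu> \<noteq> 0}. p \<mu> * \<psi> (xword \<mu>))" if "character \<psi>" for \<psi>
    proof -
      have "\<psi> p = \<psi> (\<lambda>w. \<Sum>\<mu>\<in>{\<mu>. p \<mu> \<noteq> 0}. p \<mu> * xword \<mu> w)" using expand by (rule arg_cong)
      also have "\<dots> = (\<Sum>\<mu>\<in>{\<mu>. p \<mu> \<noteq> 0}. \<psi> (\<lambda>w. p \<mu> * xword \<mu> w))"
        by (rule character_sum[OF that fin]) (rule alg_scale[OF xword_alg])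
      finally show ?thesis by (simp only: characterD(4)[OF that xword_alg])
    qed
    from this[OF \<tau>(1)] this[OF \<tau>(2)]
    have "\<tau> p = (\<Sum>\<mu>\<in>{\<mu>. p \<mu> \<noteq> 0}. p \<mu> * \<tau> (xword \<mu>))" "\<tau>' p = (\<Sum>\<mu>\<in>{\<mu>. p \<mu> \<noteq> 0}. p \<mu> * \<tau>' (xword \<mu>))" .
    moreover have "(\<Sum>\<mu>\<in>{\<mu>. p \<mu> \<noteq> 0}. p \<mu> * \<tau> (xword \<mu>)) = (\<Sum>\<mu>\<in>{\<mu>. p \<mu> \<noteq> 0}. p \<mu> * \<tau>' (xword \<mu>))"
      using m inL L_words by (intro sum.cong refl) auto
    ultimately show ?thesis by simp
  qed
  have "cmod (\<tau> a - \<tau>' a) \<le> 0 + e" if e: "e > 0" for e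
  proof -
    obtain p where p': "p \<in> polys" "nb (e/2) (\<lambda>w. a w - p w)" using alg_approx[OF a, of "e/2"] e by auto
    have d: "(\<lambda>w. a w - p w) \<in> alg" by (rule alg_diff[OF a polys_alg[OF p'(1)]])
    have "\<tau> a - \<tau>' a = \<tau> (\<lambda>w. a w - p w) - \<tau>' (\<lambda>w. a w - p w)"
      using character_diff[OF \<tau>(1) a polys_alg[OF p'(1)]] character_diff[OF \<tau>(2) a polys_alg[OF p'(1)]] p[OF p'(1)] by simp
    also have "cmod \<dots> \<le> e/2 + e/2"
      by (rule order_trans[OF norm_triangle_ineq4 add_mono]) (rule character_bound[OF \<tau>(1) d p'(2)] character_bound[OF \<tau>(2) d p'(2)])+
    finally show ?thesis by simp
  qed
  then have "cmod (\<tau> a - \<tau>' a) \<le> 0" by (rule field_le_epsilon)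
  then show ?thesis by simp
qed

text \<open>Multiplications by distinct letters have orthogonal ranges: the coordinate at
  \<open>j # v\<close> receives only \<open>c j * \<xi> v\<close>.\<close>

lemma nb_row: "nb (sqrt (\<Sum>i<d. (cmod (c i))\<^sup>2)) (\<lambda>w. \<Sum>i<d. c i * monom_word [i] w)"
proof -
  let ?b = "\<lambda>w. \<Sum>i<d. c i * monom_word [i] w"
  have mult: "nc_mult ?b \<xi> w = (\<Sum>i<d. c i * nc_mult (monom_word [i]) \<xi> w)" for \<xi> w
    unfolding nc_mult_sum_left nc_mult_scale_left ..
  have Nil: "nc_mult ?b \<xi> [] = 0" for \<xi>
    unfolding mult by (auto intro!: sum.neutral nc_mult_monom_not_prefix)
  have Cons: "nc_mult ?b \<xi> (j # v) = c j * \<xi> v" if "j < d" for \<xi> j v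
  proof -
    have "c i * nc_mult (monom_word [i]) \<xi> (j # v) = (if i = j then c j * \<xi> v else 0)" for i
      using nc_mult_monom_append[of "[j]" \<xi> v] nc_mult_monom_not_prefix[of "j # v" "[i]" \<xi>] by auto
    then show ?thesis unfolding mult using that by simp
  qed
  have "nsq (Lw M) (nc_mult ?b \<xi>) \<le> (\<Sum>i<d. (cmod (c i))\<^sup>2) * nsq (Lw M) \<xi>" for M \<xi>
  proof -
    have "nsq (Lw M) (nc_mult ?b \<xi>) = nsq (Lw M - {[]}) (nc_mult ?b \<xi>)"
      unfolding nsq_def by (rule sum.mono_neutral_right) (auto simp: Nil)
    also have "\<dots> \<le> (\<Sum>(i, v)\<in>{..<d} \<times> Lw M. (cmod (c i))\<^sup>2 * (cmod (\<xi> v))\<^sup>2)"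
      unfolding nsq_def
    proof (rule sum_le_included[where i = "\<lambda>(i, v). i # v"])
      show "\<forall>w\<in>Lw M - {[]}. \<exists>iv\<in>{..<d} \<times> Lw M. (case iv of (i, v) \<Rightarrow> i # v) = w \<and>
          (cmod (nc_mult ?b \<xi> w))\<^sup>2 \<le> (case iv of (i, v) \<Rightarrow> (cmod (c i))\<^sup>2 * (cmod (\<xi> v))\<^sup>2)"
      proof
        fix w assume "w \<in> Lw M - {[]}"
        then obtain j v where w: "w = j # v" "j # v \<in> L" "length (j # v) \<le> M" by (cases w) (auto simp: Lw_def)
        then have j: "j < d" using L_words by auto
        with w have "(j, v) \<in> {..<d} \<times> Lw M" using L_append2[of "[j]" v] by (auto simp: Lw_def)
        then show "\<exists>iv\<in>{..<d} \<times> Lw M. (case iv of (i, v) \<Rightarrow> i # v) = w \<and>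
          (cmod (nc_mult ?b \<xi> w))\<^sup>2 \<le> (case iv of (i, v) \<Rightarrow> (cmod (c i))\<^sup>2 * (cmod (\<xi> v))\<^sup>2)"
          by (rule rev_bexI) (simp add: w(1) Cons[OF j] norm_mult power_mult_distrib)
      qed
    qed auto
    also have "\<dots> = (\<Sum>i<d. (cmod (c i))\<^sup>2) * nsq (Lw M) \<xi>"
      by (simp add: nsq_def sum_product sum.cartesian_product)
    finally show ?thesis .
  qed
  then show ?thesis by (simp add: nb_def sum_nonneg)
qed

text \<open>A test element for the unit ball: its norm is at most |z|, while a character with point
  z takes the value |z|^2 on it.\<close>

definition conj_row :: "(nat \<Rightarrow> complex) \<Rightarrow> nat list \<Rightarrow> complex" where
  "conj_row z = (\<lambda>w. \<Sum>i<d. cnj (z i) * monom_word [i] w)"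

lemma conj_row_alg: "conj_row z \<in> alg"
  unfolding conj_row_def by (intro alg_sum alg_scale polys_alg polys_monom letters) auto

lemma nb_conj_row: "nb (sqrt (\<Sum>i<d. (cmod (z i))\<^sup>2)) (conj_row z)"
  using nb_row[of "\<lambda>i. cnj (z i)"] by (simp add: conj_row_def)

lemma character_conj_row:
  assumes "character \<tau>"
  shows "\<tau> (conj_row z) = (\<Sum>i<d. cnj (z i) * \<tau> (monom_word [i]))"
  unfolding conj_row_def
  by (subst character_sum[OF assms])
    (auto intro: alg_scale polys_alg polys_monom letters simp: characterD(4)[OF assms polys_alg[OF polys_monom[OF letters]]])

text \<open>Testing on the row conjugate to the point of the character gives
  \<open>S \<le> sqrt S\<close>.\<close>

lemma character_ball:
  assumes "character \<tau>"
  shows "(\<Sum>i<d. (cmod (\<tau> (monom_word [i])))\<^sup>2) \<le> 1"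
proof -
  define S where "S = (\<Sum>i<d. (cmod (\<tau> (monom_word [i])))\<^sup>2)"
  have S0: "0 \<le> S" by (simp add: S_def sum_nonneg)
  have "\<tau> (conj_row (\<lambda>i. \<tau> (monom_word [i]))) = complex_of_real S"
    unfolding character_conj_row[OF assms] S_def of_real_sum
    by (intro sum.cong refl) (metis complex_norm_square mult.commute)
  then have "S \<le> sqrt S"
    using character_bound[OF assms conj_row_alg nb_conj_row, of "\<lambda>i. \<tau> (monom_word [i])"] S0 by (simp add: S_def[symmetric])
  then have "S\<^sup>2 \<le> (sqrt S)\<^sup>2" using S0 by (intro power_mono)
  then have "S * S \<le> S * 1" using S0 by (simp add: power2_eq_square)
  have "S \<le> 1"
  proof (rule ccontr)
    assume "\<not> S \<le> 1"
    then have "S * 1 < S * S" by (intro mult_strict_left_mono) auto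
    with \<open>S * S \<le> S * 1\<close> show False by simp
  qed
  then show ?thesis by (simp add: S_def)
qed

lemma vacuum_character: "character (\<lambda>a. a [])"
  by (auto simp: character_def monom_word_def cv_def nil nc_mult_def)

text \<open>On the powers of \<open>j\<close> the product \<open>cv\<close> is the Cauchy product of
  power series. Their coefficients are bounded, so they converge absolutely in the open disc and can
  be evaluated there.\<close>

lemma disc_character:
  assumes j: "\<And>k. replicate k j \<in> L" and \<zeta>: "cmod \<zeta> < 1"
  shows "character (\<lambda>a. \<Sum>k. a (replicate k j) * \<zeta> ^ k)"
    and "a \<in> alg \<Longrightarrow> summable (\<lambda>k. a (replicate k j) * \<zeta> ^ k)"
    and "(\<Sum>k. monom_word [j] (replicate k j) * \<zeta> ^ k) = \<zeta>"
proof -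
  have norm: "summable (\<lambda>k. norm (a (replicate k j) * \<zeta> ^ k))" if a: "a \<in> alg" for a
  proof -
    obtain C where C: "nb C a" using nb_alg[OF a] by blast
    have "summable (\<lambda>k. C * cmod \<zeta> ^ k)" using \<zeta> by (intro summable_mult summable_geometric) simp
    then show ?thesis
    proof (rule summable_comparison_test')
      fix k
      have "cmod (a (replicate k j)) * cmod \<zeta> ^ k \<le> C * cmod \<zeta> ^ k"
        by (intro mult_right_mono nb_coef[OF C j]) simp
      then show "norm (norm (a (replicate k j) * \<zeta> ^ k)) \<le> C * cmod \<zeta> ^ k"
        by (simp add: norm_mult norm_power)
    qed
  qed
  show summ: "summable (\<lambda>k. a (replicate k j) * \<zeta> ^ k)" if "a \<in> alg" for a
    using norm[OF that] by (rule summable_norm_cancel)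
  have one: "(\<Sum>k. monom_word (replicate m j) (replicate k j) * \<zeta> ^ k) = \<zeta> ^ m" for m
  proof -
    have eq: "replicate k j = replicate m j \<longleftrightarrow> k = m" for k by (metis length_replicate)
    show ?thesis
      by (subst suminf_finite[of "{m}"]) (auto simp: monom_word_def eq)
  qed
  from one[of 1] show "(\<Sum>k. monom_word [j] (replicate k j) * \<zeta> ^ k) = \<zeta>" by simp
  have mult: "(\<Sum>k. cv a b (replicate k j) * \<zeta> ^ k) = (\<Sum>k. a (replicate k j) * \<zeta> ^ k) * (\<Sum>k. b (replicate k j) * \<zeta> ^ k)"
    if "a \<in> alg" "b \<in> alg" for a b
  proof -
    have "cv a b (replicate k j) * \<zeta> ^ k = (\<Sum>i\<le>k. (a (replicate i j) * \<zeta> ^ i) * (b (replicate (k - i) j) * \<zeta> ^ (k - i)))" for k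
    proof -
      have "cv a b (replicate k j) * \<zeta> ^ k = (\<Sum>i\<le>k. a (replicate i j) * b (replicate (k - i) j)) * \<zeta> ^ k"
        using j by (simp add: cv_def nc_mult_def min_def)
      also have "\<dots> = (\<Sum>i\<le>k. (a (replicate i j) * \<zeta> ^ i) * (b (replicate (k - i) j) * \<zeta> ^ (k - i)))"
        unfolding sum_distrib_right
      proof (rule sum.cong[OF refl])
        fix i assume "i \<in> {..k}"
        then have "\<zeta> ^ k = \<zeta> ^ i * \<zeta> ^ (k - i)" by (simp add: power_add[symmetric])
        then show "a (replicate i j) * b (replicate (k - i) j) * \<zeta> ^ k = (a (replicate i j) * \<zeta> ^ i) * (b (replicate (k - i) j) * \<zeta> ^ (k - i))"
          by simp
      qed
      finally show ?thesis .
    qed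
    then show ?thesis by (simp only: Cauchy_product[OF norm[OF that(1)] norm[OF that(2)]])
  qed
  show "character (\<lambda>a. \<Sum>k. a (replicate k j) * \<zeta> ^ k)"
    unfolding character_def
  proof (intro conjI ballI allI)
    show "(\<Sum>k. monom_word [] (replicate k j) * \<zeta> ^ k) = 1" using one[of 0] by simp
    show "(\<Sum>k. (a (replicate k j) + b (replicate k j)) * \<zeta> ^ k) = (\<Sum>k. a (replicate k j) * \<zeta> ^ k) + (\<Sum>k. b (replicate k j) * \<zeta> ^ k)"
      if "a \<in> alg" "b \<in> alg" for a b
      using suminf_add[OF summ[OF that(1)] summ[OF that(2)]] by (simp add: distrib_right)
    show "(\<Sum>k. c * a (replicate k j) * \<zeta> ^ k) = c * (\<Sum>k. a (replicate k j) * \<zeta> ^ k)" if "a \<in> alg" for c a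
      using suminf_mult[OF summ[OF that], of c] by (simp add: mult.assoc)
  qed (use mult in auto)
qed

end

section \<open>Isomorphic algebras have dominated languages\<close>

lemma nc_mult_low_degree:
  assumes "\<And>w. length w < m \<Longrightarrow> u w = 0" "\<And>w. length w < n \<Longrightarrow> v w = 0" "length w < m + n"
  shows "nc_mult u v w = 0"
  unfolding nc_mult_def
proof (intro sum.neutral ballI)
  fix k assume "k \<in> {..length w}"
  then show "u (take k w) * v (drop k w) = 0"
    using assms(1)[of "take k w"] assms(2)[of "drop k w"] assms(3) by (cases "k < m") auto
qed

lemma nc_mult_lowest_degree:
  assumes "u [] = 0" "\<And>w. length w < length \<kappa> \<Longrightarrow> v w = 0"
  shows "nc_mult u v (j # \<kappa>) = u [j] * v \<kappa>"
proof -
  have "nc_mult u v (j # \<kappa>) = (\<Sum>k\<in>{1}. u (take k (j # \<kappa>)) * v (drop k (j # \<kappa>)))"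
    unfolding nc_mult_def
  proof (rule sum.mono_neutral_right)
    show "\<forall>k\<in>{..length (j # \<kappa>)} - {1}. u (take k (j # \<kappa>)) * v (drop k (j # \<kappa>)) = 0"
    proof
      fix k assume k: "k \<in> {..length (j # \<kappa>)} - {1}"
      show "u (take k (j # \<kappa>)) * v (drop k (j # \<kappa>)) = 0"
      proof (cases k)
        case 0
        then show ?thesis using assms(1) by simp
      next
        case (Suc m)
        then have "length (drop m \<kappa>) < length \<kappa>" using k by auto
        then show ?thesis using assms(2) Suc by simp
      qed
    qed
  qed auto
  then show ?thesis by simp
qed

locale alg_equiv = X: pointed_lang d L + Y: pointed_lang d' L' for d L d' L' +
  fixes f g :: "(nat list \<Rightarrow> complex) \<Rightarrow> nat list \<Rightarrow> complex"
  assumes f_alg: "a \<in> X.alg \<Longrightarrow> f a \<in> Y.alg"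
    and f_one: "f (monom_word []) = monom_word []"
    and f_add: "a \<in> X.alg \<Longrightarrow> b \<in> X.alg \<Longrightarrow> f (\<lambda>w. a w + b w) = (\<lambda>w. f a w + f b w)"
    and f_scale: "a \<in> X.alg \<Longrightarrow> f (\<lambda>w. c * a w) = (\<lambda>w. c * f a w)"
    and f_mult: "a \<in> X.alg \<Longrightarrow> b \<in> X.alg \<Longrightarrow> f (X.cv a b) = Y.cv (f a) (f b)"
    and g_alg: "u \<in> Y.alg \<Longrightarrow> g u \<in> X.alg"
    and g_one: "g (monom_word []) = monom_word []"
    and g_add: "u \<in> Y.alg \<Longrightarrow> v \<in> Y.alg \<Longrightarrow> g (\<lambda>w. u w + v w) = (\<lambda>w. g u w + g v w)"
    and g_scale: "u \<in> Y.alg \<Longrightarrow> g (\<lambda>w. c * u w) = (\<lambda>w. c * g u w)"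
    and g_mult: "u \<in> Y.alg \<Longrightarrow> v \<in> Y.alg \<Longrightarrow> g (Y.cv u v) = X.cv (g u) (g v)"
    and gf: "a \<in> X.alg \<Longrightarrow> g (f a) = a"
    and fg: "u \<in> Y.alg \<Longrightarrow> f (g u) = u"
begin

lemma reversed: "alg_equiv d' L' d L g f"
  by unfold_locales (simp_all add: f_alg f_one f_add f_scale f_mult g_alg g_one g_add g_scale g_mult gf fg)

lemma f_diff: "a \<in> X.alg \<Longrightarrow> b \<in> X.alg \<Longrightarrow> f (\<lambda>w. a w - b w) = (\<lambda>w. f a w - f b w)"
  using f_add[of a "\<lambda>w. (-1) * b w"] f_scale[of b "-1"] X.alg_scale[of b "-1"] by simp

lemma f_zero: "f (\<lambda>w. 0) = (\<lambda>w. 0)"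
  using f_scale[OF X.polys_alg[OF X.polys_zero], of 0] by simp

lemma f_sum:
  "finite S \<Longrightarrow> (\<And>s. s \<in> S \<Longrightarrow> h s \<in> X.alg) \<Longrightarrow> f (\<lambda>w. \<Sum>s\<in>S. h s w) = (\<lambda>w. \<Sum>s\<in>S. f (h s) w)"
proof (induction rule: finite_induct)
  case empty
  then show ?case by (simp add: f_zero)
next
  case (insert x F)
  then show ?case using f_add[of "h x" "\<lambda>w. \<Sum>s\<in>F. h s w"] by (simp add: X.alg_sum)
qed

lemma character_pullback: "Y.character \<tau> \<Longrightarrow> X.character (\<lambda>a. \<tau> (f a))"
  unfolding X.character_def
  using f_one f_add f_scale f_mult f_alg Y.characterD[of \<tau>] by auto

definition center :: "nat \<Rightarrow> complex" where
  "center i = f (monom_word [i]) []"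

lemma center_character: "X.character (\<lambda>a. f a [])"
  using character_pullback[OF Y.vacuum_character] .

lemma letter_alg: "i < d \<Longrightarrow> monom_word [i] \<in> X.alg"
  by (rule X.polys_alg[OF X.polys_monom[OF X.letters]])

text \<open>If the center lies on the unit sphere, then \<open>L'\<close> contains all powers of a letter; the
  function \<open>h\<close> below attains its maximal modulus at the origin, so it is constant
  and the center does not determine the character.\<close>

lemma center_in_ball: "(\<Sum>i<d. (cmod (center i))\<^sup>2) < 1"
proof (rule ccontr)
  assume "\<not> ?thesis"
  then have one: "(\<Sum>i<d. (cmod (center i))\<^sup>2) = 1"
    using X.character_ball[OF center_character] by (simp add: center_def)
  interpret R: alg_equiv d' L' d L g f by (rule reversed)
  obtain i where i: "i < d" "center i \<noteq> 0"
  proof -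
    have "\<exists>i<d. center i \<noteq> 0"
    proof (rule ccontr)
      assume "\<not> (\<exists>i<d. center i \<noteq> 0)"
      then have "(\<Sum>i<d. (cmod (center i))\<^sup>2) = 0" by auto
      then show False using one by simp
    qed
    then show thesis using that by blast
  qed
  have repi: "replicate k i \<in> L" for k
    using X.character_support[OF center_character i(1)] i(2) by (simp add: center_def)
  \<comment> \<open>This second character serves to find a letter \<open>j\<close> of the other
    alphabet on which some character is nonzero. If the pullbacks of \<open>\<tau>1\<close> and of
    the vacuum vanished on all letters they would agree, yet they differ at the image of letter
    \<open>i\<close>.\<close>
  define \<tau>1 where "\<tau>1 a = (\<Sum>k. a (replicate k i) * (1/2) ^ k)" for a :: "nat list \<Rightarrow> complex"
  have \<tau>1: "X.character \<tau>1" unfolding \<tau>1_def by (rule X.disc_character(1)[OF repi]) (simp add: norm_divide)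
  have \<tau>1i: "\<tau>1 (monom_word [i]) = 1/2" unfolding \<tau>1_def by (rule X.disc_character(3)[OF repi]) (simp add: norm_divide)
  have ch: "Y.character (\<lambda>u. \<tau>1 (g u))" "Y.character (\<lambda>u. g u [])"
    using R.character_pullback[OF \<tau>1] R.center_character by simp_all
  obtain j \<sigma> where j: "j < d'" "Y.character \<sigma>" "\<sigma> (monom_word [j]) \<noteq> 0"
  proof -
    have "\<exists>j<d'. \<tau>1 (g (monom_word [j])) \<noteq> 0 \<or> g (monom_word [j]) [] \<noteq> 0"
    proof (rule ccontr)
      assume "\<not> ?thesis"
      then have "\<tau>1 (g u) = g u []" if "u \<in> Y.alg" for u
        using Y.character_eq[OF ch(1) ch(2) _ that] by simp
      from this[OF f_alg[OF letter_alg[OF i(1)]]] have "\<tau>1 (monom_word [i]) = monom_word [i] []"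
        by (simp add: gf letter_alg i(1))
      then show False using \<tau>1i by (simp add: monom_word_def)
    qed
    then show thesis using that ch by blast
  qed
  have repj: "replicate k j \<in> L'" for k
    by (rule Y.character_support[OF j(2) j(1) j(3)])
  \<comment> \<open>The bound is 1 because the center has norm 1, and the constant term of
    \<open>f b\<close> is the squared norm of the center. The disc function \<open>h\<close>
    therefore reaches its bound at 0.\<close>
  define b where "b = X.conj_row center"
  have b: "b \<in> X.alg" "X.nb 1 b"
    using X.conj_row_alg X.nb_conj_row[of center] one by (simp_all add: b_def)
  define D where "D \<zeta> u = (\<Sum>k. u (replicate k j) * \<zeta> ^ k)" for \<zeta> :: complex and u :: "nat list \<Rightarrow> complex"
  have D: "Y.character (D \<zeta>)" if "cmod \<zeta> < 1" for \<zeta>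
    unfolding D_def by (rule Y.disc_character(1)[OF repj that])
  define h where "h \<zeta> = D \<zeta> (f b)" for \<zeta>
  have hle: "cmod (h \<zeta>) \<le> 1" if "cmod \<zeta> < 1" for \<zeta>
    unfolding h_def using X.character_bound[OF character_pullback[OF D[OF that]] b] .
  have h0: "h 0 = 1"
  proof -
    have "h 0 = f b []"
      unfolding h_def D_def by (subst suminf_finite[of "{0}"]) auto
    also have "\<dots> = (\<Sum>i<d. cnj (center i) * center i)"
      unfolding b_def X.character_conj_row[OF center_character] by (simp add: center_def)
    also have "\<dots> = complex_of_real (\<Sum>i<d. (cmod (center i))\<^sup>2)"
      unfolding of_real_sum by (intro sum.cong refl) (metis complex_norm_square mult.commute)
    finally show ?thesis using one by simp
  qed
  have "h holomorphic_on ball 0 1"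
  proof (rule power_series_holomorphic)
    fix \<zeta> :: complex assume "\<zeta> \<in> ball 0 1"
    then have "cmod \<zeta> < 1" by simp
    then show "(\<lambda>n. f b (replicate n j) * (\<zeta> - 0) ^ n) sums h \<zeta>"
      unfolding h_def D_def using summable_sums[OF Y.disc_character(2)[OF repj _ f_alg[OF b(1)]]] by simp
  qed
  then have "h constant_on ball 0 1"
    using hle h0 by (intro maximum_modulus_principle[where U = "ball 0 1" and \<xi> = 0]) auto
  then obtain c where c: "\<And>\<zeta>. \<zeta> \<in> ball 0 1 \<Longrightarrow> h \<zeta> = c" unfolding constant_on_def by blast
  have half: "cmod (1/2) < 1" by (simp add: norm_divide)
  have h2: "h (1/2) = 1" using c[of 0] c[of "1/2"] h0 half by (simp del: norm_divide)
  define \<tau> where "\<tau> a = D (1/2) (f a)" for a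
  have \<tau>: "X.character \<tau>" unfolding \<tau>_def by (rule character_pullback[OF D[OF half]])
  define y where "y i = \<tau> (monom_word [i])" for i
  have inner: "(\<Sum>i<d. cnj (center i) * y i) = 1"
    using h2 X.character_conj_row[OF \<tau>, of center] by (simp add: y_def h_def \<tau>_def b_def)
  have yle: "(\<Sum>i<d. (cmod (y i))\<^sup>2) \<le> 1" using X.character_ball[OF \<tau>] by (simp add: y_def)
  \<comment> \<open>Equality case of Cauchy-Schwarz: two points of the closed unit ball with inner
    product 1 coincide.\<close>
  have "(\<Sum>i<d. (cmod (y i - center i))\<^sup>2) = (\<Sum>i<d. (cmod (y i))\<^sup>2) + (\<Sum>i<d. (cmod (center i))\<^sup>2) - 2 * Re (\<Sum>i<d. cnj (center i) * y i)"
  proof -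
    have "(cmod (u - v))\<^sup>2 = (cmod u)\<^sup>2 + (cmod v)\<^sup>2 - 2 * Re (cnj v * u)" for u v :: complex
      unfolding cmod_power2 by (simp add: power2_diff algebra_simps)
    then show ?thesis by (simp add: sum.distrib sum_subtractf sum_distrib_left)
  qed
  then have "(\<Sum>i<d. (cmod (y i - center i))\<^sup>2) \<le> 0" using yle one inner by simp
  then have "(\<Sum>i<d. (cmod (y i - center i))\<^sup>2) = 0" by (meson order_antisym sum_nonneg zero_le_power2)
  then have "y i = center i" if "i < d" for i
    using that by (subst (asm) sum_nonneg_eq_0_iff) auto
  then have eq: "\<tau> a = f a []" if "a \<in> X.alg" for a
    using X.character_eq[OF \<tau> center_character _ that] by (simp add: y_def center_def)
  have mj: "monom_word [j] \<in> Y.alg" by (rule R.letter_alg[OF j(1)])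
  \<comment> \<open>The points 0 and 1/2 of the disc now give the same character, although their
    values at letter \<open>j\<close> are 0 and 1/2.\<close>
  have "D (1/2) (monom_word [j]) = monom_word [j] []"
    using eq[OF g_alg[OF mj]] by (simp add: \<tau>_def fg[OF mj])
  moreover have "D (1/2) (monom_word [j]) = 1/2"
    unfolding D_def by (rule Y.disc_character(3)[OF repj half])
  ultimately show False by (simp add: monom_word_def)
qed

lemma shifted_letter_alg: "i < d \<Longrightarrow> shifted_letter z i \<in> X.alg"
  by (rule X.polys_alg[OF X.shifted_letter_polys])

lemma f_shifted_letter:
  assumes "i < d"
  shows "f (shifted_letter z i) = (\<lambda>w. f (monom_word [i]) w - z i * monom_word [] w)"
  unfolding shifted_letter_def
  using f_diff[OF letter_alg[OF assms] X.alg_scale[OF X.unit_alg, of "z i"]] f_scale[OF X.unit_alg, of "z i"] f_one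
  by simp

lemma f_poly:
  assumes p: "p \<in> X.polys" and S: "finite S" "\<And>w. p w \<noteq> 0 \<Longrightarrow> w \<in> S" "S \<subseteq> L"
  shows "f p = (\<lambda>w. \<Sum>s\<in>S. f (monom_word s) w * p s)"
proof -
  have "p = (\<lambda>w. \<Sum>s\<in>S. p s * monom_word s w)"
  proof
    fix w
    have "(\<Sum>s\<in>S. p s * monom_word s w) = (\<Sum>s\<in>S. if s = w then p w else 0)"
      by (rule sum.cong) (auto simp: monom_word_def)
    then show "p w = (\<Sum>s\<in>S. p s * monom_word s w)" using S by auto
  qed
  then have "f p = f (\<lambda>w. \<Sum>s\<in>S. p s * monom_word s w)" by (rule arg_cong)
  also have "\<dots> = (\<lambda>w. \<Sum>s\<in>S. f (\<lambda>w. p s * monom_word s w) w)"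
    using S by (intro f_sum X.alg_scale X.polys_alg X.polys_monom) auto
  also have "\<dots> = (\<lambda>w. \<Sum>s\<in>S. f (monom_word s) w * p s)"
    using S f_scale[OF X.polys_alg[OF X.polys_monom]] by (intro ext sum.cong refl) (auto simp: mult.commute)
  finally show ?thesis .
qed

text \<open>Induction on the degree. The image of a letter shifted by its \<open>center\<close>
  value has no constant term, so up to degree \<open>n\<close> a product with it on the left depends
  only on the right factor in degrees below \<open>n\<close>. There the induction hypothesis
  replaces the coefficients of the factorization by polynomials.\<close>

lemma poly_approximation:
  "a \<in> X.alg \<Longrightarrow> \<exists>p\<in>X.polys. (\<forall>w. p w \<noteq> 0 \<longrightarrow> length w < n) \<and> (\<forall>w. length w < n \<longrightarrow> f a w = f p w)"
proof (induction n arbitrary: a)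
  case 0
  then show ?case using X.polys_zero by (intro bexI[of _ "\<lambda>w. 0"]) auto
next
  case (Suc n)
  obtain c b where b: "\<And>i. b i \<in> X.alg" and a: "\<And>w. a w = c * monom_word [] w + (\<Sum>i<d. X.cv (shifted_letter center i) (b i) w)"
    using X.alg_factor[OF center_in_ball Suc.prems] by blast
  define P where "P i = (SOME p. p \<in> X.polys \<and> (\<forall>w. p w \<noteq> 0 \<longrightarrow> length w < n) \<and> (\<forall>w. length w < n \<longrightarrow> f (b i) w = f p w))" for i
  have P: "P i \<in> X.polys \<and> (\<forall>w. P i w \<noteq> 0 \<longrightarrow> length w < n) \<and> (\<forall>w. length w < n \<longrightarrow> f (b i) w = f (P i) w)" for i
  proof -
    from Suc.IH[OF b[of i]] have "\<exists>p. p \<in> X.polys \<and> (\<forall>w. p w \<noteq> 0 \<longrightarrow> length w < n) \<and> (\<forall>w. length w < n \<longrightarrow> f (b i) w = f p w)"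
      by blast
    from someI_ex[OF this] show ?thesis unfolding P_def .
  qed
  define p where "p = (\<lambda>w. c * monom_word [] w + (\<Sum>i<d. X.cv (shifted_letter center i) (P i) w))"
  have Pp: "P i \<in> X.polys" for i using P by blast
  have p: "p \<in> X.polys"
    unfolding p_def by (intro X.polys_add X.polys_scale X.polys_sum X.polys_cv Pp X.shifted_letter_polys X.polys_monom X.nil) auto
  have deg: "length w < Suc n" if "p w \<noteq> 0" for w
  proof (rule ccontr)
    assume w: "\<not> length w < Suc n"
    \<comment> \<open>A shifted letter raises the degree by at most one; for \<open>n = 0\<close>
      every \<open>P i\<close> is zero.\<close>
    have "X.cv (shifted_letter center i) (P i) w = 0" for i
    proof -
      have "shifted_letter center i (take k w) * P i (drop k w) = 0" for k
      proof (cases "k \<le> 1")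
        case True
        then have "\<not> length (drop k w) < n" using w by auto
        then have "P i (drop k w) = 0" using P[of i] by blast
        then show ?thesis by simp
      next
        case False
        then have "length (take k w) > 1 \<or> drop k w = []" by auto
        moreover have "shifted_letter center i v = 0" if "length v > 1" for v
          using that by (auto simp: shifted_letter_def monom_word_def)
        moreover have "P i [] = 0 \<or> n > 0" using P[of i] by auto
        moreover have "length (take k w) > 1" if "n > 0" using that False w by auto
        ultimately show ?thesis by auto
      qed
      then have "nc_mult (shifted_letter center i) (P i) w = 0"
        unfolding nc_mult_def by (simp only: sum.neutral_const)
      then show ?thesis by (simp add: X.cv_def)
    qed
    moreover have "monom_word [] w = 0" using w by (auto simp: monom_word_def)
    ultimately show False using that by (simp add: p_def)
  qed
  have lin: "f (\<lambda>w. c * monom_word [] w + (\<Sum>i<d. X.cv (shifted_letter center i) (h i) w)) =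
      (\<lambda>w. c * monom_word [] w + (\<Sum>i<d. Y.cv (f (shifted_letter center i)) (f (h i)) w))"
    if h: "\<And>i. h i \<in> X.alg" for h
  proof -
    have t: "X.cv (shifted_letter center i) (h i) \<in> X.alg" if "i < d" for i
      by (rule X.alg_cv[OF shifted_letter_alg[OF that] h])
    have "f (\<lambda>w. c * monom_word [] w + (\<Sum>i<d. X.cv (shifted_letter center i) (h i) w)) =
      (\<lambda>w. f (\<lambda>w. c * monom_word [] w) w + f (\<lambda>w. \<Sum>i<d. X.cv (shifted_letter center i) (h i) w) w)"
      by (intro f_add X.alg_scale X.unit_alg X.alg_sum t) auto
    also have "\<dots> = (\<lambda>w. c * monom_word [] w + (\<Sum>i<d. f (X.cv (shifted_letter center i) (h i)) w))"
      by (subst f_sum) (auto simp: t f_scale[OF X.unit_alg] f_one)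
    also have "\<dots> = (\<lambda>w. c * monom_word [] w + (\<Sum>i<d. Y.cv (f (shifted_letter center i)) (f (h i)) w))"
      by (intro ext arg_cong2[where f = "(+)"] refl sum.cong) (simp add: f_mult[OF shifted_letter_alg h])
    finally show ?thesis .
  qed
  have "f a w = f p w" if w: "length w < Suc n" for w
  proof -
    have "f a = (\<lambda>w. c * monom_word [] w + (\<Sum>i<d. Y.cv (f (shifted_letter center i)) (f (b i)) w))"
      by (rule trans[OF arg_cong[OF ext[OF a], of f] lin[OF b]])
    moreover have "f p = (\<lambda>w. c * monom_word [] w + (\<Sum>i<d. Y.cv (f (shifted_letter center i)) (f (P i)) w))"
      unfolding p_def by (rule lin[OF X.polys_alg[OF Pp]])
    moreover have "Y.cv (f (shifted_letter center i)) (f (b i)) w = Y.cv (f (shifted_letter center i)) (f (P i)) w" if i: "i < d" for i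
    proof -
      have "nc_mult (f (shifted_letter center i)) (\<lambda>w. f (b i) w - f (P i) w) w = 0"
      proof (rule nc_mult_low_degree[where m = 1 and n = n])
        show "f (shifted_letter center i) w = 0" if "length w < 1" for w
          using that by (simp add: f_shifted_letter[OF i] center_def monom_word_def)
      qed (use P w in auto)
      then show ?thesis by (simp add: Y.cv_def nc_mult_diff_right)
    qed
    ultimately show ?thesis by simp
  qed
  then show ?case using p deg by blast
qed

section \<open>The isomorphism on polynomials of bounded degree\<close>

lemma finite_shorter: "finite {w \<in> L. length w < n}"
  by (rule finite_subset[OF _ X.finite_Lw[of n]]) (auto simp: X.Lw_def)

text \<open>The coefficients \<open>c\<close> are those of a polynomial that approximates the
  preimage \<open>g (monom_word t0)\<close> in the sense of
  \<open>poly_approximation\<close>.\<close>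

lemma surjective_shorter:
  assumes t0: "t0 \<in> L'"
  shows "\<exists>c. \<forall>t. length t < n \<longrightarrow> (\<Sum>s\<in>{w \<in> L. length w < n}. f (monom_word s) t * c s) = (if t = t0 then 1 else 0)"
proof -
  have m: "monom_word t0 \<in> Y.alg" by (rule Y.polys_alg[OF Y.polys_monom[OF t0]])
  obtain p where p: "p \<in> X.polys" "\<And>w. p w \<noteq> 0 \<Longrightarrow> length w < n" "\<And>w. length w < n \<Longrightarrow> f (g (monom_word t0)) w = f p w"
    using poly_approximation[OF g_alg[OF m], of n] by blast
  have fp: "f p = (\<lambda>w. \<Sum>s\<in>{w \<in> L. length w < n}. f (monom_word s) w * p s)"
    by (rule f_poly[OF p(1) finite_shorter]) (use p in \<open>auto simp: X.polys_def\<close>)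
  have "(\<Sum>s\<in>{w \<in> L. length w < n}. f (monom_word s) t * p s) = (if t = t0 then 1 else 0)" if "length t < n" for t
    using p(3)[OF that] unfolding fp fg[OF m] by (simp add: monom_word_def[of t0])
  then show ?thesis by blast
qed

lemma card_shorter: "card {w \<in> L'. length w < n} \<le> card {w \<in> L. length w < n}"
proof -
  interpret R: alg_equiv d' L' d L g f by (rule reversed)
  show ?thesis
  proof (rule finite_right_inverse(1)[OF finite_shorter R.finite_shorter, where m = "\<lambda>t s. f (monom_word s) t"])
    fix t0 assume "t0 \<in> {w \<in> L'. length w < n}"
    then show "\<exists>c. \<forall>t\<in>{w \<in> L'. length w < n}. (\<Sum>s\<in>{w \<in> L. length w < n}. f (monom_word s) t * c s) = (if t = t0 then 1 else 0)"
      using surjective_shorter[of t0 n] by blast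
  qed
qed

lemma injective_shorter:
  assumes p: "p \<in> X.polys" "\<And>w. p w \<noteq> 0 \<Longrightarrow> length w < n" and z: "\<And>w. length w < n \<Longrightarrow> f p w = 0"
  shows "p w = 0"
proof -
  interpret R: alg_equiv d' L' d L g f by (rule reversed)
  have fp: "f p = (\<lambda>w. \<Sum>s\<in>{w \<in> L. length w < n}. f (monom_word s) w * p s)"
    by (rule f_poly[OF p(1) finite_shorter]) (use p in \<open>auto simp: X.polys_def\<close>)
  have "p w = 0" if w: "w \<in> {w \<in> L. length w < n}"
  proof (rule finite_right_inverse(2)[OF finite_shorter R.finite_shorter, where m = "\<lambda>t s. f (monom_word s) t"])
    show "\<exists>c. \<forall>t\<in>{w \<in> L'. length w < n}. (\<Sum>s\<in>{w \<in> L. length w < n}. f (monom_word s) t * c s) = (if t = t0 then 1 else 0)"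
      if "t0 \<in> {w \<in> L'. length w < n}" for t0
      using surjective_shorter[of t0 n] that by blast
    show "card {w \<in> L. length w < n} = card {w \<in> L'. length w < n}"
      using card_shorter[of n] R.card_shorter[of n] by simp
    show "(\<Sum>s\<in>{w \<in> L. length w < n}. f (monom_word s) t * p s) = 0" if "t \<in> {w \<in> L'. length w < n}" for t
      using z[of t] that unfolding fp by simp
  qed (rule w)
  then show ?thesis using p by (auto simp: X.polys_def)
qed

theorem dominates: "word_dominates d L d' L'"
proof -
  define A where "A j i = f (monom_word [i]) [j]" for j i
  have m0: "monom_word [] [j] = 0" for j by (simp add: monom_word_def)
  \<comment> \<open>The right inverse of \<open>A\<close> is the case of degrees below 2. The
    constant drops out because \<open>f\<close> fixes the unit, whose coefficients at letters are
    zero.\<close>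
  have short: "{w \<in> L. length w < 2} = insert [] ((\<lambda>i. [i]) ` {..<d})"
  proof (intro equalityI subsetI)
    fix w assume w: "w \<in> {w \<in> L. length w < 2}"
    then consider "w = []" | i where "w = [i]" by (cases w rule: remdups_adj.cases) auto
    then show "w \<in> insert [] ((\<lambda>i. [i]) ` {..<d})" using w X.L_words by cases auto
  qed (use X.nil X.letters in auto)
  have "\<exists>c. \<forall>j<d'. (\<Sum>i<d. A j i * c i) = (if j = j' then 1 else 0)" if j': "j' < d'" for j'
  proof -
    obtain c where c: "\<And>t. length t < 2 \<Longrightarrow> (\<Sum>s\<in>{w \<in> L. length w < 2}. f (monom_word s) t * c s) = (if t = [j'] then 1 else 0)"
      using surjective_shorter[OF Y.letters[OF j'], of 2] by blast
    have "(\<Sum>i<d. A j i * c [i]) = (if j = j' then 1 else 0)" for j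
    proof -
      have "(\<Sum>s\<in>{w \<in> L. length w < 2}. f (monom_word s) [j] * c s) = (\<Sum>i<d. A j i * c [i])"
        unfolding short by (subst sum.insert) (auto simp: sum.reindex inj_on_def A_def f_one m0)
      then show ?thesis using c[of "[j]"] by simp
    qed
    then show ?thesis by (intro exI[of _ "\<lambda>i. c [i]"]) blast
  qed
  then obtain c where c: "\<And>j j'. j' < d' \<Longrightarrow> j < d' \<Longrightarrow> (\<Sum>i<d. A j i * c j' i) = (if j = j' then 1 else 0)"
    by metis
  have "(\<Prod>k<length \<mu>. A (\<kappa> ! k) (\<mu> ! k)) = 0"
    if \<mu>: "\<mu> \<in> words d" "\<mu> \<notin> L" and \<kappa>: "\<kappa> \<in> L'" "length \<kappa> = length \<mu>" for \<mu> \<kappa>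
  proof -
    define q where "q = rec_list (monom_word []) (\<lambda>i \<mu> r. X.cv (shifted_letter center i) r)"
    have q_simps: "q [] = monom_word []" "q (i # \<nu>) = X.cv (shifted_letter center i) (q \<nu>)" for i \<nu>
      by (simp_all add: q_def)
    have q_polys: "q \<nu> \<in> X.polys" if "\<nu> \<in> words d" for \<nu>
      using that by (induction \<nu>) (auto simp: q_simps X.polys_monom X.nil X.polys_cv X.shifted_letter_polys)
    \<comment> \<open>The only word of full length in the expanded product is \<open>\<nu>\<close>
      itself. For \<open>\<mu>\<close>, which is not in \<open>L\<close>, this leading term is
      lost.\<close>
    have q_top: "length w < length \<nu> \<or> w = \<nu>" if "q \<nu> w \<noteq> 0" for \<nu> w
      using that
    proof (induction \<nu> arbitrary: w)
      case Nil
      then show ?case by (auto simp: q_simps monom_word_def split: if_splits)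
    next
      case (Cons i \<nu>)
      then have "nc_mult (monom_word [i]) (q \<nu>) w - center i * q \<nu> w \<noteq> 0"
        by (auto simp: q_simps X.cv_def shifted_letter_def nc_mult_diff_left nc_mult_scale_left nc_mult_one(1) split: if_splits)
      then consider "q \<nu> w \<noteq> 0" | "nc_mult (monom_word [i]) (q \<nu>) w \<noteq> 0" by fastforce
      then show ?case
      proof cases
        case 1
        then show ?thesis using Cons.IH[of w] by auto
      next
        case 2
        then obtain v where v: "w = [i] @ v" using nc_mult_monom_not_prefix by blast
        then have "q \<nu> v \<noteq> 0" using 2 nc_mult_monom_append[of "[i]" "q \<nu>" v] by simp
        then show ?thesis using Cons.IH[of v] v by auto
      qed
    qed
    \<comment> \<open>Every factor maps to an element without constant term and so raises the order
      by one; in lowest degree only the coefficients at letters are multiplied.\<close>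
    have fq: "(\<forall>w. length w < length \<nu> \<longrightarrow> f (q \<nu>) w = 0) \<and>
        (\<forall>\<kappa>\<in>L'. length \<kappa> = length \<nu> \<longrightarrow> f (q \<nu>) \<kappa> = (\<Prod>k<length \<nu>. A (\<kappa> ! k) (\<nu> ! k)))" if "\<nu> \<in> words d" for \<nu>
      using that
    proof (induction \<nu>)
      case Nil
      then show ?case by (simp add: q_simps f_one) (simp add: monom_word_def)
    next
      case (Cons i \<nu>)
      then have i: "i < d" and \<nu>: "\<nu> \<in> words d" by auto
      note IH = Cons.IH[OF \<nu>]
      have fq: "f (q (i # \<nu>)) = Y.cv (f (shifted_letter center i)) (f (q \<nu>))"
        unfolding q_simps by (rule f_mult[OF shifted_letter_alg[OF i] X.polys_alg[OF q_polys[OF \<nu>]]])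
      have f0: "f (shifted_letter center i) [] = 0"
        by (simp add: f_shifted_letter[OF i] center_def monom_word_def)
      show ?case
      proof (intro conjI allI impI ballI)
        fix w :: "nat list" assume "length w < length (i # \<nu>)"
        then have "nc_mult (f (shifted_letter center i)) (f (q \<nu>)) w = 0"
          using f0 IH by (intro nc_mult_low_degree[where m = 1 and n = "length \<nu>"]) auto
        then show "f (q (i # \<nu>)) w = 0" by (simp add: fq Y.cv_def)
      next
        fix \<kappa> assume \<kappa>: "\<kappa> \<in> L'" "length \<kappa> = length (i # \<nu>)"
        then obtain j \<kappa>' where jk: "\<kappa> = j # \<kappa>'" "length \<kappa>' = length \<nu>" by (cases \<kappa>) auto
        then have "\<kappa>' \<in> L'" using \<kappa> Y.L_append2[of "[j]" \<kappa>'] by simp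
        have "f (q (i # \<nu>)) \<kappa> = f (shifted_letter center i) [j] * f (q \<nu>) \<kappa>'"
          unfolding fq Y.cv_def using \<kappa> jk IH f0 by (simp add: nc_mult_lowest_degree)
        also have "f (shifted_letter center i) [j] = A j i"
          by (simp add: f_shifted_letter[OF i] A_def monom_word_def)
        also have "f (q \<nu>) \<kappa>' = (\<Prod>k<length \<nu>. A (\<kappa>' ! k) (\<nu> ! k))"
          using IH \<open>\<kappa>' \<in> L'\<close> jk by blast
        finally show "f (q (i # \<nu>)) \<kappa> = (\<Prod>k<length (i # \<nu>). A (\<kappa> ! k) ((i # \<nu>) ! k))"
          unfolding jk by (simp add: prod.lessThan_Suc_shift del: prod.lessThan_Suc)
      qed
    qed
    have "q \<mu> w = 0" for w
    proof (rule injective_shorter[OF q_polys[OF \<mu>(1)], where n = "length \<mu>"])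
      show "length w < length \<mu>" if "q \<mu> w \<noteq> 0" for w
        using q_top[OF that] q_polys[OF \<mu>(1)] that \<mu>(2) by (auto simp: X.polys_def)
    qed (use fq[OF \<mu>(1)] in blast)
    then have "q \<mu> = (\<lambda>w. 0)" by auto
    then have "f (q \<mu>) \<kappa> = 0" by (simp add: f_zero)
    then show ?thesis using fq[OF \<mu>(1)] \<kappa> by auto
  qed
  then show ?thesis
    unfolding word_dominates_def using c by (intro exI[of _ A] exI[of _ "\<lambda>i j'. c j' i"]) auto
qed

end

section \<open>The tensor algebra as an algebra of multipliers\<close>

lemma ell2_summable: "\<xi> \<in> ell2 \<longleftrightarrow> (\<lambda>w. (cmod (\<xi> w))\<^sup>2) summable_on UNIV"
  by (simp add: ell2_def)

lemma l2_norm_nonneg [simp]: "0 \<le> l2_norm \<xi>"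
  by (simp add: l2_norm_def infsum_nonneg)

lemma l2_norm_sq: "(l2_norm \<xi>)\<^sup>2 = (\<Sum>\<^sub>\<infinity>w. (cmod (\<xi> w))\<^sup>2)"
  by (simp add: l2_norm_def infsum_nonneg)

lemma nsq_le_l2_norm: "\<xi> \<in> ell2 \<Longrightarrow> finite A \<Longrightarrow> nsq A \<xi> \<le> (l2_norm \<xi>)\<^sup>2"
  unfolding l2_norm_sq nsq_def by (rule finite_sum_le_infsum) (auto simp: ell2_summable)

lemma coordinate_le_l2_norm:
  assumes "\<xi> \<in> ell2"
  shows "cmod (\<xi> w) \<le> l2_norm \<xi>"
proof -
  have "(cmod (\<xi> w))\<^sup>2 \<le> (l2_norm \<xi>)\<^sup>2"
    using nsq_le_l2_norm[OF assms, of "{w}"] by (simp add: nsq_def)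
  then show ?thesis by (rule power2_le_imp_le) simp
qed

lemma l2_norm_scale: "l2_norm (\<lambda>w. c * \<xi> w) = cmod c * l2_norm \<xi>"
  by (simp add: l2_norm_def norm_mult power_mult_distrib infsum_cmult_right' real_sqrt_mult)

lemma l2_norm_zero: "l2_norm (\<lambda>w. 0) = 0"
  by (simp add: l2_norm_def)

lemma l2_bound:
  assumes "\<And>A. finite A \<Longrightarrow> nsq A \<eta> \<le> K\<^sup>2" "0 \<le> K"
  shows "\<eta> \<in> ell2" and "l2_norm \<eta> \<le> K"
proof -
  have s: "(\<lambda>w. (cmod (\<eta> w))\<^sup>2) summable_on UNIV"
    by (rule nonneg_bdd_above_summable_on) (use assms(1) in \<open>auto simp: nsq_def intro!: bdd_aboveI2\<close>)
  then show "\<eta> \<in> ell2" by (simp add: ell2_summable)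
  have "(\<Sum>\<^sub>\<infinity>w. (cmod (\<eta> w))\<^sup>2) \<le> K\<^sup>2"
    by (rule infsum_le_finite_sums[OF s]) (use assms(1) in \<open>simp add: nsq_def\<close>)
  then have "(l2_norm \<eta>)\<^sup>2 \<le> K\<^sup>2" by (simp add: l2_norm_sq)
  then show "l2_norm \<eta> \<le> K" using assms(2) by (rule power2_le_imp_le)
qed

lemma fock_scale: "\<xi> \<in> fock d I \<Longrightarrow> (\<lambda>w. c * \<xi> w) \<in> fock d I"
  by (auto simp: fock_iff ell2_summable norm_mult power_mult_distrib intro: summable_on_cmult_right)

lemma fock_add:
  assumes "\<xi> \<in> fock d I" "\<eta> \<in> fock d I"
  shows "(\<lambda>w. \<xi> w + \<eta> w) \<in> fock d I" and "l2_norm (\<lambda>w. \<xi> w + \<eta> w) \<le> l2_norm \<xi> + l2_norm \<eta>"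
proof -
  have e: "\<xi> \<in> ell2" "\<eta> \<in> ell2" using assms by (auto simp: fock_iff)
  have "nsq A (\<lambda>w. \<xi> w + \<eta> w) \<le> (l2_norm \<xi> + l2_norm \<eta>)\<^sup>2" if A: "finite A" for A
  proof -
    have "sqrt (nsq A (\<lambda>w. \<xi> w + \<eta> w)) \<le> sqrt (nsq A \<xi>) + sqrt (nsq A \<eta>)" by (rule nsq_triangle)
    also have "\<dots> \<le> l2_norm \<xi> + l2_norm \<eta>"
      using nsq_le_l2_norm[OF e(1) A] nsq_le_l2_norm[OF e(2) A] by (intro add_mono real_le_lsqrt) auto
    finally show ?thesis by (simp add: sqrt_le_D)
  qed
  note b = l2_bound[OF this]
  show "l2_norm (\<lambda>w. \<xi> w + \<eta> w) \<le> l2_norm \<xi> + l2_norm \<eta>" by (rule b(2)) auto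
  have "w \<in> allowable d I" if "\<xi> w + \<eta> w \<noteq> 0" for w
    using that assms by (cases "\<xi> w = 0") (auto simp: fock_iff)
  then show "(\<lambda>w. \<xi> w + \<eta> w) \<in> fock d I" using b(1) by (simp add: fock_iff)
qed

lemma op_norm_le:
  assumes "\<And>\<xi>. \<xi> \<in> H \<Longrightarrow> l2_norm (T \<xi>) \<le> C * l2_norm \<xi>" "0 \<le> C"
  shows "op_norm H T \<le> ennreal C"
  unfolding op_norm_def
proof (rule SUP_least)
  fix \<xi> assume \<xi>: "\<xi> \<in> {\<xi> \<in> H. l2_norm \<xi> \<le> 1}"
  then have "l2_norm (T \<xi>) \<le> C * l2_norm \<xi>" by (intro assms(1)) simp
  also have "\<dots> \<le> C * 1" using \<xi> by (intro mult_left_mono assms(2)) simp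
  finally show "ennreal (l2_norm (T \<xi>)) \<le> ennreal C" by (simp add: ennreal_leI)
qed

lemma op_norm_bound:
  assumes T: "\<And>c \<xi>. \<xi> \<in> fock d I \<Longrightarrow> T (\<lambda>w. c * \<xi> w) = (\<lambda>w. c * T \<xi> w)"
    and C: "op_norm (fock d I) T \<le> ennreal C" "0 \<le> C" and \<xi>: "\<xi> \<in> fock d I"
  shows "l2_norm (T \<xi>) \<le> C * l2_norm \<xi>"
proof (cases "l2_norm \<xi> = 0")
  case True
  have "\<xi> \<in> ell2" using \<xi> by (simp add: fock_iff)
  then have "\<xi> w = 0" for w using coordinate_le_l2_norm[of \<xi> w] True by simp
  then have "(\<lambda>w. 0 * \<xi> w) = \<xi>" by auto
  then have "T \<xi> = (\<lambda>w. 0 * T \<xi> w)" using T[OF \<xi>, of 0] by simp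
  then have "T \<xi> = (\<lambda>w. 0)" by simp
  then show ?thesis using True by (simp add: l2_norm_zero)
next
  case False
  then have pos: "l2_norm \<xi> > 0" using l2_norm_nonneg[of \<xi>] by linarith
  define c where "c = complex_of_real (1 / l2_norm \<xi>)"
  have "cmod c = 1 / l2_norm \<xi>" using pos by (simp add: c_def norm_divide)
  then have scaled: "l2_norm (\<lambda>w. c * \<eta> w) = l2_norm \<eta> / l2_norm \<xi>" for \<eta> by (simp only: l2_norm_scale) simp
  then have "l2_norm (\<lambda>w. c * \<xi> w) = 1" using pos by simp
  then have "ennreal (l2_norm (T (\<lambda>w. c * \<xi> w))) \<le> op_norm (fock d I) T"
    unfolding op_norm_def by (intro SUP_upper) (simp add: fock_scale[OF \<xi>])
  also note C(1)
  finally have "l2_norm (T (\<lambda>w. c * \<xi> w)) \<le> C" using C(2) by (simp add: ennreal_le_iff)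
  then have "l2_norm (T \<xi>) / l2_norm \<xi> \<le> C" by (simp only: T[OF \<xi>] scaled)
  then show ?thesis using pos by (simp add: pos_divide_le_eq)
qed

lemma bounded_ops_simps:
  "T \<in> carrier (bounded_ops H) \<longleftrightarrow> T \<in> H \<rightarrow>\<^sub>E H \<and> linear_map_on H T \<and> op_norm H T < \<infinity>"
  "S \<otimes>\<^bsub>bounded_ops H\<^esub> T = compose H S T"
  "\<one>\<^bsub>bounded_ops H\<^esub> = (\<lambda>\<xi>\<in>H. \<xi>)"
  "\<zero>\<^bsub>bounded_ops H\<^esub> = (\<lambda>\<xi>\<in>H. (\<lambda>w. 0))"
  "S \<oplus>\<^bsub>bounded_ops H\<^esub> T = (\<lambda>\<xi>\<in>H. (\<lambda>w. S \<xi> w + T \<xi> w))"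
  "c \<odot>\<^bsub>bounded_ops H\<^esub> T = (\<lambda>\<xi>\<in>H. (\<lambda>w. c * T \<xi> w))"
  by (simp_all add: bounded_ops_def)

locale tensor_lang = pointed_lang d "allowable d I" for d I
begin

abbreviation "L \<equiv> allowable d I"

text \<open>Every element of the tensor algebra is of this form, with \<open>a\<close> the image of the vacuum vector.\<close>

definition mult_op :: "(nat list \<Rightarrow> complex) \<Rightarrow> (nat list \<Rightarrow> complex) \<Rightarrow> nat list \<Rightarrow> complex" where
  "mult_op a = (\<lambda>\<xi>\<in>fock d I. (\<lambda>w. if w \<in> L then nc_mult a \<xi> w else 0))"

lemma unit_fock: "monom_word [] \<in> fock d I"
  using basis_vec_fock[OF nil] by (simp add: basis_vec_def monom_word_def)

lemma mult_op_unit: "a \<in> alg \<Longrightarrow> mult_op a (monom_word []) = a"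
  by (auto simp: mult_op_def unit_fock nc_mult_one(2) alg_zeroD)

lemma nsq_support:
  assumes "finite A" "\<And>w. \<eta> w \<noteq> 0 \<Longrightarrow> w \<in> L"
  shows "\<exists>M. nsq A \<eta> \<le> nsq (Lw M) \<eta>"
proof -
  obtain M where M: "\<forall>w\<in>A. length w \<le> M"
    using assms(1) by (metis finite_imageI finite_nat_set_iff_bounded_le imageI)
  have "nsq A \<eta> = nsq (A \<inter> Lw M) \<eta>"
    unfolding nsq_def by (rule sum.mono_neutral_right) (use assms M in \<open>auto simp: Lw_def\<close>)
  also have "\<dots> \<le> nsq (Lw M) \<eta>" by (rule nsq_mono) auto
  finally show ?thesis by blast
qed

lemma mult_op_bound:
  assumes a: "nb C a" and \<xi>: "\<xi> \<in> fock d I"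
  shows "mult_op a \<xi> \<in> fock d I" and "l2_norm (mult_op a \<xi>) \<le> C * l2_norm \<xi>"
proof -
  have supp: "w \<in> L" if "mult_op a \<xi> w \<noteq> 0" for w
    using that \<xi> by (auto simp: mult_op_def split: if_splits)
  have "nsq A (mult_op a \<xi>) \<le> (C * l2_norm \<xi>)\<^sup>2" if "finite A" for A
  proof -
    obtain M where "nsq A (mult_op a \<xi>) \<le> nsq (Lw M) (mult_op a \<xi>)"
      using nsq_support[OF \<open>finite A\<close> supp] by blast
    also have "\<dots> = nsq (Lw M) (nc_mult a \<xi>)"
      by (rule nsq_cong) (use \<xi> in \<open>auto simp: mult_op_def Lw_def\<close>)
    also have "\<dots> \<le> C\<^sup>2 * nsq (Lw M) \<xi>" by (rule nb_bound[OF a])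
    also have "\<dots> \<le> C\<^sup>2 * (l2_norm \<xi>)\<^sup>2"
      using \<xi> by (intro mult_left_mono nsq_le_l2_norm) (auto simp: fock_iff)
    finally show ?thesis by (simp add: power_mult_distrib)
  qed
  note b = l2_bound[OF this]
  have "0 \<le> C * l2_norm \<xi>" using nb_nonneg[OF a] by simp
  from b[OF _ this] show "mult_op a \<xi> \<in> fock d I" "l2_norm (mult_op a \<xi>) \<le> C * l2_norm \<xi>"
    using supp by (auto simp: fock_iff)
qed

text \<open>The truncated inequality is tested on vectors supported in \<open>Lw M\<close>, whose
  norm is controlled by a finite square sum.\<close>

lemma nb_of_mult_op:
  assumes C: "0 \<le> C" and bound: "\<And>\<xi>. \<xi> \<in> fock d I \<Longrightarrow> l2_norm (mult_op a \<xi>) \<le> C * l2_norm \<xi>"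
    and cl: "\<And>\<xi>. \<xi> \<in> fock d I \<Longrightarrow> mult_op a \<xi> \<in> fock d I"
  shows "nb C a"
proof -
  have "nsq (Lw M) (nc_mult a \<xi>) \<le> C\<^sup>2 * nsq (Lw M) \<xi>" for M \<xi>
  proof -
    define \<eta> where "\<eta> w = (if w \<in> Lw M then \<xi> w else 0)" for w
    have nsq\<eta>: "nsq A \<eta> \<le> (sqrt (nsq (Lw M) \<xi>))\<^sup>2" if "finite A" for A
    proof -
      have "nsq A \<eta> = nsq (A \<inter> Lw M) \<xi>"
        unfolding nsq_def by (rule sum.mono_neutral_cong_right) (use that in \<open>auto simp: \<eta>_def\<close>)
      also have "\<dots> \<le> nsq (Lw M) \<xi>" by (rule nsq_mono) auto
      finally show ?thesis by simp
    qed
    have \<eta>: "\<eta> \<in> fock d I" "l2_norm \<eta> \<le> sqrt (nsq (Lw M) \<xi>)"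
      using l2_bound[OF nsq\<eta>] by (auto simp: fock_iff \<eta>_def Lw_def)
    have "nsq (Lw M) (nc_mult a \<xi>) = nsq (Lw M) (mult_op a \<eta>)"
    proof (rule nsq_cong)
      fix w assume w: "w \<in> Lw M"
      then have "nc_mult a \<xi> w = nc_mult a \<eta> w"
        by (intro nc_mult_eqI) (auto simp: \<eta>_def Lw_def L_drop)
      then show "nc_mult a \<xi> w = mult_op a \<eta> w" using w \<eta>(1) by (simp add: mult_op_def Lw_def)
    qed
    also have "\<dots> \<le> (l2_norm (mult_op a \<eta>))\<^sup>2"
      using cl[OF \<eta>(1)] by (intro nsq_le_l2_norm) (auto simp: fock_iff)
    also have "\<dots> \<le> (C * sqrt (nsq (Lw M) \<xi>))\<^sup>2"
      by (intro power_mono order_trans[OF bound[OF \<eta>(1)]] mult_left_mono \<eta>(2) C) simp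
    finally show ?thesis by (simp add: power_mult_distrib)
  qed
  then show ?thesis using C by (simp add: nb_def)
qed

lemma mult_op_linear: "linear_map_on (fock d I) (mult_op a)"
  by (auto simp: linear_map_on_def mult_op_def fock_add(1) fock_scale nc_mult_add_right nc_mult_scale_right)

lemma mult_op_bounded:
  assumes "a \<in> alg"
  shows "mult_op a \<in> carrier (bounded_ops (fock d I))"
proof -
  obtain C where C: "nb C a" using nb_alg[OF assms] by blast
  have "op_norm (fock d I) (mult_op a) \<le> ennreal C"
    by (rule op_norm_le[OF mult_op_bound(2)[OF C] nb_nonneg[OF C]])
  then have "op_norm (fock d I) (mult_op a) < \<infinity>" using le_less_trans by fastforce
  moreover have "mult_op a \<in> fock d I \<rightarrow>\<^sub>E fock d I"
    using mult_op_bound(1)[OF C] by (auto simp: mult_op_def)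
  ultimately show ?thesis by (simp add: bounded_ops_simps mult_op_linear)
qed

lemma mult_op_add: "mult_op a \<oplus>\<^bsub>bounded_ops (fock d I)\<^esub> mult_op b = mult_op (\<lambda>w. a w + b w)"
  by (auto simp: bounded_ops_simps mult_op_def nc_mult_add_left fun_eq_iff)

lemma mult_op_scale: "c \<odot>\<^bsub>bounded_ops (fock d I)\<^esub> mult_op a = mult_op (\<lambda>w. c * a w)"
  by (auto simp: bounded_ops_simps mult_op_def nc_mult_scale_left fun_eq_iff)

lemma mult_op_one: "mult_op (monom_word []) = \<one>\<^bsub>bounded_ops (fock d I)\<^esub>"
  by (auto simp: bounded_ops_simps mult_op_def nc_mult_one(1) fun_eq_iff fock_iff)

lemma mult_op_mult:
  assumes "b \<in> alg"
  shows "mult_op a \<otimes>\<^bsub>bounded_ops (fock d I)\<^esub> mult_op b = mult_op (cv a b)"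
proof
  fix \<xi>
  show "(mult_op a \<otimes>\<^bsub>bounded_ops (fock d I)\<^esub> mult_op b) \<xi> = mult_op (cv a b) \<xi>"
  proof (cases "\<xi> \<in> fock d I")
    case True
    obtain C where "nb C b" using nb_alg[OF assms] by blast
    from mult_op_bound(1)[OF this True] have b\<xi>: "mult_op b \<xi> \<in> fock d I" .
    have "nc_mult a (mult_op b \<xi>) w = nc_mult (cv a b) \<xi> w" if "w \<in> L" for w
    proof -
      have "nc_mult a (mult_op b \<xi>) w = nc_mult a (nc_mult b \<xi>) w"
        using that True by (intro nc_mult_eqI) (auto simp: mult_op_def L_drop)
      then show ?thesis using nc_mult_cv[OF that] by simp
    qed
    then show ?thesis using True b\<xi> by (auto simp: bounded_ops_simps compose_def mult_op_def[of a] mult_op_def[of "cv a b"])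
  next
    case False
    then show ?thesis by (simp add: bounded_ops_simps compose_def mult_op_def)
  qed
qed

lemma shift_mult_op:
  assumes "i < d"
  shows "shift d I i = mult_op (monom_word [i])"
proof
  fix \<xi>
  have "(case w of [] \<Rightarrow> 0 | j # \<nu> \<Rightarrow> if j = i \<and> i # \<nu> \<in> L then \<xi> \<nu> else 0) =
      (if w \<in> L then nc_mult (monom_word [i]) \<xi> w else 0)" for w
  proof (cases w)
    case Nil
    then show ?thesis by (simp add: nc_mult_monom_not_prefix)
  next
    case (Cons j \<nu>)
    then show ?thesis
      using nc_mult_monom_append[of "[j]" \<xi> \<nu>] nc_mult_monom_not_prefix[of "j # \<nu>" "[i]" \<xi>] by auto
  qed
  then show "shift d I i \<xi> = mult_op (monom_word [i]) \<xi>"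
    by (auto simp: shift_def mult_op_def fun_eq_iff)
qed

text \<open>A norm limit \<open>S\<close> of multipliers is multiplication by its value
  \<open>c\<close> at the vacuum, because one coordinate of a product involves only finitely many
  coefficients of either factor.\<close>

lemma mult_op_closed: "closed_subalgebra (fock d I) (mult_op ` alg)"
  unfolding closed_subalgebra_def
proof (intro conjI ballI allI impI)
  show "mult_op ` alg \<subseteq> carrier (bounded_ops (fock d I))" using mult_op_bounded by blast
  show "\<one>\<^bsub>bounded_ops (fock d I)\<^esub> \<in> mult_op ` alg"
    using unit_alg by (subst mult_op_one[symmetric]) blast
  show "S \<oplus>\<^bsub>bounded_ops (fock d I)\<^esub> T \<in> mult_op ` alg" "S \<otimes>\<^bsub>bounded_ops (fock d I)\<^esub> T \<in> mult_op ` alg"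
    if "S \<in> mult_op ` alg" "T \<in> mult_op ` alg" for S T
    using that by (auto simp: mult_op_add mult_op_mult intro!: imageI alg_add alg_cv)
  show "c \<odot>\<^bsub>bounded_ops (fock d I)\<^esub> T \<in> mult_op ` alg" if "T \<in> mult_op ` alg" for c T
    using that by (auto simp: mult_op_scale intro!: imageI alg_scale)
next
  fix S assume S: "S \<in> carrier (bounded_ops (fock d I))"
    and approx: "\<forall>\<epsilon>>0. \<exists>T\<in>mult_op ` alg. op_norm (fock d I) (\<lambda>\<xi> w. S \<xi> w - T \<xi> w) < ennreal \<epsilon>"
  have SH: "S \<xi> \<in> fock d I" if "\<xi> \<in> fock d I" for \<xi> using S that by (auto simp: bounded_ops_simps)
  have Slin: "linear_map_on (fock d I) S" using S by (simp add: bounded_ops_simps)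
  define c where "c = S (monom_word [])"
  have c: "w \<in> L" if "c w \<noteq> 0" for w using SH[OF unit_fock] that by (auto simp: c_def fock_iff)
  have near: "\<exists>a\<in>alg. \<forall>\<xi>\<in>fock d I. (\<lambda>w. S \<xi> w - mult_op a \<xi> w) \<in> fock d I \<and>
      l2_norm (\<lambda>w. S \<xi> w - mult_op a \<xi> w) \<le> \<epsilon> * l2_norm \<xi>" if e: "\<epsilon> > 0" for \<epsilon>
  proof -
    obtain a where a: "a \<in> alg" "op_norm (fock d I) (\<lambda>\<xi> w. S \<xi> w - mult_op a \<xi> w) < ennreal \<epsilon>"
      using approx e by blast
    have "l2_norm (\<lambda>w. S \<xi> w - mult_op a \<xi> w) \<le> \<epsilon> * l2_norm \<xi>" if "\<xi> \<in> fock d I" for \<xi>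
    proof (rule op_norm_bound[where T = "\<lambda>\<xi> w. S \<xi> w - mult_op a \<xi> w", OF _ _ _ that])
      show "(\<lambda>w. S (\<lambda>w. c * \<xi> w) w - mult_op a (\<lambda>w. c * \<xi> w) w) = (\<lambda>w. c * (S \<xi> w - mult_op a \<xi> w))"
        if "\<xi> \<in> fock d I" for c \<xi>
        using Slin mult_op_linear[of a] that by (simp add: linear_map_on_def right_diff_distrib)
    qed (use a e in auto)
    moreover have "(\<lambda>w. S \<xi> w - mult_op a \<xi> w) \<in> fock d I" if "\<xi> \<in> fock d I" for \<xi>
    proof -
      have "mult_op a \<xi> \<in> fock d I" using mult_op_bounded[OF a(1)] that by (auto simp: bounded_ops_simps)
      from fock_add(1)[OF SH[OF that] fock_scale[OF this, of "-1"]] show ?thesis by simp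
    qed
    ultimately show ?thesis using a(1) by blast
  qed
  have unit_norm: "l2_norm (monom_word []) = 1"
  proof -
    have "(\<Sum>\<^sub>\<infinity>w. (cmod (monom_word [] w))\<^sup>2) = (\<Sum>\<^sub>\<infinity>w\<in>{[]}. (cmod (monom_word [] w))\<^sup>2)"
      by (rule infsum_cong_neutral) (auto simp: monom_word_def)
    then show ?thesis by (simp add: l2_norm_def monom_word_def)
  qed
  have S_eq: "S \<xi> w = nc_mult c \<xi> w" if \<xi>: "\<xi> \<in> fock d I" and w: "w \<in> L" for \<xi> w
  proof -
    \<comment> \<open>Total weight of the error in one coordinate: the operator error acts on
      \<open>\<xi>\<close>, and each coefficient error multiplies one of finitely many coordinates
      of \<open>\<xi>\<close>.\<close>
    define B where "B = l2_norm \<xi> + (\<Sum>k\<le>length w. cmod (\<xi> (drop k w)))"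
    have B: "B \<ge> 0" by (simp add: B_def sum_nonneg)
    have "cmod (S \<xi> w - nc_mult c \<xi> w) \<le> 0 + e" if e: "e > 0" for e
    proof -
      define \<epsilon> where "\<epsilon> = e / (B + 1)"
      have \<epsilon>: "\<epsilon> > 0" "\<epsilon> * B \<le> e" using e B by (auto simp: \<epsilon>_def field_simps)
      obtain a where a: "a \<in> alg" "\<And>\<xi>. \<xi> \<in> fock d I \<Longrightarrow> (\<lambda>w. S \<xi> w - mult_op a \<xi> w) \<in> fock d I"
        "\<And>\<xi>. \<xi> \<in> fock d I \<Longrightarrow> l2_norm (\<lambda>w. S \<xi> w - mult_op a \<xi> w) \<le> \<epsilon> * l2_norm \<xi>"
        using near[OF \<epsilon>(1)] by blast
      have pt: "cmod (S \<eta> v - mult_op a \<eta> v) \<le> \<epsilon> * l2_norm \<eta>" if "\<eta> \<in> fock d I" for \<eta> v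
        using coordinate_le_l2_norm[of "\<lambda>w. S \<eta> w - mult_op a \<eta> w" v] a(2,3)[OF that] by (auto simp: fock_iff)
      have ca: "cmod (c v - a v) \<le> \<epsilon>" for v
        using pt[OF unit_fock, of v] by (simp add: mult_op_unit[OF a(1)] c_def unit_norm)
      have "S \<xi> w - nc_mult c \<xi> w = (S \<xi> w - mult_op a \<xi> w) - (\<Sum>k\<le>length w. (c (take k w) - a (take k w)) * \<xi> (drop k w))"
        using \<xi> w by (simp add: mult_op_def nc_mult_def left_diff_distrib sum_subtractf)
      also have "cmod \<dots> \<le> \<epsilon> * l2_norm \<xi> + (\<Sum>k\<le>length w. \<epsilon> * cmod (\<xi> (drop k w)))"
        by (intro order_trans[OF norm_triangle_ineq4] add_mono pt[OF \<xi>] order_trans[OF norm_sum] sum_mono)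
          (auto simp: norm_mult intro!: mult_right_mono ca)
      also have "\<dots> = \<epsilon> * B" by (simp add: B_def distrib_left sum_distrib_left)
      finally show ?thesis using \<epsilon>(2) by simp
    qed
    then have "cmod (S \<xi> w - nc_mult c \<xi> w) \<le> 0" by (rule field_le_epsilon)
    then show ?thesis by simp
  qed
  have "S = mult_op c"
  proof
    fix \<xi>
    show "S \<xi> = mult_op c \<xi>"
    proof (cases "\<xi> \<in> fock d I")
      case True
      have "S \<xi> w = (if w \<in> L then nc_mult c \<xi> w else 0)" for w
        using S_eq[OF True, of w] SH[OF True] by (auto simp: fock_iff)
      then show ?thesis using True by (auto simp: mult_op_def)
    next
      case False
      then show ?thesis using S by (auto simp: bounded_ops_simps mult_op_def PiE_def extensional_def)
    qed
  qed
  moreover have "c \<in> alg"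
  proof -
    have "\<exists>p\<in>polys. nb \<epsilon> (\<lambda>w. c w - p w)" if e: "\<epsilon> > 0" for \<epsilon>
    proof -
      obtain a where a: "a \<in> alg" "\<And>\<xi>. \<xi> \<in> fock d I \<Longrightarrow> (\<lambda>w. S \<xi> w - mult_op a \<xi> w) \<in> fock d I"
        "\<And>\<xi>. \<xi> \<in> fock d I \<Longrightarrow> l2_norm (\<lambda>w. S \<xi> w - mult_op a \<xi> w) \<le> \<epsilon> / 2 * l2_norm \<xi>"
        using near[of "\<epsilon> / 2"] e by auto
      have eq: "mult_op (\<lambda>w. c w - a w) \<xi> = (\<lambda>w. S \<xi> w - mult_op a \<xi> w)" if "\<xi> \<in> fock d I" for \<xi>
        unfolding \<open>S = mult_op c\<close> using that by (auto simp: mult_op_def nc_mult_diff_left)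
      have "nb (\<epsilon> / 2) (\<lambda>w. c w - a w)"
        by (rule nb_of_mult_op) (use e a eq in auto)
      moreover obtain p where p: "p \<in> polys" "nb (\<epsilon> / 2) (\<lambda>w. a w - p w)"
        using alg_approx[OF a(1), of "\<epsilon> / 2"] e by auto
      ultimately have "nb (\<epsilon> / 2 + \<epsilon> / 2) (\<lambda>w. (c w - a w) + (a w - p w))" by (intro nb_add)
      then show ?thesis using p(1) by auto
    qed
    then show ?thesis using c by (simp add: alg_def)
  qed
  ultimately show "S \<in> mult_op ` alg" by blast
qed

text \<open>Words arise as products of shifts, polynomials as linear combinations of words, and the
  remaining multipliers as norm limits of polynomials.\<close>

lemma mult_op_minimal:
  assumes A: "closed_subalgebra (fock d I) A" "\<And>i. i < d \<Longrightarrow> shift d I i \<in> A" and a: "a \<in> alg"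
  shows "mult_op a \<in> A"
proof -
  have one: "mult_op (monom_word []) \<in> A" using A(1) by (simp add: closed_subalgebra_def mult_op_one)
  have add: "mult_op (\<lambda>w. a w + b w) \<in> A" if "mult_op a \<in> A" "mult_op b \<in> A" for a b
    using A(1) that by (simp add: closed_subalgebra_def mult_op_add[symmetric])
  have scale: "mult_op (\<lambda>w. c * a w) \<in> A" if "mult_op a \<in> A" for c a
    using A(1) that by (simp add: closed_subalgebra_def mult_op_scale[symmetric])
  have mult: "mult_op (cv a b) \<in> A" if "mult_op a \<in> A" "mult_op b \<in> A" "b \<in> alg" for a b
    using A(1) that by (simp add: closed_subalgebra_def mult_op_mult[symmetric])
  have word: "mult_op (monom_word \<mu>) \<in> A" if "\<mu> \<in> L" for \<mu>
    using that
  proof (induction \<mu>)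
    case (Cons i \<mu>)
    then have i: "i < d" and \<mu>: "\<mu> \<in> L" using L_words L_append2[of "[i]" \<mu>] by auto
    have "mult_op (cv (monom_word [i]) (monom_word \<mu>)) \<in> A"
      using A(2)[OF i] by (intro mult Cons.IH \<mu> polys_alg polys_monom) (simp add: shift_mult_op[OF i])
    then show ?case using Cons.prems by (simp add: cv_monom)
  qed (rule one)
  have zero: "mult_op (\<lambda>w. 0) \<in> A" using scale[OF one, of 0] by simp
  have poly: "mult_op p \<in> A" if p: "p \<in> polys" for p
  proof -
    have "finite S \<Longrightarrow> S \<subseteq> L \<Longrightarrow> mult_op (\<lambda>w. \<Sum>\<mu>\<in>S. p \<mu> * monom_word \<mu> w) \<in> A" for S
      by (induction rule: finite_induct) (auto simp: zero intro!: add scale word)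
    from this[of "{\<mu>. p \<mu> \<noteq> 0}"] p show ?thesis by (subst polys_expand[OF p]) (auto simp: polys_def)
  qed
  have "\<exists>T\<in>A. op_norm (fock d I) (\<lambda>\<xi> w. mult_op a \<xi> w - T \<xi> w) < ennreal \<epsilon>" if e: "\<epsilon> > 0" for \<epsilon>
  proof -
    obtain p where p: "p \<in> polys" "nb (\<epsilon> / 2) (\<lambda>w. a w - p w)" using alg_approx[OF a, of "\<epsilon> / 2"] e by auto
    have eq: "mult_op (\<lambda>w. a w - p w) \<xi> = (\<lambda>w. mult_op a \<xi> w - mult_op p \<xi> w)" if "\<xi> \<in> fock d I" for \<xi>
      using that by (auto simp: mult_op_def nc_mult_diff_left)
    have "op_norm (fock d I) (\<lambda>\<xi> w. mult_op a \<xi> w - mult_op p \<xi> w) \<le> ennreal (\<epsilon> / 2)"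
      using mult_op_bound(2)[OF p(2)] e by (intro op_norm_le) (auto simp: eq)
    also have "\<dots> < ennreal \<epsilon>" using e by (simp add: ennreal_lessI)
    finally show ?thesis using poly[OF p(1)] by blast
  qed
  then show ?thesis using A(1) mult_op_bounded[OF a] unfolding closed_subalgebra_def by blast
qed

lemma tensor_algebra_carrier: "carrier (tensor_algebra d I) = mult_op ` alg"
proof
  have "\<forall>i<d. shift d I i \<in> mult_op ` alg"
    using shift_mult_op polys_alg[OF polys_monom[OF letters]] by auto
  then show "carrier (tensor_algebra d I) \<subseteq> mult_op ` alg"
    using mult_op_closed by (auto simp: tensor_algebra_def)
  show "mult_op ` alg \<subseteq> carrier (tensor_algebra d I)"
    using mult_op_minimal by (auto simp: tensor_algebra_def)
qed

end

lemma tensor_algebra_simps: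
  "S \<otimes>\<^bsub>tensor_algebra d I\<^esub> T = S \<otimes>\<^bsub>bounded_ops (fock d I)\<^esub> T"
  "\<one>\<^bsub>tensor_algebra d I\<^esub> = \<one>\<^bsub>bounded_ops (fock d I)\<^esub>"
  "\<zero>\<^bsub>tensor_algebra d I\<^esub> = \<zero>\<^bsub>bounded_ops (fock d I)\<^esub>"
  "S \<oplus>\<^bsub>tensor_algebra d I\<^esub> T = S \<oplus>\<^bsub>bounded_ops (fock d I)\<^esub> T"
  "c \<odot>\<^bsub>tensor_algebra d I\<^esub> T = c \<odot>\<^bsub>bounded_ops (fock d I)\<^esub> T"
  by (simp_all add: tensor_algebra_def)

lemma alg_equivI:
  assumes "pointed_lang d L" "pointed_lang d' L'"
    and bij: "bij_betw f (word_lang.alg L) (word_lang.alg L')"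
    and one: "f (monom_word []) = monom_word []"
    and add: "\<And>a b. a \<in> word_lang.alg L \<Longrightarrow> b \<in> word_lang.alg L \<Longrightarrow> f (\<lambda>w. a w + b w) = (\<lambda>w. f a w + f b w)"
    and scale: "\<And>c a. a \<in> word_lang.alg L \<Longrightarrow> f (\<lambda>w. c * a w) = (\<lambda>w. c * f a w)"
    and mult: "\<And>a b. a \<in> word_lang.alg L \<Longrightarrow> b \<in> word_lang.alg L \<Longrightarrow> f (word_lang.cv L a b) = word_lang.cv L' (f a) (f b)"
  shows "alg_equiv d L d' L' f (inv_into (word_lang.alg L) f)"
proof -
  interpret X: pointed_lang d L by fact
  interpret Y: pointed_lang d' L' by fact
  let ?g = "inv_into X.alg f"
  have f: "f a \<in> Y.alg" if "a \<in> X.alg" for a using bij that by (auto simp: bij_betw_def)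
  have g: "?g u \<in> X.alg" "f (?g u) = u" if "u \<in> Y.alg" for u
    using bij that by (auto simp: bij_betw_def inv_into_into f_inv_into_f)
  have gf: "?g (f a) = a" if "a \<in> X.alg" for a using bij that by (auto simp: bij_betw_def)
  show ?thesis
  proof unfold_locales
    show "?g (monom_word []) = monom_word []" using gf[OF X.unit_alg] one by simp
    show "?g (\<lambda>w. u w + v w) = (\<lambda>w. ?g u w + ?g v w)" if "u \<in> Y.alg" "v \<in> Y.alg" for u v
      using gf[OF X.alg_add[OF g(1)[OF that(1)] g(1)[OF that(2)]]] add[OF g(1)[OF that(1)] g(1)[OF that(2)]] g(2) that by simp
    show "?g (\<lambda>w. c * u w) = (\<lambda>w. c * ?g u w)" if "u \<in> Y.alg" for c u
      using gf[OF X.alg_scale[OF g(1)[OF that], of c]] scale[OF g(1)[OF that], of c] g(2) that by simp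
    show "?g (Y.cv u v) = X.cv (?g u) (?g v)" if "u \<in> Y.alg" "v \<in> Y.alg" for u v
      using gf[OF X.alg_cv[OF g(1)[OF that(1)] g(1)[OF that(2)]]] mult[OF g(1)[OF that(1)] g(1)[OF that(2)]] g(2) that by simp
  qed (use f g gf one add scale mult in auto)
qed

text \<open>An operator in the tensor algebra is determined by its value at the vacuum, so an
  isomorphism of operator algebras can be transferred to coefficient functions.\<close>

theorem alg_iso_alg_equiv:
  assumes "tensor_lang d I" "tensor_lang d' J"
    and \<phi>: "\<phi> \<in> alg_iso (tensor_algebra d I) (tensor_algebra d' J)"
  shows "\<exists>f g. alg_equiv d (allowable d I) d' (allowable d' J) f g"
proof -
  interpret X: tensor_lang d I by fact
  interpret Y: tensor_lang d' J by fact
  define f where "f a = \<phi> (X.mult_op a) (monom_word [])" for a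
  have hom: "\<phi> \<in> Ring.ring_hom (tensor_algebra d I) (tensor_algebra d' J)"
    and bij: "bij_betw \<phi> (X.mult_op ` X.alg) (Y.mult_op ` Y.alg)"
    and sc: "\<And>c a. a \<in> X.mult_op ` X.alg \<Longrightarrow> \<phi> (c \<odot>\<^bsub>bounded_ops (fock d I)\<^esub> a) = c \<odot>\<^bsub>bounded_ops (fock d' J)\<^esub> \<phi> a"
    using \<phi> by (auto simp: alg_iso_def ring_iso_def X.tensor_algebra_carrier Y.tensor_algebra_carrier tensor_algebra_simps)
  have fop: "f a \<in> Y.alg \<and> \<phi> (X.mult_op a) = Y.mult_op (f a)" if a: "a \<in> X.alg" for a
  proof -
    have "\<phi> (X.mult_op a) \<in> Y.mult_op ` Y.alg" using bij a by (auto simp: bij_betw_def)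
    then obtain u where u: "u \<in> Y.alg" "\<phi> (X.mult_op a) = Y.mult_op u" by blast
    then show ?thesis by (simp add: f_def Y.mult_op_unit)
  qed
  have hmult: "\<phi> (X.mult_op (X.cv a b)) = Y.mult_op (Y.cv (f a) (f b))" if "a \<in> X.alg" "b \<in> X.alg" for a b
    using ring_hom_mult[OF hom, of "X.mult_op a" "X.mult_op b"] that fop
    by (simp add: X.tensor_algebra_carrier tensor_algebra_simps X.mult_op_mult Y.mult_op_mult)
  have hadd: "\<phi> (X.mult_op (\<lambda>w. a w + b w)) = Y.mult_op (\<lambda>w. f a w + f b w)" if "a \<in> X.alg" "b \<in> X.alg" for a b
    using ring_hom_add[OF hom, of "X.mult_op a" "X.mult_op b"] that fop
    by (simp add: X.tensor_algebra_carrier tensor_algebra_simps X.mult_op_add Y.mult_op_add)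
  have hscale: "\<phi> (X.mult_op (\<lambda>w. c * a w)) = Y.mult_op (\<lambda>w. c * f a w)" if "a \<in> X.alg" for c a
    using sc[of "X.mult_op a" c] that fop by (simp add: X.mult_op_scale Y.mult_op_scale)
  have hone: "\<phi> (X.mult_op (monom_word [])) = Y.mult_op (monom_word [])"
    using ring_hom_one[OF hom] by (simp add: tensor_algebra_simps X.mult_op_one Y.mult_op_one)
  have "bij_betw f X.alg Y.alg"
  proof (rule bij_betw_imageI)
    show "inj_on f X.alg"
    proof (rule inj_onI)
      fix a b assume ab: "a \<in> X.alg" "b \<in> X.alg" "f a = f b"
      then have "\<phi> (X.mult_op a) = \<phi> (X.mult_op b)" using fop by simp
      then have "X.mult_op a = X.mult_op b" using bij ab by (auto simp: bij_betw_def dest: inj_onD)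
      then show "a = b" using X.mult_op_unit ab by metis
    qed
    show "f ` X.alg = Y.alg"
    proof
      show "f ` X.alg \<subseteq> Y.alg" using fop by blast
      show "Y.alg \<subseteq> f ` X.alg"
      proof
        fix u assume u: "u \<in> Y.alg"
        then have "Y.mult_op u \<in> \<phi> ` X.mult_op ` X.alg" using bij by (auto simp: bij_betw_def)
        then obtain a where "a \<in> X.alg" "\<phi> (X.mult_op a) = Y.mult_op u" by force
        then have "f a = u" using Y.mult_op_unit[OF u] by (simp add: f_def)
        with \<open>a \<in> X.alg\<close> show "u \<in> f ` X.alg" by blast
      qed
    qed
  qed
  then have "alg_equiv d (allowable d I) d' (allowable d' J) f (inv_into X.alg f)"
  proof (rule alg_equivI[rotated 2])
    show "f (monom_word []) = monom_word []"
      unfolding f_def hone by (rule Y.mult_op_unit[OF Y.unit_alg])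
    show "f (\<lambda>w. a w + b w) = (\<lambda>w. f a w + f b w)" if "a \<in> X.alg" "b \<in> X.alg" for a b
      unfolding f_def[of "\<lambda>w. a w + b w"] hadd[OF that] using fop that by (intro Y.mult_op_unit Y.alg_add) auto
    show "f (\<lambda>w. c * a w) = (\<lambda>w. c * f a w)" if "a \<in> X.alg" for c a
      unfolding f_def[of "\<lambda>w. c * a w"] hscale[OF that] using fop that by (intro Y.mult_op_unit Y.alg_scale) auto
    show "f (X.cv a b) = Y.cv (f a) (f b)" if "a \<in> X.alg" "b \<in> X.alg" for a b
      unfolding f_def[of "X.cv a b"] hmult[OF that] using fop that by (intro Y.mult_op_unit Y.alg_cv) auto
  qed unfold_locales
  then show ?thesis by blast
qed

section \<open>Graded isomorphisms\<close>

lemma sps_add: "\<xi> \<in> sps d I n \<Longrightarrow> \<eta> \<in> sps d I n \<Longrightarrow> (\<lambda>w. \<xi> w + \<eta> w) \<in> sps d I n"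
  unfolding sps_iff by (metis add_0)

lemma sps_scale: "\<xi> \<in> sps d I n \<Longrightarrow> (\<lambda>w. c * \<xi> w) \<in> sps d I n"
  by (auto simp: sps_iff)

lemma sps_outside: "\<xi> \<in> sps d I n \<Longrightarrow> w \<notin> allowable d I \<Longrightarrow> \<xi> w = 0"
  unfolding sps_iff by blast

lemma sps_length: "\<xi> \<in> sps d I n \<Longrightarrow> \<xi> w \<noteq> 0 \<Longrightarrow> length w = n"
  unfolding sps_iff by blast

lemma sps_zero: "(\<lambda>w. 0) \<in> sps d I n"
  by (simp add: sps_iff)

lemma sps_sum: "finite S \<Longrightarrow> (\<And>s. s \<in> S \<Longrightarrow> h s \<in> sps d I n) \<Longrightarrow> (\<lambda>w. \<Sum>s\<in>S. h s w) \<in> sps d I n"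
  by (induction rule: finite_induct) (simp_all add: sps_zero sps_add)

text \<open>A similarity without the two norm bounds, the common consequence of the conditions on
  quotients and on subproduct systems.\<close>

definition graded_iso :: "nat \<Rightarrow> (nat list \<Rightarrow> complex) set \<Rightarrow> nat \<Rightarrow> (nat list \<Rightarrow> complex) set
    \<Rightarrow> (nat \<Rightarrow> (nat list \<Rightarrow> complex) \<Rightarrow> nat list \<Rightarrow> complex) \<Rightarrow> bool" where
  "graded_iso d I d' J V \<longleftrightarrow>
    (\<forall>n. linear_map_on (sps d I n) (V n) \<and> bij_betw (V n) (sps d I n) (sps d' J n)) \<and>
    (\<forall>m n. \<forall>\<xi>\<in>sps d I m. \<forall>\<eta>\<in>sps d I n.
       V (m + n) (sps_proj d I (m + n) (tensor m \<xi> \<eta>)) =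
       sps_proj d' J (m + n) (tensor m (V m \<xi>) (V n \<eta>)))"

lemma sps_proj_sps: "sps_proj d I n \<xi> \<in> sps d I n"
  by (auto simp: sps_proj_eq sps_iff)

lemma graded_iso_inverse:
  assumes V: "graded_iso d I d' J V"
  shows "graded_iso d' J d I (\<lambda>n. inv_into (sps d I n) (V n))"
proof -
  let ?W = "\<lambda>n. inv_into (sps d I n) (V n)"
  have lin: "linear_map_on (sps d I n) (V n)" and bij: "bij_betw (V n) (sps d I n) (sps d' J n)" for n
    using V by (auto simp: graded_iso_def)
  have W: "?W n u \<in> sps d I n" "V n (?W n u) = u" if "u \<in> sps d' J n" for n u
    using bij[of n] that by (auto simp: bij_betw_def inv_into_into f_inv_into_f)
  have WV: "?W n \<xi> = \<eta>" if "\<eta> \<in> sps d I n" "V n \<eta> = \<xi>" for n \<xi> \<eta>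
    using bij[of n] that by (auto simp: bij_betw_def)
  show ?thesis
    unfolding graded_iso_def
  proof (intro conjI allI ballI)
    show "bij_betw (?W n) (sps d' J n) (sps d I n)" for n using bij by (rule bij_betw_inv_into)
    show "linear_map_on (sps d' J n) (?W n)" for n
      unfolding linear_map_on_def
    proof (intro conjI ballI allI)
      show "?W n (\<lambda>w. u w + v w) = (\<lambda>w. ?W n u w + ?W n v w)" if "u \<in> sps d' J n" "v \<in> sps d' J n" for u v
        using lin[of n] W[OF that(1)] W[OF that(2)] by (intro WV sps_add) (auto simp: linear_map_on_def)
      show "?W n (\<lambda>w. c * u w) = (\<lambda>w. c * ?W n u w)" if "u \<in> sps d' J n" for c u
        using lin[of n] W[OF that] by (intro WV sps_scale) (auto simp: linear_map_on_def)
    qed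
    show "?W (m + n) (sps_proj d' J (m + n) (tensor m u v)) = sps_proj d I (m + n) (tensor m (?W m u) (?W n v))"
      if "u \<in> sps d' J m" "v \<in> sps d' J n" for m n u v
      using V W[OF that(1)] W[OF that(2)] by (intro WV sps_proj_sps) (auto simp: graded_iso_def)
  qed
qed

text \<open>Multiplicativity makes the coefficient of the image of a word at an allowable word a
  product of entries of the degree-one matrix. A word outside the language is represented by the
  zero vector, so these products vanish.\<close>

lemma graded_iso_dominates:
  assumes I: "monomial_ideal d I" and J: "monomial_ideal d' J"
    and letters: "\<forall>i<d. monom_word [i] \<notin> I" "\<forall>j<d'. monom_word [j] \<notin> J"
    and V: "graded_iso d I d' J V"
  shows "word_dominates d (allowable d I) d' (allowable d' J)"
proof -
  let ?L = "allowable d I" and ?L' = "allowable d' J"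
  have lin: "linear_map_on (sps d I n) (V n)" and bij: "bij_betw (V n) (sps d I n) (sps d' J n)" for n
    using V by (auto simp: graded_iso_def)
  have V_add: "V n (\<lambda>w. \<xi> w + \<eta> w) = (\<lambda>w. V n \<xi> w + V n \<eta> w)" if "\<xi> \<in> sps d I n" "\<eta> \<in> sps d I n" for n \<xi> \<eta>
    using lin[of n] that by (auto simp: linear_map_on_def)
  have V_scale: "V n (\<lambda>w. c * \<xi> w) = (\<lambda>w. c * V n \<xi> w)" if "\<xi> \<in> sps d I n" for n \<xi> c
    using lin[of n] that by (auto simp: linear_map_on_def)
  have V_mult: "V (m + n) (sps_proj d I (m + n) (tensor m \<xi> \<eta>)) = sps_proj d' J (m + n) (tensor m (V m \<xi>) (V n \<eta>))"
    if "\<xi> \<in> sps d I m" "\<eta> \<in> sps d I n" for m n \<xi> \<eta>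
    using V that by (auto simp: graded_iso_def)
  have zero: "(\<lambda>w. 0) \<in> sps d I n" for n by (simp add: sps_iff)
  have V_zero: "V n (\<lambda>w. 0) = (\<lambda>w. 0)" for n using V_scale[OF zero, of n 0] by simp
  have V_sum: "V n (\<lambda>w. \<Sum>s\<in>S. h s w) = (\<lambda>w. \<Sum>s\<in>S. V n (h s) w)"
    if "finite S" "\<And>s. s \<in> S \<Longrightarrow> h s \<in> sps d I n" for n S h
    using that
  proof (induction rule: finite_induct)
    case (insert x F)
    then show ?case using V_add[of "h x" n "\<lambda>w. \<Sum>s\<in>F. h s w"] by (simp add: sps_sum)
  qed (simp add: V_zero)
  define E where "E \<mu> = (\<lambda>w. if \<mu> \<in> ?L then monom_word \<mu> w else 0)" for \<mu>
  have E: "E \<mu> \<in> sps d I (length \<mu>)" for \<mu> by (auto simp: E_def sps_iff monom_word_def)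
  have let_L: "[i] \<in> ?L" if "i < d" for i using letters(1) that by (auto simp: allowable_def)
  have let_L': "[j] \<in> ?L'" if "j < d'" for j using letters(2) that by (auto simp: allowable_def)
  have E_Cons: "sps_proj d I (1 + length \<mu>) (tensor 1 (E [i]) (E \<mu>)) = E (i # \<mu>)" if "i < d" for i \<mu>
  proof
    fix w
    have "\<mu> \<in> ?L" if "i # \<mu> \<in> ?L" using allowable_factor[OF I, of "[i]" \<mu> "[]"] that by simp
    then show "sps_proj d I (1 + length \<mu>) (tensor 1 (E [i]) (E \<mu>)) w = E (i # \<mu>) w"
      using let_L[OF that] by (cases w) (auto simp: sps_proj_eq tensor_def E_def monom_word_def)
  qed
  define A where "A j i = V 1 (E [i]) [j]" for j i
  have prod: "V (length \<mu>) (E \<mu>) \<kappa> = (\<Prod>k<length \<mu>. A (\<kappa> ! k) (\<mu> ! k))"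
    if "\<mu> \<noteq> []" "\<mu> \<in> words d" "\<kappa> \<in> ?L'" "length \<kappa> = length \<mu>" for \<mu> \<kappa>
    using that
  proof (induction \<mu> arbitrary: \<kappa> rule: list_nonempty_induct)
    case (single i)
    then obtain j where "\<kappa> = [j]" by (cases \<kappa>) auto
    then show ?case by (simp add: A_def)
  next
    case (cons i \<mu>)
    then obtain j \<kappa>' where \<kappa>: "\<kappa> = j # \<kappa>'" "length \<kappa>' = length \<mu>" by (cases \<kappa>) auto
    have i: "i < d" using cons.prems by simp
    have "\<kappa>' \<in> ?L'" using allowable_factor[OF J, of "[j]" \<kappa>' "[]"] cons.prems \<kappa> by simp
    have "E [i] \<in> sps d I 1" using E[of "[i]"] by simp
    from V_mult[OF this E[of \<mu>]]
    have "V (1 + length \<mu>) (E (i # \<mu>)) = sps_proj d' J (1 + length \<mu>) (tensor 1 (V 1 (E [i])) (V (length \<mu>) (E \<mu>)))"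
      unfolding E_Cons[OF i] .
    then have "V (length (i # \<mu>)) (E (i # \<mu>)) \<kappa> = A j i * V (length \<mu>) (E \<mu>) \<kappa>'"
      using cons.prems \<kappa> by (simp add: sps_proj_eq tensor_def A_def)
    also have "V (length \<mu>) (E \<mu>) \<kappa>' = (\<Prod>k<length \<mu>. A (\<kappa>' ! k) (\<mu> ! k))"
      using cons.IH[of \<kappa>'] cons.prems \<kappa> \<open>\<kappa>' \<in> ?L'\<close> by simp
    finally show ?case unfolding \<kappa> by (simp add: prod.lessThan_Suc_shift del: prod.lessThan_Suc)
  qed
  define B where "B i j = inv_into (sps d I 1) (V 1) (monom_word [j]) [i]" for i j
  have AB: "(\<Sum>i<d. A j i * B i j') = (if j = j' then 1 else 0)" if "j < d'" "j' < d'" for j j'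
  proof -
    have m: "monom_word [j'] \<in> sps d' J 1" using let_L'[OF that(2)] by (auto simp: sps_iff monom_word_def)
    define \<xi> where "\<xi> = inv_into (sps d I 1) (V 1) (monom_word [j'])"
    have \<xi>: "\<xi> \<in> sps d I 1" "V 1 \<xi> = monom_word [j']"
      using bij[of 1] m by (auto simp: \<xi>_def bij_betw_def inv_into_into f_inv_into_f)
    have "\<xi> w = (\<Sum>i<d. B i j' * E [i] w)" for w
    proof (cases "\<exists>i<d. w = [i]")
      case True
      then obtain i where i: "i < d" "w = [i]" by blast
      have "(\<Sum>k<d. B k j' * E [k] w) = (\<Sum>k<d. if k = i then B i j' else 0)"
        by (rule sum.cong) (auto simp: E_def let_L monom_word_def i)
      then show ?thesis using i by (simp add: B_def \<xi>_def)
    next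
      case False
      have "\<xi> w = 0"
      proof (rule ccontr)
        assume "\<xi> w \<noteq> 0"
        then have "w \<in> words d" "length w = 1" using \<xi>(1) by (auto simp: sps_iff allowable_def)
        then show False using False by (cases w) auto
      qed
      moreover have "E [k] w = 0" if "k < d" for k using False that by (auto simp: E_def monom_word_def)
      ultimately show ?thesis by simp
    qed
    then have "V 1 \<xi> = V 1 (\<lambda>w. \<Sum>i<d. B i j' * E [i] w)" by (intro arg_cong[where f = "V 1"]) auto
    also have "\<dots> = (\<lambda>w. \<Sum>i<d. B i j' * V 1 (E [i]) w)"
      using E[of "[_]"] by (subst V_sum) (auto intro: sps_scale simp: V_scale)
    finally have "monom_word [j'] [j] = (\<Sum>i<d. A j i * B i j')"
      unfolding \<xi>(2) by (simp add: A_def mult.commute)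
    then show ?thesis by (simp add: monom_word_def)
  qed
  have van: "(\<Prod>k<length \<mu>. A (\<kappa> ! k) (\<mu> ! k)) = 0"
    if \<mu>: "\<mu> \<in> words d" "\<mu> \<notin> ?L" and \<kappa>: "\<kappa> \<in> ?L'" "length \<kappa> = length \<mu>" for \<mu> \<kappa>
  proof (cases "\<mu> = []")
    case True
    \<comment> \<open>The empty product is 1, so this case must be contradictory: without the empty
      word the degree-zero space is zero, whereas \<open>\<kappa>\<close>, being empty, makes the
      target space nonzero.\<close>
    have "\<xi> = (\<lambda>w. 0)" if "\<xi> \<in> sps d I 0" for \<xi>
      using that \<mu>(2) True by (auto simp: sps_iff)
    then have V0: "V 0 \<xi> = (\<lambda>w. 0)" if "\<xi> \<in> sps d I 0" for \<xi> using that V_zero by blast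
    have "monom_word [] \<in> V 0 ` sps d I 0"
      using bij[of 0] \<kappa> True by (auto simp: bij_betw_def sps_iff monom_word_def)
    then obtain \<xi> where \<xi>: "\<xi> \<in> sps d I 0" "monom_word [] = V 0 \<xi>" by blast
    have "monom_word [] = (\<lambda>w. 0 :: complex)" unfolding \<xi>(2) by (rule V0[OF \<xi>(1)])
    then have "monom_word [] [] = (0 :: complex)" by (rule fun_cong)
    then show ?thesis by (simp add: monom_word_def)
  next
    case False
    have "E \<mu> = (\<lambda>w. 0)" using \<mu>(2) by (simp add: E_def)
    then show ?thesis using prod[OF False \<mu>(1) \<kappa>] by (simp add: V_zero)
  qed
  show ?thesis
    unfolding word_dominates_def using AB van by (intro exI[of _ A] exI[of _ B]) auto
qed

section \<open>Cosets of a monomial ideal and their representatives on allowable words\<close>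

lemma coset_def: "I +>\<^bsub>nc_poly d\<^esub> f = {\<lambda>w. h w + f w | h. h \<in> I}"
  by (auto simp: a_r_coset_def' nc_poly_def)

lemma nc_poly_add: "f \<in> carrier (nc_poly d) \<Longrightarrow> g \<in> carrier (nc_poly d) \<Longrightarrow> (\<lambda>w. f w + g w) \<in> carrier (nc_poly d)"
  using ring.ring_simprules(1)[OF nc_poly_ring, of f d g] by (simp add: nc_poly_def)

lemma nc_poly_scale:
  assumes "f \<in> carrier (nc_poly d)"
  shows "(\<lambda>w. c * f w) \<in> carrier (nc_poly d)"
proof -
  have "finite {w. c * f w \<noteq> 0}"
    by (rule finite_subset[of _ "{w. f w \<noteq> 0}"]) (use assms in \<open>auto simp: nc_poly_carrier\<close>)
  then show ?thesis using assms by (simp add: nc_poly_carrier)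
qed

lemma nc_poly_mult: "f \<in> carrier (nc_poly d) \<Longrightarrow> g \<in> carrier (nc_poly d) \<Longrightarrow> nc_mult f g \<in> carrier (nc_poly d)"
  using monoid.m_closed[OF ring.is_monoid[OF nc_poly_ring], of f d g] by (simp add: nc_poly_def)

lemma monomial_ideal_add:
  assumes I: "monomial_ideal d I" and fg: "f \<in> I" "g \<in> I"
  shows "(\<lambda>w. f w + g w) \<in> I"
proof -
  have "w \<notin> allowable d I" if "f w + g w \<noteq> 0" for w
    using that fg by (cases "f w = 0") (auto simp: monomial_ideal_iff[OF I])
  then show ?thesis using fg nc_poly_add by (simp add: monomial_ideal_iff[OF I])
qed

lemma monomial_ideal_zero: "monomial_ideal d I \<Longrightarrow> (\<lambda>w. 0) \<in> I"
  by (simp add: monomial_ideal_iff nc_poly_carrier)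

lemma coset_self: "monomial_ideal d I \<Longrightarrow> f \<in> I +>\<^bsub>nc_poly d\<^esub> f"
  unfolding coset_def using monomial_ideal_zero[of d I] by force

lemma coset_eq:
  assumes I: "monomial_ideal d I" and fg: "f \<in> carrier (nc_poly d)" "g \<in> carrier (nc_poly d)"
  shows "I +>\<^bsub>nc_poly d\<^esub> f = I +>\<^bsub>nc_poly d\<^esub> g \<longleftrightarrow> (\<forall>w\<in>allowable d I. f w = g w)"
proof
  assume eq: "I +>\<^bsub>nc_poly d\<^esub> f = I +>\<^bsub>nc_poly d\<^esub> g"
  from coset_self[OF I, of f] obtain h where h: "h \<in> I" "f = (\<lambda>w. h w + g w)" unfolding eq by (auto simp: coset_def)
  then have "h w = 0" if "w \<in> allowable d I" for w using that by (auto simp: monomial_ideal_iff[OF I])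
  then show "\<forall>w\<in>allowable d I. f w = g w" by (simp add: h(2))
next
  have sub: "I +>\<^bsub>nc_poly d\<^esub> f \<subseteq> I +>\<^bsub>nc_poly d\<^esub> g"
    if fg: "f \<in> carrier (nc_poly d)" "g \<in> carrier (nc_poly d)" and eq: "\<forall>w\<in>allowable d I. f w = g w" for f g
  proof
    fix u assume "u \<in> I +>\<^bsub>nc_poly d\<^esub> f"
    then obtain h where h: "h \<in> I" "u = (\<lambda>w. h w + f w)" by (auto simp: coset_def)
    have "(\<lambda>w. f w - g w) \<in> carrier (nc_poly d)"
      using nc_poly_add[OF fg(1) nc_poly_scale[OF fg(2), of "-1"]] by simp
    then have "(\<lambda>w. f w - g w) \<in> I"
      unfolding monomial_ideal_iff[OF I] using eq by auto
    from monomial_ideal_add[OF I h(1) this] have "(\<lambda>w. h w + (f w - g w)) \<in> I" .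
    moreover have "u = (\<lambda>w. (h w + (f w - g w)) + g w)" by (simp add: h(2))
    ultimately show "u \<in> I +>\<^bsub>nc_poly d\<^esub> g"
      unfolding coset_def by (intro CollectI exI[of _ "\<lambda>w. h w + (f w - g w)"] conjI)
  qed
  assume eq: "\<forall>w\<in>allowable d I. f w = g w"
  show "I +>\<^bsub>nc_poly d\<^esub> f = I +>\<^bsub>nc_poly d\<^esub> g"
    using sub[OF fg eq] sub[OF fg(2,1)] eq by simp
qed

lemma nc_quot_carrier: "carrier (nc_quot d I) = {I +>\<^bsub>nc_poly d\<^esub> f | f. f \<in> carrier (nc_poly d)}"
  by (auto simp: FactRing_def A_RCOSETS_def')

lemma coset_ops:
  assumes I: "monomial_ideal d I" and f: "f \<in> carrier (nc_poly d)" and g: "g \<in> carrier (nc_poly d)"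
  shows "(I +>\<^bsub>nc_poly d\<^esub> f) \<oplus>\<^bsub>nc_quot d I\<^esub> (I +>\<^bsub>nc_poly d\<^esub> g) = I +>\<^bsub>nc_poly d\<^esub> (\<lambda>w. f w + g w)"
    and "(I +>\<^bsub>nc_poly d\<^esub> f) \<otimes>\<^bsub>nc_quot d I\<^esub> (I +>\<^bsub>nc_poly d\<^esub> g) = I +>\<^bsub>nc_poly d\<^esub> (nc_mult f g)"
    and "c \<odot>\<^bsub>nc_quot d I\<^esub> (I +>\<^bsub>nc_poly d\<^esub> f) = I +>\<^bsub>nc_poly d\<^esub> (\<lambda>w. c * f w)"
    and "\<one>\<^bsub>nc_quot d I\<^esub> = I +>\<^bsub>nc_poly d\<^esub> monom_word []"
proof -
  interpret ideal I "nc_poly d" by (rule monomial_ideal_is_ideal[OF I])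
  show "(I +>\<^bsub>nc_poly d\<^esub> f) \<oplus>\<^bsub>nc_quot d I\<^esub> (I +>\<^bsub>nc_poly d\<^esub> g) = I +>\<^bsub>nc_poly d\<^esub> (\<lambda>w. f w + g w)"
    using a_rcos_sum[OF f g] by (simp add: FactRing_def) (simp add: nc_poly_def)
  show "(I +>\<^bsub>nc_poly d\<^esub> f) \<otimes>\<^bsub>nc_quot d I\<^esub> (I +>\<^bsub>nc_poly d\<^esub> g) = I +>\<^bsub>nc_poly d\<^esub> (nc_mult f g)"
    using rcoset_mult_add[OF f g] by (simp add: FactRing_def) (simp add: nc_poly_def)
  show "\<one>\<^bsub>nc_quot d I\<^esub> = I +>\<^bsub>nc_poly d\<^esub> monom_word []"
    by (simp add: FactRing_def) (simp add: nc_poly_def)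
  have sm: "c \<odot>\<^bsub>nc_poly d\<^esub> u = (\<lambda>w. c * u w)" for u by (simp add: nc_poly_def)
  have "I +>\<^bsub>nc_poly d\<^esub> (c \<odot>\<^bsub>nc_poly d\<^esub> u) = I +>\<^bsub>nc_poly d\<^esub> (\<lambda>w. c * f w)" if u: "u \<in> I +>\<^bsub>nc_poly d\<^esub> f" for u
  proof -
    obtain h where h: "h \<in> I" "u = (\<lambda>w. h w + f w)" using u by (auto simp: coset_def)
    then have hc: "h \<in> carrier (nc_poly d)" by (simp add: monomial_ideal_iff[OF I])
    have uc: "u \<in> carrier (nc_poly d)" unfolding h(2) by (rule nc_poly_add[OF hc f])
    have hI: "h w = 0" if "w \<in> allowable d I" for w using h(1) that by (auto simp: monomial_ideal_iff[OF I])
    show ?thesis unfolding sm coset_eq[OF I nc_poly_scale[OF uc] nc_poly_scale[OF f]] using h hI by simp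
  qed
  with coset_self[OF I, of f] show "c \<odot>\<^bsub>nc_quot d I\<^esub> (I +>\<^bsub>nc_poly d\<^esub> f) = I +>\<^bsub>nc_poly d\<^esub> (\<lambda>w. c * f w)"
    unfolding nc_quot_simps by blast
qed

lemma sps_carrier: "\<xi> \<in> sps d I n \<Longrightarrow> \<xi> \<in> carrier (nc_poly d)"
proof -
  assume \<xi>: "\<xi> \<in> sps d I n"
  have "finite {w. \<xi> w \<noteq> 0}"
    by (rule finite_subset[OF _ finite_words_eq[of d n]]) (use \<xi> in \<open>auto simp: sps_iff allowable_def\<close>)
  then show ?thesis using \<xi> by (simp add: nc_poly_carrier sps_iff allowable_def)
qed

text \<open>Deleting the coefficients at words of the ideal changes neither the coset nor the
  degree.\<close>

lemma quot_component_eq: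
  assumes I: "monomial_ideal d I"
  shows "quot_component d I n = (\<lambda>\<xi>. I +>\<^bsub>nc_poly d\<^esub> \<xi>) ` sps d I n"
proof
  show "(\<lambda>\<xi>. I +>\<^bsub>nc_poly d\<^esub> \<xi>) ` sps d I n \<subseteq> quot_component d I n"
  proof (rule image_subsetI)
    fix \<xi> assume \<xi>: "\<xi> \<in> sps d I n"
    then show "I +>\<^bsub>nc_poly d\<^esub> \<xi> \<in> quot_component d I n"
      unfolding quot_component_def using sps_carrier[OF \<xi>] by (intro CollectI exI[of _ \<xi>]) (simp add: sps_iff)
  qed
  show "quot_component d I n \<subseteq> (\<lambda>\<xi>. I +>\<^bsub>nc_poly d\<^esub> \<xi>) ` sps d I n"
  proof
    fix C assume "C \<in> quot_component d I n"
    then obtain f where f: "C = I +>\<^bsub>nc_poly d\<^esub> f" "f \<in> carrier (nc_poly d)" "\<forall>w. f w \<noteq> 0 \<longrightarrow> length w = n"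
      by (auto simp: quot_component_def)
    have nf: "(\<lambda>w. if w \<in> allowable d I then f w else 0) \<in> sps d I n" using f(3) by (auto simp: sps_iff)
    from sps_carrier[OF this] have C: "C = I +>\<^bsub>nc_poly d\<^esub> (\<lambda>w. if w \<in> allowable d I then f w else 0)"
      unfolding f(1) by (subst coset_eq[OF I f(2)]) auto
    show "C \<in> (\<lambda>\<xi>. I +>\<^bsub>nc_poly d\<^esub> \<xi>) ` sps d I n"
      by (rule image_eqI[where f = "\<lambda>\<xi>. I +>\<^bsub>nc_poly d\<^esub> \<xi>", OF C nf])
  qed
qed

text \<open>A coset of degree \<open>n\<close> has exactly one representative in \<open>sps\<close>;
  \<open>V n\<close> is \<open>\<phi>\<close> read off on these representatives.\<close>

lemma graded_quot_iso_graded_iso: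
  assumes I: "monomial_ideal d I" and J: "monomial_ideal d' J" and \<phi>: "\<phi> \<in> graded_quot_iso d I d' J"
  shows "\<exists>V. graded_iso d I d' J V"
proof -
  let ?I = "\<lambda>\<xi>. I +>\<^bsub>nc_poly d\<^esub> \<xi>" and ?J = "\<lambda>\<xi>. J +>\<^bsub>nc_poly d'\<^esub> \<xi>"
  have hom: "\<phi> \<in> Ring.ring_hom (nc_quot d I) (nc_quot d' J)"
    and inj: "inj_on \<phi> (carrier (nc_quot d I))"
    and sc: "\<And>c a. a \<in> carrier (nc_quot d I) \<Longrightarrow> \<phi> (c \<odot>\<^bsub>nc_quot d I\<^esub> a) = c \<odot>\<^bsub>nc_quot d' J\<^esub> \<phi> a"
    and comp: "\<And>n. \<phi> ` ?I ` sps d I n = ?J ` sps d' J n"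
    using \<phi> by (auto simp: graded_quot_iso_def alg_iso_def ring_iso_def bij_betw_def quot_component_eq[OF I] quot_component_eq[OF J]
        simp del: nc_quot_simps)
  have carI: "?I f \<in> carrier (nc_quot d I)" if "f \<in> carrier (nc_poly d)" for f
    using that by (auto simp: nc_quot_carrier simp del: nc_quot_simps)
  have unique: "\<xi> = \<eta>" if "\<xi> \<in> sps d' J n" "\<eta> \<in> sps d' J n" "?J \<xi> = ?J \<eta>" for \<xi> \<eta> n
  proof
    fix w
    show "\<xi> w = \<eta> w"
    proof (cases "w \<in> allowable d' J")
      case True
      then show ?thesis using that(3) coset_eq[OF J sps_carrier[OF that(1)] sps_carrier[OF that(2)]] by blast
    next
      case False
      then show ?thesis using sps_outside[OF that(1)] sps_outside[OF that(2)] by simp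
    qed
  qed
  define V where "V n \<xi> = (SOME \<eta>. \<eta> \<in> sps d' J n \<and> \<phi> (?I \<xi>) = ?J \<eta>)" for n \<xi>
  have V: "V n \<xi> \<in> sps d' J n \<and> \<phi> (?I \<xi>) = ?J (V n \<xi>)" if "\<xi> \<in> sps d I n" for n \<xi>
  proof -
    have "\<phi> (?I \<xi>) \<in> ?J ` sps d' J n" using comp[of n] that by blast
    then have "\<exists>\<eta>. \<eta> \<in> sps d' J n \<and> \<phi> (?I \<xi>) = ?J \<eta>" by blast
    then show ?thesis unfolding V_def by (rule someI_ex)
  qed
  have V_eq: "V n \<xi> = \<eta>" if "\<xi> \<in> sps d I n" "\<eta> \<in> sps d' J n" "\<phi> (?I \<xi>) = ?J \<eta>" for n \<xi> \<eta>
    using unique[of "V n \<xi>" n \<eta>] V[OF that(1)] that by simp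
  have "graded_iso d I d' J V"
    unfolding graded_iso_def linear_map_on_def
  proof (intro conjI allI ballI)
    fix n \<xi> \<eta> assume \<xi>: "\<xi> \<in> sps d I n" and \<eta>: "\<eta> \<in> sps d I n"
    show "V n (\<lambda>w. \<xi> w + \<eta> w) = (\<lambda>w. V n \<xi> w + V n \<eta> w)"
    proof (rule V_eq)
      have "\<phi> (?I (\<lambda>w. \<xi> w + \<eta> w)) = \<phi> (?I \<xi>) \<oplus>\<^bsub>nc_quot d' J\<^esub> \<phi> (?I \<eta>)"
        unfolding coset_ops(1)[OF I sps_carrier[OF \<xi>] sps_carrier[OF \<eta>], symmetric]
        by (rule ring_hom_add[OF hom]) (intro carI sps_carrier[OF \<xi>] sps_carrier[OF \<eta>])+
      also have "\<dots> = ?J (V n \<xi>) \<oplus>\<^bsub>nc_quot d' J\<^esub> ?J (V n \<eta>)" using V[OF \<xi>] V[OF \<eta>] by (simp only:)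
      also have "\<dots> = ?J (\<lambda>w. V n \<xi> w + V n \<eta> w)"
        using V[OF \<xi>] V[OF \<eta>] by (intro coset_ops(1)[OF J]) (auto intro: sps_carrier)
      finally show "\<phi> (?I (\<lambda>w. \<xi> w + \<eta> w)) = ?J (\<lambda>w. V n \<xi> w + V n \<eta> w)" .
    qed (use V \<xi> \<eta> in \<open>auto intro: sps_add\<close>)
  next
    fix n c \<xi> assume \<xi>: "\<xi> \<in> sps d I n"
    show "V n (\<lambda>w. c * \<xi> w) = (\<lambda>w. c * V n \<xi> w)"
    proof (rule V_eq)
      have "\<phi> (?I (\<lambda>w. c * \<xi> w)) = c \<odot>\<^bsub>nc_quot d' J\<^esub> \<phi> (?I \<xi>)"
        unfolding coset_ops(3)[OF I sps_carrier[OF \<xi>] sps_carrier[OF \<xi>], symmetric]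
        by (rule sc) (intro carI sps_carrier[OF \<xi>])
      also have "\<dots> = c \<odot>\<^bsub>nc_quot d' J\<^esub> ?J (V n \<xi>)" using V[OF \<xi>] by (simp only:)
      also have "\<dots> = ?J (\<lambda>w. c * V n \<xi> w)"
        using V[OF \<xi>] by (intro coset_ops(3)[OF J]) (auto intro: sps_carrier)
      finally show "\<phi> (?I (\<lambda>w. c * \<xi> w)) = ?J (\<lambda>w. c * V n \<xi> w)" .
    qed (use V \<xi> in \<open>auto intro: sps_scale\<close>)
  next
    fix n
    show "bij_betw (V n) (sps d I n) (sps d' J n)"
    proof (rule bij_betw_imageI)
      show "inj_on (V n) (sps d I n)"
      proof (rule inj_onI)
        fix \<xi> \<eta> assume h: "\<xi> \<in> sps d I n" "\<eta> \<in> sps d I n" "V n \<xi> = V n \<eta>"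
        then have "\<phi> (?I \<xi>) = \<phi> (?I \<eta>)" using V[OF h(1)] V[OF h(2)] by simp
        from inj_onD[OF inj this carI[OF sps_carrier[OF h(1)]] carI[OF sps_carrier[OF h(2)]]] have "?I \<xi> = ?I \<eta>" .
        then have "\<forall>w\<in>allowable d I. \<xi> w = \<eta> w" using coset_eq[OF I sps_carrier[OF h(1)] sps_carrier[OF h(2)]] by blast
        moreover have "\<xi> w = \<eta> w" if "w \<notin> allowable d I" for w using sps_outside[OF h(1) that] sps_outside[OF h(2) that] by simp
        ultimately show "\<xi> = \<eta>" by blast
      qed
      show "V n ` sps d I n = sps d' J n"
      proof (intro equalityI subsetI)
        fix \<eta> assume \<eta>: "\<eta> \<in> sps d' J n"
        then have "?J \<eta> \<in> \<phi> ` ?I ` sps d I n" unfolding comp by blast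
        then obtain \<xi> where \<xi>: "\<xi> \<in> sps d I n" "?J \<eta> = \<phi> (?I \<xi>)" by blast
        then have "V n \<xi> = \<eta>" using V_eq[OF \<xi>(1) \<eta>] by simp
        then show "\<eta> \<in> V n ` sps d I n" using \<xi>(1) by blast
      qed (use V in blast)
    qed
  next
    fix m n \<xi> \<eta> assume \<xi>: "\<xi> \<in> sps d I m" and \<eta>: "\<eta> \<in> sps d I n"
    have mult: "nc_mult \<xi> \<eta> w = (if length w = m + n then tensor m \<xi> \<eta> w else 0)" if "\<xi> \<in> sps d I m" "\<eta> \<in> sps d I n" for d I \<xi> \<eta> w
    proof -
      have "nc_mult \<xi> \<eta> w = (\<Sum>k\<le>length w. if k = m then (if length w = m + n then tensor m \<xi> \<eta> w else 0) else 0)"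
        unfolding nc_mult_def
      proof (rule sum.cong[OF refl])
        fix k assume k: "k \<in> {..length w}"
        then have l: "length (take k w) = k" "length (drop k w) = length w - k" by auto
        show "\<xi> (take k w) * \<eta> (drop k w) = (if k = m then (if length w = m + n then tensor m \<xi> \<eta> w else 0) else 0)"
        proof (cases "k = m \<and> length w = m + n")
          case False
          have "\<xi> (take k w) = 0 \<or> \<eta> (drop k w) = 0"
          proof (rule ccontr)
            assume "\<not> (\<xi> (take k w) = 0 \<or> \<eta> (drop k w) = 0)"
            then have "length (take k w) = m" "length (drop k w) = n"
              using sps_length[OF that(1)] sps_length[OF that(2)] by blast+
            then have "k = m" "length w - k = n" using l by simp_all
            moreover have "k \<le> length w" using k by simp
            ultimately show False using False by simp
          qed
          then show ?thesis using False by auto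
        qed (simp add: tensor_def)
      qed
      then show ?thesis by auto
    qed
    \<comment> \<open>For homogeneous factors the polynomial product is the tensor product, and the
      projection discards only words of the ideal, so the coset is unchanged.\<close>
    have pr: "K +>\<^bsub>nc_poly e\<^esub> nc_mult \<xi> \<eta> = K +>\<^bsub>nc_poly e\<^esub> (sps_proj e K (m + n) (tensor m \<xi> \<eta>))"
      if K: "monomial_ideal e K" and "\<xi> \<in> sps e K m" "\<eta> \<in> sps e K n" for e K \<xi> \<eta>
      using that(2,3) by (subst coset_eq[OF K nc_poly_mult sps_carrier[OF sps_proj_sps]])
        (auto intro: sps_carrier simp: mult[OF that(2,3)] sps_proj_eq)
    show "V (m + n) (sps_proj d I (m + n) (tensor m \<xi> \<eta>)) = sps_proj d' J (m + n) (tensor m (V m \<xi>) (V n \<eta>))"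
    proof (rule V_eq[OF sps_proj_sps sps_proj_sps])
      have "\<phi> (?I (sps_proj d I (m + n) (tensor m \<xi> \<eta>))) = \<phi> (?I \<xi> \<otimes>\<^bsub>nc_quot d I\<^esub> ?I \<eta>)"
        unfolding coset_ops(2)[OF I sps_carrier[OF \<xi>] sps_carrier[OF \<eta>]] pr[OF I \<xi> \<eta>] ..
      also have "\<dots> = \<phi> (?I \<xi>) \<otimes>\<^bsub>nc_quot d' J\<^esub> \<phi> (?I \<eta>)"
        by (rule ring_hom_mult[OF hom]) (intro carI sps_carrier[OF \<xi>] sps_carrier[OF \<eta>])+
      also have "\<dots> = ?J (V m \<xi>) \<otimes>\<^bsub>nc_quot d' J\<^esub> ?J (V n \<eta>)" using V[OF \<xi>] V[OF \<eta>] by (simp only:)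
      also have "\<dots> = ?J (nc_mult (V m \<xi>) (V n \<eta>))"
        using V[OF \<xi>] V[OF \<eta>] by (intro coset_ops(2)[OF J]) (auto intro: sps_carrier)
      also have "\<dots> = ?J (sps_proj d' J (m + n) (tensor m (V m \<xi>) (V n \<eta>)))"
        using V[OF \<xi>] V[OF \<eta>] by (intro pr[OF J]) auto
      finally show "\<phi> (?I (sps_proj d I (m + n) (tensor m \<xi> \<eta>))) = ?J (sps_proj d' J (m + n) (tensor m (V m \<xi>) (V n \<eta>)))" .
    qed
  qed
  then show ?thesis by blast
qed

section \<open>Relabelling and the main theorem\<close>

locale relabelling =
  fixes d :: nat and I J :: "(nat list \<Rightarrow> complex) set" and \<pi> :: "nat \<Rightarrow> nat"
  assumes I: "monomial_ideal d I" and J: "monomial_ideal d J"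
    and perm: "\<pi> permutes {..<d}"
    and words_iff: "\<And>\<mu>. \<mu> \<in> words d \<Longrightarrow> \<mu> \<in> allowable d I \<longleftrightarrow> map \<pi> \<mu> \<in> allowable d J"
begin

abbreviation "\<pi>' \<equiv> inv_into UNIV \<pi>"

lemma map_inverse [simp]: "map \<pi> (map \<pi>' w) = w" "map \<pi>' (map \<pi> w) = w"
  using permutes_inverses[OF perm] by (simp_all add: o_def)

lemma map_words: "map \<pi> w \<in> words d \<longleftrightarrow> w \<in> words d" "map \<pi>' w \<in> words d \<longleftrightarrow> w \<in> words d"
  using permutes_in_image[OF perm] permutes_in_image[OF permutes_inv[OF perm]] by (auto simp: words_def lists_eq_set)

lemma allowable_map: "map \<pi>' w \<in> allowable d I \<longleftrightarrow> w \<in> allowable d J"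
proof (cases "w \<in> words d")
  case True
  then have "map \<pi>' w \<in> words d" using map_words by simp
  from words_iff[OF this] show ?thesis unfolding map_inverse .
next
  case False
  then show ?thesis using map_words by (simp add: allowable_def)
qed

lemma reversed: "relabelling d J I \<pi>'"
proof
  show "\<pi>' permutes {..<d}" by (rule permutes_inv[OF perm])
qed (use I J allowable_map in auto)

lemma subst_inverse: "subst_vars \<pi>' (subst_vars \<pi> f) = f" "subst_vars \<pi> (subst_vars \<pi>' f) = f"
  unfolding subst_vars_def permutes_inv_inv[OF perm] by (simp_all del: map_map)

lemma bij_map: "bij (map \<pi>')"
  by (rule o_bij[where g = "map \<pi>"]) (rule ext, simp only: o_apply id_apply map_inverse)+

lemma subst_inj: "subst_vars \<pi> f = subst_vars \<pi> g \<longleftrightarrow> f = g"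
  using subst_inverse(1) by metis

lemma subst_add: "subst_vars \<pi> (\<lambda>w. f w + g w) = (\<lambda>w. subst_vars \<pi> f w + subst_vars \<pi> g w)"
  by (simp add: subst_vars_def)

lemma subst_diff: "subst_vars \<pi> (\<lambda>w. f w - g w) = (\<lambda>w. subst_vars \<pi> f w - subst_vars \<pi> g w)"
  by (simp add: subst_vars_def)

lemma subst_scale: "subst_vars \<pi> (\<lambda>w. c * f w) = (\<lambda>w. c * subst_vars \<pi> f w)"
  by (simp add: subst_vars_def)

lemma subst_sum: "subst_vars \<pi> (\<lambda>w. \<Sum>s\<in>S. f s w) = (\<lambda>w. \<Sum>s\<in>S. subst_vars \<pi> (f s) w)"
  by (simp add: subst_vars_def)

lemma subst_unit: "subst_vars \<pi> (monom_word []) = monom_word []"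
  by (auto simp: subst_vars_def monom_word_def)

lemma subst_mult: "subst_vars \<pi> (nc_mult f g) = nc_mult (subst_vars \<pi> f) (subst_vars \<pi> g)"
  by (simp add: subst_vars_def nc_mult_def take_map drop_map)

lemma l2_norm_subst: "l2_norm (subst_vars \<pi> \<xi>) = l2_norm \<xi>"
  unfolding l2_norm_def subst_vars_def
  by (subst infsum_reindex_bij_betw[OF bij_map, of "\<lambda>w. (cmod (\<xi> w))\<^sup>2"]) simp

lemma l2_inner_subst: "l2_inner (subst_vars \<pi> \<xi>) (subst_vars \<pi> \<eta>) = l2_inner \<xi> \<eta>"
  unfolding l2_inner_def subst_vars_def
  by (subst infsum_reindex_bij_betw[OF bij_map, of "\<lambda>w. \<xi> w * cnj (\<eta> w)"]) simp

lemma subst_ell2: "subst_vars \<pi> \<xi> \<in> ell2 \<longleftrightarrow> \<xi> \<in> ell2"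
  unfolding ell2_def subst_vars_def mem_Collect_eq
  by (rule summable_on_reindex_bij_betw[OF bij_map, of "\<lambda>w. (cmod (\<xi> w))\<^sup>2"])

lemma subst_support:
  "(\<forall>w. subst_vars \<pi> f w \<noteq> 0 \<longrightarrow> P w) \<longleftrightarrow> (\<forall>w. f w \<noteq> 0 \<longrightarrow> P (map \<pi> w))"
proof
  assume a: "\<forall>w. subst_vars \<pi> f w \<noteq> 0 \<longrightarrow> P w"
  show "\<forall>w. f w \<noteq> 0 \<longrightarrow> P (map \<pi> w)"
  proof (intro allI impI)
    fix w assume "f w \<noteq> 0"
    then have "subst_vars \<pi> f (map \<pi> w) \<noteq> 0" unfolding subst_vars_def map_inverse .
    then show "P (map \<pi> w)" using a by blast
  qed
next
  assume a: "\<forall>w. f w \<noteq> 0 \<longrightarrow> P (map \<pi> w)"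
  show "\<forall>w. subst_vars \<pi> f w \<noteq> 0 \<longrightarrow> P w"
  proof (intro allI impI)
    fix w assume "subst_vars \<pi> f w \<noteq> 0"
    then have "f (map \<pi>' w) \<noteq> 0" unfolding subst_vars_def .
    then have "P (map \<pi> (map \<pi>' w))" using a by blast
    then show "P w" unfolding map_inverse .
  qed
qed

lemma allowable_map': "map \<pi> w \<in> allowable d J \<longleftrightarrow> w \<in> allowable d I"
  using allowable_map[of "map \<pi> w"] unfolding map_inverse by simp

lemma subst_fock: "subst_vars \<pi> \<xi> \<in> fock d J \<longleftrightarrow> \<xi> \<in> fock d I"
  unfolding fock_iff subst_ell2 subst_support allowable_map' ..

lemma subst_sps: "subst_vars \<pi> \<xi> \<in> sps d J n \<longleftrightarrow> \<xi> \<in> sps d I n"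
  unfolding sps_iff subst_support allowable_map' length_map ..

lemma subst_carrier: "subst_vars \<pi> f \<in> carrier (nc_poly d) \<longleftrightarrow> f \<in> carrier (nc_poly d)"
proof -
  have "{w. subst_vars \<pi> f w \<noteq> 0} = map \<pi> ` {w. f w \<noteq> 0}"
  proof (intro equalityI subsetI)
    fix w assume "w \<in> {w. subst_vars \<pi> f w \<noteq> 0}"
    then have "map \<pi>' w \<in> {w. f w \<noteq> 0}" by (simp add: subst_vars_def)
    then have "map \<pi> (map \<pi>' w) \<in> map \<pi> ` {w. f w \<noteq> 0}" by (rule imageI)
    then show "w \<in> map \<pi> ` {w. f w \<noteq> 0}" unfolding map_inverse .
  next
    fix w assume "w \<in> map \<pi> ` {w. f w \<noteq> 0}"
    then obtain v where "w = map \<pi> v" "f v \<noteq> 0" by blast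
    then show "w \<in> {w. subst_vars \<pi> f w \<noteq> 0}" by (simp add: subst_vars_def del: map_map)
  qed
  moreover have "inj (map \<pi>)" using permutes_inj[OF perm] by simp
  ultimately have "finite {w. subst_vars \<pi> f w \<noteq> 0} \<longleftrightarrow> finite {w. f w \<noteq> 0}"
    by (simp add: finite_image_iff inj_on_subset[of _ UNIV])
  then show ?thesis unfolding nc_poly_carrier subst_support map_words by simp
qed

lemma subst_ideal: "subst_vars \<pi> f \<in> J \<longleftrightarrow> f \<in> I"
  unfolding monomial_ideal_iff[OF I] monomial_ideal_iff[OF J] subst_carrier subst_support allowable_map' ..

lemma subst_image:
  assumes "\<And>f. subst_vars \<pi> f \<in> B \<longleftrightarrow> f \<in> A"
  shows "subst_vars \<pi> ` A = B" and "bij_betw (subst_vars \<pi>) A B"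
proof -
  show im: "subst_vars \<pi> ` A = B"
  proof (intro equalityI subsetI)
    fix g assume g: "g \<in> B"
    then have "subst_vars \<pi> (subst_vars \<pi>' g) \<in> B" unfolding subst_inverse .
    then have "subst_vars \<pi>' g \<in> A" unfolding assms .
    then have "subst_vars \<pi> (subst_vars \<pi>' g) \<in> subst_vars \<pi> ` A" by (rule imageI)
    then show "g \<in> subst_vars \<pi> ` A" unfolding subst_inverse .
  qed (use assms in blast)
  show "bij_betw (subst_vars \<pi>) A B"
    unfolding bij_betw_def using im by (simp add: inj_on_def subst_inj)
qed

lemma image_ideal: "subst_vars \<pi> ` I = J"
  by (rule subst_image(1)[OF subst_ideal])

lemma sps_isomorphic: "sps_isomorphic d I d J"
proof -
  let ?V = "\<lambda>n :: nat. subst_vars \<pi>"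
  interpret R: relabelling d J I \<pi>' by (rule reversed)
  have bij: "bij_betw (subst_vars \<pi>) (sps d I n) (sps d J n)" for n by (rule subst_image(2)[OF subst_sps])
  have inv: "inv_into (sps d I n) (subst_vars \<pi>) \<eta> = subst_vars \<pi>' \<eta>" if "\<eta> \<in> sps d J n" for \<eta> n
  proof -
    have "subst_vars \<pi>' \<eta> \<in> sps d I n" using that unfolding R.subst_sps .
    moreover have "inj_on (subst_vars \<pi>) (sps d I n)" using bij by (rule bij_betw_imp_inj_on)
    ultimately have "inv_into (sps d I n) (subst_vars \<pi>) (subst_vars \<pi> (subst_vars \<pi>' \<eta>)) = subst_vars \<pi>' \<eta>" by simp
    then show ?thesis unfolding subst_inverse .
  qed
  have "sps_similarity d I d J ?V"
    unfolding sps_similarity_def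
  proof (intro conjI allI ballI bij)
    show "linear_map_on (sps d I n) (subst_vars \<pi>)" for n
      by (simp add: linear_map_on_def subst_add subst_scale)
    have "op_norm (sps d I n) (subst_vars \<pi>) \<le> ennreal 1" for n
      by (rule op_norm_le) (simp_all add: l2_norm_subst)
    then have "(SUP n. op_norm (sps d I n) (subst_vars \<pi>)) \<le> ennreal 1" by (intro SUP_least)
    then show "(SUP n. op_norm (sps d I n) (subst_vars \<pi>)) < \<infinity>" by (rule le_less_trans) simp
    have "op_norm (sps d J n) (inv_into (sps d I n) (subst_vars \<pi>)) \<le> ennreal 1" for n
      by (rule op_norm_le) (simp_all add: inv R.l2_norm_subst)
    then have "(SUP n. op_norm (sps d J n) (inv_into (sps d I n) (subst_vars \<pi>))) \<le> ennreal 1" by (intro SUP_least)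
    then show "(SUP n. op_norm (sps d J n) (inv_into (sps d I n) (subst_vars \<pi>))) < \<infinity>" by (rule le_less_trans) simp
    show "subst_vars \<pi> (sps_proj d I (m + n) (tensor m \<xi> \<eta>)) = sps_proj d J (m + n) (tensor m (subst_vars \<pi> \<xi>) (subst_vars \<pi> \<eta>))" for m n \<xi> \<eta>
      unfolding sps_proj_eq tensor_def subst_vars_def allowable_map length_map take_map drop_map ..
  qed
  then show ?thesis
    unfolding sps_isomorphic_def by (intro exI[of _ ?V]) (simp add: l2_inner_subst)
qed

lemma image_coset: "subst_vars \<pi> ` (I +>\<^bsub>nc_poly d\<^esub> f) = J +>\<^bsub>nc_poly d\<^esub> subst_vars \<pi> f"
  unfolding coset_def image_ideal[symmetric] Setcompr_eq_image image_image subst_add ..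

lemma graded_quot_iso: "(\<lambda>C. subst_vars \<pi> ` C) \<in> graded_quot_iso d I d J"
proof -
  let ?\<phi> = "\<lambda>C. subst_vars \<pi> ` C"
  interpret R: relabelling d J I \<pi>' by (rule reversed)
  have car: "subst_vars \<pi> f \<in> carrier (nc_poly d)" if "f \<in> carrier (nc_poly d)" for f
    using that unfolding subst_carrier .
  have carI: "\<exists>f\<in>carrier (nc_poly d). C = I +>\<^bsub>nc_poly d\<^esub> f" if "C \<in> carrier (nc_quot d I)" for C
    using that unfolding nc_quot_carrier by blast
  have "?\<phi> \<in> Ring.ring_hom (nc_quot d I) (nc_quot d J)"
  proof (rule ring_hom_memI)
    fix C assume "C \<in> carrier (nc_quot d I)"
    then obtain f where f: "f \<in> carrier (nc_poly d)" "C = I +>\<^bsub>nc_poly d\<^esub> f" using carI by blast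
    show "?\<phi> C \<in> carrier (nc_quot d J)" unfolding f(2) image_coset nc_quot_carrier using car[OF f(1)] by blast
    fix D assume "D \<in> carrier (nc_quot d I)"
    then obtain g where g: "g \<in> carrier (nc_poly d)" "D = I +>\<^bsub>nc_poly d\<^esub> g" using carI by blast
    show "?\<phi> (C \<otimes>\<^bsub>nc_quot d I\<^esub> D) = ?\<phi> C \<otimes>\<^bsub>nc_quot d J\<^esub> ?\<phi> D"
      unfolding f(2) g(2) image_coset coset_ops(2)[OF I f(1) g(1)] coset_ops(2)[OF J car[OF f(1)] car[OF g(1)]] subst_mult ..
    show "?\<phi> (C \<oplus>\<^bsub>nc_quot d I\<^esub> D) = ?\<phi> C \<oplus>\<^bsub>nc_quot d J\<^esub> ?\<phi> D"
      unfolding f(2) g(2) image_coset coset_ops(1)[OF I f(1) g(1)] coset_ops(1)[OF J car[OF f(1)] car[OF g(1)]] subst_add ..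
  next
    have "monom_word [] \<in> carrier (nc_poly d)" by (simp add: monom_word_carrier)
    then show "?\<phi> \<one>\<^bsub>nc_quot d I\<^esub> = \<one>\<^bsub>nc_quot d J\<^esub>"
      unfolding coset_ops(4)[OF I \<open>monom_word [] \<in> carrier (nc_poly d)\<close> \<open>monom_word [] \<in> carrier (nc_poly d)\<close>]
        coset_ops(4)[OF J \<open>monom_word [] \<in> carrier (nc_poly d)\<close> \<open>monom_word [] \<in> carrier (nc_poly d)\<close>] image_coset subst_unit by simp
  qed
  moreover have "bij_betw ?\<phi> (carrier (nc_quot d I)) (carrier (nc_quot d J))"
  proof (rule bij_betw_imageI)
    have "inj (subst_vars \<pi>)" by (simp add: inj_def subst_inj)
    then show "inj_on ?\<phi> (carrier (nc_quot d I))" by (intro inj_onI) (simp only: inj_image_eq_iff)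
    show "?\<phi> ` carrier (nc_quot d I) = carrier (nc_quot d J)"
    proof (intro equalityI subsetI)
      fix D assume "D \<in> ?\<phi> ` carrier (nc_quot d I)"
      then obtain C where "C \<in> carrier (nc_quot d I)" "D = ?\<phi> C" by blast
      then obtain f where f: "f \<in> carrier (nc_poly d)" "D = ?\<phi> (I +>\<^bsub>nc_poly d\<^esub> f)" using carI by blast
      show "D \<in> carrier (nc_quot d J)" unfolding f(2) image_coset nc_quot_carrier using car[OF f(1)] by blast
    next
      fix D assume "D \<in> carrier (nc_quot d J)"
      then obtain g where g: "g \<in> carrier (nc_poly d)" "D = J +>\<^bsub>nc_poly d\<^esub> g" unfolding nc_quot_carrier by blast
      have "D = ?\<phi> (I +>\<^bsub>nc_poly d\<^esub> subst_vars \<pi>' g)" unfolding image_coset subst_inverse g(2) ..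
      moreover have "I +>\<^bsub>nc_poly d\<^esub> subst_vars \<pi>' g \<in> carrier (nc_quot d I)"
        unfolding nc_quot_carrier using g(1) R.subst_carrier[of g] by blast
      ultimately show "D \<in> ?\<phi> ` carrier (nc_quot d I)" by (rule image_eqI)
    qed
  qed
  moreover have "?\<phi> (c \<odot>\<^bsub>nc_quot d I\<^esub> C) = c \<odot>\<^bsub>nc_quot d J\<^esub> ?\<phi> C" if C: "C \<in> carrier (nc_quot d I)" for c C
  proof -
    obtain f where f: "f \<in> carrier (nc_poly d)" "C = I +>\<^bsub>nc_poly d\<^esub> f" using carI[OF C] by blast
    show ?thesis
      unfolding f(2) image_coset coset_ops(3)[OF I f(1) f(1)] coset_ops(3)[OF J car[OF f(1)] car[OF f(1)]] subst_scale ..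
  qed
  moreover have "?\<phi> ` quot_component d I n = quot_component d J n" for n
  proof -
    have "?\<phi> ` quot_component d I n = (\<lambda>\<xi>. J +>\<^bsub>nc_poly d\<^esub> \<xi>) ` subst_vars \<pi> ` sps d I n"
      unfolding quot_component_eq[OF I] image_image image_coset ..
    then show ?thesis unfolding subst_image(1)[OF subst_sps] quot_component_eq[OF J] .
  qed
  ultimately show ?thesis by (simp add: graded_quot_iso_def alg_iso_def ring_iso_def del: nc_quot_simps)
qed

text \<open>Conjugation by the unitary between the Fock spaces that relabels the basis
  words.\<close>

definition conj_op :: "((nat list \<Rightarrow> complex) \<Rightarrow> nat list \<Rightarrow> complex) \<Rightarrow> (nat list \<Rightarrow> complex) \<Rightarrow> nat list \<Rightarrow> complex" where
  "conj_op T = (\<lambda>\<eta>\<in>fock d J. subst_vars \<pi> (T (subst_vars \<pi>' \<eta>)))"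

text \<open>The relabelling acts unitarily on every component of a vector, so it carries one unit
  ball onto the other and preserves the norms of the images.\<close>

lemma mat_op_norm_conj: "mat_op_norm (fock d J) n (\<lambda>i j. conj_op (a i j)) = mat_op_norm (fock d I) n a"
proof -
  interpret R: relabelling d J I \<pi>' by (rule reversed)
  have val: "l2_norm (\<lambda>w. \<Sum>j<n. conj_op (a i j) (\<eta> j) w) = l2_norm (\<lambda>w. \<Sum>j<n. a i j (subst_vars \<pi>' (\<eta> j)) w)"
    if "\<forall>j<n. \<eta> j \<in> fock d J" for \<eta> i
  proof -
    have "(\<lambda>w. \<Sum>j<n. conj_op (a i j) (\<eta> j) w) = subst_vars \<pi> (\<lambda>w. \<Sum>j<n. a i j (subst_vars \<pi>' (\<eta> j)) w)"
      unfolding subst_sum by (intro ext sum.cong refl) (use that in \<open>simp add: conj_op_def\<close>)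
    then show ?thesis by (simp only: l2_norm_subst)
  qed
  let ?S = "\<lambda>H. {\<xi>. (\<forall>j<n. \<xi> j \<in> H) \<and> (\<Sum>j<n. (l2_norm (\<xi> j))\<^sup>2) \<le> 1}"
  show ?thesis
  proof (rule antisym)
    show "mat_op_norm (fock d J) n (\<lambda>i j. conj_op (a i j)) \<le> mat_op_norm (fock d I) n a"
      unfolding mat_op_norm_def
    proof (rule SUP_mono)
      fix \<eta> assume \<eta>: "\<eta> \<in> ?S (fock d J)"
      then have "(\<lambda>j. subst_vars \<pi>' (\<eta> j)) \<in> ?S (fock d I)" by (simp add: R.subst_fock R.l2_norm_subst)
      then show "\<exists>\<xi>\<in>?S (fock d I). ennreal (sqrt (\<Sum>i<n. (l2_norm (\<lambda>w. \<Sum>j<n. conj_op (a i j) (\<eta> j) w))\<^sup>2))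
          \<le> ennreal (sqrt (\<Sum>i<n. (l2_norm (\<lambda>w. \<Sum>j<n. a i j (\<xi> j) w))\<^sup>2))"
        by (rule rev_bexI) (use \<eta> val in simp)
    qed
    show "mat_op_norm (fock d I) n a \<le> mat_op_norm (fock d J) n (\<lambda>i j. conj_op (a i j))"
      unfolding mat_op_norm_def
    proof (rule SUP_mono)
      fix \<xi> assume \<xi>: "\<xi> \<in> ?S (fock d I)"
      then have mem: "(\<lambda>j. subst_vars \<pi> (\<xi> j)) \<in> ?S (fock d J)" by (simp add: subst_fock l2_norm_subst)
      then show "\<exists>\<eta>\<in>?S (fock d J). ennreal (sqrt (\<Sum>i<n. (l2_norm (\<lambda>w. \<Sum>j<n. a i j (\<xi> j) w))\<^sup>2))
          \<le> ennreal (sqrt (\<Sum>i<n. (l2_norm (\<lambda>w. \<Sum>j<n. conj_op (a i j) (\<eta> j) w))\<^sup>2))"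
        by (rule rev_bexI) (use mem val[of "\<lambda>j. subst_vars \<pi> (\<xi> j)"] in \<open>simp add: subst_inverse\<close>)
    qed
  qed
qed

end

section \<open>The completely isometric isomorphism induced by a relabelling\<close>

locale pointed_relabelling = relabelling + X: tensor_lang d I + Y: tensor_lang d J
begin

lemma reversed_pointed: "pointed_relabelling d J I \<pi>'"
proof -
  interpret R: relabelling d J I \<pi>' by (rule reversed)
  show ?thesis by unfold_locales
qed

lemma nsq_subst: "nsq (Y.Lw M) (subst_vars \<pi> \<xi>) = nsq (X.Lw M) \<xi>"
proof -
  have "bij_betw (map \<pi>') (Y.Lw M) (X.Lw M)"
  proof (rule bij_betw_byWitness[where f' = "map \<pi>"])
    show "map \<pi>' ` Y.Lw M \<subseteq> X.Lw M" "map \<pi> ` X.Lw M \<subseteq> Y.Lw M"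
      unfolding X.Lw_def Y.Lw_def by (auto simp: allowable_map allowable_map' simp del: map_map)
  qed (auto simp del: map_map)
  from sum.reindex_bij_betw[OF this, of "\<lambda>w. (cmod (\<xi> w))\<^sup>2"] show ?thesis
    by (simp add: nsq_def subst_vars_def)
qed

lemma nb_subst:
  assumes "X.nb C a"
  shows "Y.nb C (subst_vars \<pi> a)"
proof -
  have "nsq (Y.Lw M) (nc_mult (subst_vars \<pi> a) \<xi>) \<le> C\<^sup>2 * nsq (Y.Lw M) \<xi>" for M \<xi>
  proof -
    have "nc_mult (subst_vars \<pi> a) \<xi> = subst_vars \<pi> (nc_mult a (subst_vars \<pi>' \<xi>))"
      unfolding subst_mult subst_inverse ..
    then have "nsq (Y.Lw M) (nc_mult (subst_vars \<pi> a) \<xi>) = nsq (X.Lw M) (nc_mult a (subst_vars \<pi>' \<xi>))"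
      by (simp only: nsq_subst)
    also have "\<dots> \<le> C\<^sup>2 * nsq (X.Lw M) (subst_vars \<pi>' \<xi>)" by (rule X.nb_bound[OF assms])
    also have "nsq (X.Lw M) (subst_vars \<pi>' \<xi>) = nsq (Y.Lw M) \<xi>"
      unfolding nsq_subst[symmetric] subst_inverse ..
    finally show ?thesis .
  qed
  then show ?thesis using X.nb_nonneg[OF assms] unfolding Y.nb_def by blast
qed

lemma alg_subst:
  assumes a: "a \<in> X.alg"
  shows "subst_vars \<pi> a \<in> Y.alg"
proof -
  have polys: "subst_vars \<pi> p \<in> Y.polys" if "p \<in> X.polys" for p
  proof -
    have "p \<in> carrier (nc_poly d)" "\<forall>w. p w \<noteq> 0 \<longrightarrow> w \<in> allowable d I"
      using that X.L_words by (auto simp: X.polys_def nc_poly_carrier)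
    then have "subst_vars \<pi> p \<in> carrier (nc_poly d)" "\<forall>w. subst_vars \<pi> p w \<noteq> 0 \<longrightarrow> w \<in> allowable d J"
      unfolding subst_carrier subst_support allowable_map' .
    then show ?thesis by (auto simp: Y.polys_def nc_poly_carrier)
  qed
  have "\<exists>q\<in>Y.polys. Y.nb \<epsilon> (\<lambda>w. subst_vars \<pi> a w - q w)" if e: "\<epsilon> > 0" for \<epsilon>
  proof -
    obtain p where p: "p \<in> X.polys" "X.nb \<epsilon> (\<lambda>w. a w - p w)" using X.alg_approx[OF a e] by blast
    from nb_subst[OF p(2)] have n: "Y.nb \<epsilon> (\<lambda>w. subst_vars \<pi> a w - subst_vars \<pi> p w)" unfolding subst_diff .
    show ?thesis by (rule bexI[where x = "subst_vars \<pi> p"]) (rule n, rule polys[OF p(1)])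
  qed
  moreover have "\<forall>w. subst_vars \<pi> a w \<noteq> 0 \<longrightarrow> w \<in> allowable d J"
    unfolding subst_support allowable_map' using X.algD[OF a] by blast
  ultimately show ?thesis by (simp add: Y.alg_def)
qed

lemma cv_subst: "subst_vars \<pi> (X.cv a b) = Y.cv (subst_vars \<pi> a) (subst_vars \<pi> b)"
proof
  fix w
  have "subst_vars \<pi> (X.cv a b) w = (if w \<in> allowable d J then subst_vars \<pi> (nc_mult a b) w else 0)"
    unfolding X.cv_def by (simp add: subst_vars_def allowable_map)
  then show "subst_vars \<pi> (X.cv a b) w = Y.cv (subst_vars \<pi> a) (subst_vars \<pi> b) w"
    unfolding subst_mult Y.cv_def .
qed

lemma conj_mult_op: "conj_op (X.mult_op a) = Y.mult_op (subst_vars \<pi> a)"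
proof
  interpret R: relabelling d J I \<pi>' by (rule reversed)
  fix \<eta>
  show "conj_op (X.mult_op a) \<eta> = Y.mult_op (subst_vars \<pi> a) \<eta>"
  proof (cases "\<eta> \<in> fock d J")
    case True
    then have "subst_vars \<pi>' \<eta> \<in> fock d I" unfolding R.subst_fock .
    then have "conj_op (X.mult_op a) \<eta> = subst_vars \<pi> (\<lambda>w. if w \<in> allowable d I then nc_mult a (subst_vars \<pi>' \<eta>) w else 0)"
      using True by (simp add: conj_op_def X.mult_op_def)
    also have "\<dots> = (\<lambda>w. if w \<in> allowable d J then subst_vars \<pi> (nc_mult a (subst_vars \<pi>' \<eta>)) w else 0)"
      unfolding subst_vars_def allowable_map ..
    finally show ?thesis using True unfolding subst_mult subst_inverse by (simp add: Y.mult_op_def)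
  next
    case False
    then show ?thesis by (simp add: conj_op_def Y.mult_op_def)
  qed
qed

lemma conj_iso: "conj_op \<in> completely_isometric_iso d I d J"
proof -
  interpret R: pointed_relabelling d J I \<pi>' by (rule reversed_pointed)
  have "conj_op \<in> Ring.ring_hom (tensor_algebra d I) (tensor_algebra d J)"
  proof (rule ring_hom_memI)
    fix S assume "S \<in> carrier (tensor_algebra d I)"
    then obtain a where a: "a \<in> X.alg" "S = X.mult_op a" unfolding X.tensor_algebra_carrier by blast
    show "conj_op S \<in> carrier (tensor_algebra d J)"
      unfolding a(2) conj_mult_op Y.tensor_algebra_carrier by (intro imageI alg_subst a(1))
    fix T assume "T \<in> carrier (tensor_algebra d I)"
    then obtain b where b: "b \<in> X.alg" "T = X.mult_op b" unfolding X.tensor_algebra_carrier by blast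
    show "conj_op (S \<otimes>\<^bsub>tensor_algebra d I\<^esub> T) = conj_op S \<otimes>\<^bsub>tensor_algebra d J\<^esub> conj_op T"
      unfolding a(2) b(2) tensor_algebra_simps X.mult_op_mult[OF b(1)] conj_mult_op Y.mult_op_mult[OF alg_subst[OF b(1)]] cv_subst ..
    show "conj_op (S \<oplus>\<^bsub>tensor_algebra d I\<^esub> T) = conj_op S \<oplus>\<^bsub>tensor_algebra d J\<^esub> conj_op T"
      unfolding a(2) b(2) tensor_algebra_simps X.mult_op_add conj_mult_op Y.mult_op_add subst_add ..
  next
    show "conj_op \<one>\<^bsub>tensor_algebra d I\<^esub> = \<one>\<^bsub>tensor_algebra d J\<^esub>"
      unfolding tensor_algebra_simps X.mult_op_one[symmetric] Y.mult_op_one[symmetric] conj_mult_op subst_unit ..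
  qed
  moreover have "bij_betw conj_op (carrier (tensor_algebra d I)) (carrier (tensor_algebra d J))"
    unfolding X.tensor_algebra_carrier Y.tensor_algebra_carrier
  proof (rule bij_betw_imageI)
    show "inj_on conj_op (X.mult_op ` X.alg)"
    proof (rule inj_onI)
      fix S T assume ST: "S \<in> X.mult_op ` X.alg" "T \<in> X.mult_op ` X.alg" "conj_op S = conj_op T"
      then obtain a b where ab: "a \<in> X.alg" "S = X.mult_op a" "b \<in> X.alg" "T = X.mult_op b" by blast
      have "Y.mult_op (subst_vars \<pi> a) (monom_word []) = Y.mult_op (subst_vars \<pi> b) (monom_word [])"
        using ST(3) unfolding ab(2,4) conj_mult_op by simp
      then have "subst_vars \<pi> a = subst_vars \<pi> b"
        unfolding Y.mult_op_unit[OF alg_subst[OF ab(1)]] Y.mult_op_unit[OF alg_subst[OF ab(3)]] .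
      then show "S = T" unfolding subst_inj ab(2,4) by simp
    qed
    show "conj_op ` X.mult_op ` X.alg = Y.mult_op ` Y.alg"
    proof (intro equalityI subsetI)
      fix T assume "T \<in> conj_op ` X.mult_op ` X.alg"
      then obtain a where "a \<in> X.alg" "T = conj_op (X.mult_op a)" by blast
      then show "T \<in> Y.mult_op ` Y.alg" using alg_subst unfolding conj_mult_op by blast
    next
      fix T assume "T \<in> Y.mult_op ` Y.alg"
      then obtain u where u: "u \<in> Y.alg" "T = Y.mult_op u" by blast
      have "T = conj_op (X.mult_op (subst_vars \<pi>' u))" unfolding conj_mult_op subst_inverse u(2) ..
      then show "T \<in> conj_op ` X.mult_op ` X.alg" using R.alg_subst[OF u(1)] by blast
    qed
  qed
  moreover have "conj_op (c \<odot>\<^bsub>tensor_algebra d I\<^esub> S) = c \<odot>\<^bsub>tensor_algebra d J\<^esub> conj_op S"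
    if S: "S \<in> carrier (tensor_algebra d I)" for c S
  proof -
    obtain a where a: "a \<in> X.alg" "S = X.mult_op a" using S unfolding X.tensor_algebra_carrier by blast
    show ?thesis unfolding a(2) tensor_algebra_simps X.mult_op_scale conj_mult_op Y.mult_op_scale subst_scale ..
  qed
  ultimately show ?thesis
    by (simp add: completely_isometric_iso_def alg_iso_def ring_iso_def mat_op_norm_conj)
qed

end

section \<open>The zero algebra and the equivalence of the conditions\<close>

lemma tensor_langI:
  assumes I: "monomial_ideal d I" and "\<forall>i<d. monom_word [i] \<notin> I" and "[] \<in> allowable d I"
  shows "tensor_lang d I"
proof unfold_locales
  show "allowable d I \<subseteq> words d" by (auto simp: allowable_def)
  show "v \<in> allowable d I" if "u @ v @ w \<in> allowable d I" for u v w by (rule allowable_factor[OF I that])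
  show "[i] \<in> allowable d I" if "i < d" for i using assms(2) that by (simp add: allowable_def)
qed (rule assms(3))

lemma allowable_Nil_iff:
  assumes I: "monomial_ideal d I"
  shows "[] \<notin> allowable d I \<longleftrightarrow> allowable d I = {}"
  using allowable_factor[OF I, of _ "[]" "[]"] by auto

text \<open>The empty word is a factor of every word, so excluding it would exclude every letter as
  well.\<close>

lemma no_letters:
  assumes "monomial_ideal d I" "\<forall>i<d. monom_word [i] \<notin> I" "[] \<notin> allowable d I"
  shows "d = 0"
proof (rule ccontr)
  assume "d \<noteq> 0"
  then have "[0] \<in> allowable d I" using assms(2) by (simp add: allowable_def)
  then show False using assms allowable_Nil_iff by blast
qed

lemma one_eq_zero_iff:
  assumes I: "monomial_ideal d I"
  shows "\<one>\<^bsub>bounded_ops (fock d I)\<^esub> = \<zero>\<^bsub>bounded_ops (fock d I)\<^esub> \<longleftrightarrow> [] \<notin> allowable d I"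
proof
  assume eq: "\<one>\<^bsub>bounded_ops (fock d I)\<^esub> = \<zero>\<^bsub>bounded_ops (fock d I)\<^esub>"
  show "[] \<notin> allowable d I"
  proof
    assume "[] \<in> allowable d I"
    from basis_vec_fock[OF this] have "basis_vec [] = (\<lambda>w. 0)"
      using fun_cong[OF eq, of "basis_vec []"] by (simp add: bounded_ops_simps)
    from fun_cong[OF this, of "[]"] show False by (simp add: basis_vec_def)
  qed
next
  assume "[] \<notin> allowable d I"
  then have "allowable d I = {}" using allowable_Nil_iff[OF I] by blast
  then have "\<xi> = (\<lambda>w. 0)" if "\<xi> \<in> fock d I" for \<xi> using that by (auto simp: fock_iff)
  then show "\<one>\<^bsub>bounded_ops (fock d I)\<^esub> = \<zero>\<^bsub>bounded_ops (fock d I)\<^esub>"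
    by (auto simp: bounded_ops_simps restrict_def)
qed

text \<open>One equals zero exactly if the empty word is not allowable, and an isomorphism preserves
  this. The zero algebra, which has no vacuum vector, is thereby separated from the main
  case.\<close>

lemma alg_iso_Nil:
  assumes I: "monomial_ideal d I" and J: "monomial_ideal d' J"
    and \<phi>: "\<phi> \<in> alg_iso (tensor_algebra d I) (tensor_algebra d' J)"
  shows "[] \<in> allowable d I \<longleftrightarrow> [] \<in> allowable d' J"
proof -
  let ?A = "tensor_algebra d I" and ?B = "tensor_algebra d' J"
  have hom: "\<phi> \<in> Ring.ring_hom ?A ?B" and inj: "inj_on \<phi> (carrier ?A)"
    and sc: "\<And>c a. a \<in> carrier ?A \<Longrightarrow> \<phi> (c \<odot>\<^bsub>?A\<^esub> a) = c \<odot>\<^bsub>?B\<^esub> \<phi> a"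
    using \<phi> by (auto simp: alg_iso_def ring_iso_def bij_betw_def)
  have one: "\<one>\<^bsub>?A\<^esub> \<in> carrier ?A" and zero: "0 \<odot>\<^bsub>?A\<^esub> \<one>\<^bsub>?A\<^esub> \<in> carrier ?A"
    by (auto simp: tensor_algebra_def closed_subalgebra_def)
  have z: "0 \<odot>\<^bsub>tensor_algebra e K\<^esub> \<one>\<^bsub>tensor_algebra e K\<^esub> = \<zero>\<^bsub>tensor_algebra e K\<^esub>" for e K
    by (auto simp: tensor_algebra_simps bounded_ops_simps)
  have \<phi>1: "\<phi> \<one>\<^bsub>?A\<^esub> = \<one>\<^bsub>?B\<^esub>" by (rule ring_hom_one[OF hom])
  have \<phi>0: "\<phi> \<zero>\<^bsub>?A\<^esub> = \<zero>\<^bsub>?B\<^esub>" using sc[OF one, of 0] unfolding z \<phi>1 .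
  have "\<one>\<^bsub>?A\<^esub> = \<zero>\<^bsub>?A\<^esub> \<longleftrightarrow> \<one>\<^bsub>?B\<^esub> = \<zero>\<^bsub>?B\<^esub>"
    using inj_on_eq_iff[OF inj one zero] unfolding z \<phi>1 \<phi>0 by simp
  then show ?thesis using one_eq_zero_iff[OF I] one_eq_zero_iff[OF J] by (simp add: tensor_algebra_simps)
qed

lemma alg_iso_dominates:
  assumes I: "monomial_ideal d I" "\<forall>i<d. monom_word [i] \<notin> I"
    and J: "monomial_ideal d' J" "\<forall>j<d'. monom_word [j] \<notin> J"
    and \<phi>: "\<phi> \<in> alg_iso (tensor_algebra d I) (tensor_algebra d' J)"
  shows "word_dominates d (allowable d I) d' (allowable d' J) \<and> word_dominates d' (allowable d' J) d (allowable d I)"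
proof (cases "[] \<in> allowable d I")
  case True
  then have "[] \<in> allowable d' J" using alg_iso_Nil[OF I(1) J(1) \<phi>] by simp
  then obtain f g where "alg_equiv d (allowable d I) d' (allowable d' J) f g"
    using alg_iso_alg_equiv[OF tensor_langI[OF I True] tensor_langI[OF J] \<phi>] by blast
  then show ?thesis using alg_equiv.dominates alg_equiv.reversed by blast
next
  case False
  then have "[] \<notin> allowable d' J" using alg_iso_Nil[OF I(1) J(1) \<phi>] by simp
  \<comment> \<open>Both algebras are zero: the alphabets and the languages are empty, and
    domination holds vacuously.\<close>
  then have "d = 0" "d' = 0" "allowable d I = {}" "allowable d' J = {}"
    using no_letters[OF I False] no_letters[OF J] allowable_Nil_iff[OF I(1)] allowable_Nil_iff[OF J(1)] False by blast+
  then show ?thesis by (simp add: word_dominates_def)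
qed

lemma completely_isometric_refl: "completely_isometric_iso d I d I \<noteq> {}"
proof -
  have "(\<lambda>T. T) \<in> completely_isometric_iso d I d I"
    by (auto simp: completely_isometric_iso_def alg_iso_def ring_iso_def bij_betw_def intro!: ring_hom_memI)
  then show ?thesis by blast
qed

theorem theorem9p2:
  fixes d d' :: nat and I J :: "(nat list \<Rightarrow> complex) set"
  assumes "monomial_ideal d I" and "monomial_ideal d' J"
    and "\<forall>i<d. monom_word [i] \<notin> I" and "\<forall>j<d'. monom_word [j] \<notin> J"
  shows "(completely_isometric_iso d I d' J \<noteq> {} \<longleftrightarrow>
          alg_iso (tensor_algebra d I) (tensor_algebra d' J) \<noteq> {}) \<and>
         (alg_iso (tensor_algebra d I) (tensor_algebra d' J) \<noteq> {} \<longleftrightarrow>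
          graded_quot_iso d I d' J \<noteq> {}) \<and>
         (graded_quot_iso d I d' J \<noteq> {} \<longleftrightarrow> sps_similar d I d' J) \<and>
         (sps_similar d I d' J \<longleftrightarrow> sps_isomorphic d I d' J) \<and>
         (sps_isomorphic d I d' J \<longleftrightarrow>
          d = d' \<and> (\<exists>\<pi>. \<pi> permutes {..<d} \<and> subst_vars \<pi> ` I = J))"
proof -
  note hI = assms(1,3) and hJ = assms(2,4)
  let ?vi = "d = d' \<and> (\<exists>\<pi>. \<pi> permutes {..<d} \<and> subst_vars \<pi> ` I = J)"
  have sub: "allowable d I \<subseteq> words d" "allowable d' J \<subseteq> words d'" by (auto simp: allowable_def)
  have dom: "?vi" if dominates: "word_dominates d (allowable d I) d' (allowable d' J)" "word_dominates d' (allowable d' J) d (allowable d I)"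
  proof -
    obtain \<pi> where \<pi>: "d = d'" "\<pi> permutes {..<d}" "\<forall>\<mu>\<in>words d. \<mu> \<in> allowable d I \<longleftrightarrow> map \<pi> \<mu> \<in> allowable d' J"
      using word_dominates_permutation[OF dominates sub] by blast
    interpret relabelling d I J \<pi>
      by unfold_locales (use \<pi> hI hJ in simp_all)
    show ?thesis using image_ideal \<pi> by blast
  qed
  have graded: "?vi" if "graded_iso d I d' J V" for V
    using dom graded_iso_dominates[OF hI(1) hJ(1) hI(2) hJ(2) that]
      graded_iso_dominates[OF hJ(1) hI(1) hJ(2) hI(2) graded_iso_inverse[OF that]] by blast
  have i_ii: "alg_iso (tensor_algebra d I) (tensor_algebra d' J) \<noteq> {}" if "completely_isometric_iso d I d' J \<noteq> {}"
    using that by (auto simp: completely_isometric_iso_def)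
  have ii_vi: "?vi" if ii: "alg_iso (tensor_algebra d I) (tensor_algebra d' J) \<noteq> {}"
  proof -
    obtain \<phi> where "\<phi> \<in> alg_iso (tensor_algebra d I) (tensor_algebra d' J)" using ii by blast
    from alg_iso_dominates[OF hI hJ this] show ?thesis using dom by blast
  qed
  have iii_vi: "?vi" if iii: "graded_quot_iso d I d' J \<noteq> {}"
  proof -
    obtain \<phi> where "\<phi> \<in> graded_quot_iso d I d' J" using iii by blast
    from graded_quot_iso_graded_iso[OF hI(1) hJ(1) this] show ?thesis using graded by blast
  qed
  have iv_vi: "?vi" if sim: "sps_similar d I d' J"
  proof -
    obtain V where V: "sps_similarity d I d' J V" using sim unfolding sps_similar_def by blast
    have "graded_iso d I d' J V" unfolding graded_iso_def using V unfolding sps_similarity_def by blast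
    then show ?thesis by (rule graded)
  qed
  have v_iv: "sps_similar d I d' J" if "sps_isomorphic d I d' J"
    using that unfolding sps_isomorphic_def sps_similar_def by blast
  have vi: "completely_isometric_iso d I d' J \<noteq> {} \<and> graded_quot_iso d I d' J \<noteq> {} \<and> sps_isomorphic d I d' J" if perm': ?vi
  proof -
    obtain \<pi> where d: "d = d'" and \<pi>: "\<pi> permutes {..<d}" "subst_vars \<pi> ` I = J" using perm' by blast
    have J': "monomial_ideal d J" "\<forall>i<d. monom_word [i] \<notin> J" using hJ unfolding d .
    have inj: "inj (subst_vars \<pi>)"
    proof (rule injI)
      fix f g assume eq: "subst_vars \<pi> f = subst_vars \<pi> g"
      have "f w = g w" for w
        using fun_cong[OF eq, of "map \<pi> w"] permutes_inverses(2)[OF \<pi>(1)] by (simp add: subst_vars_def o_def)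
      then show "f = g" by blast
    qed
    interpret relabelling d I J \<pi>
    proof unfold_locales
      fix \<mu> assume \<mu>: "\<mu> \<in> words d"
      then have m: "map \<pi> \<mu> \<in> words d" using permutes_in_image[OF \<pi>(1)] by (auto simp: words_def lists_eq_set)
      have "monom_word (map \<pi> \<mu>) \<in> J \<longleftrightarrow> subst_vars \<pi> (monom_word \<mu>) \<in> subst_vars \<pi> ` I"
        unfolding \<pi>(2) subst_vars_monom_word[OF permutes_bij[OF \<pi>(1)]] ..
      also have "\<dots> \<longleftrightarrow> monom_word \<mu> \<in> I" by (rule inj_image_mem_iff[OF inj])
      finally show "\<mu> \<in> allowable d I \<longleftrightarrow> map \<pi> \<mu> \<in> allowable d J" using \<mu> m by (simp add: allowable_def)
    qed (rule hI(1) J'(1) \<pi>(1))+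
    have "completely_isometric_iso d I d J \<noteq> {}"
    proof (cases "[] \<in> allowable d I")
      case True
      then have "[] \<in> allowable d J" using allowable_map[of "[]"] by simp
      interpret X: tensor_lang d I by (rule tensor_langI[OF hI True])
      interpret Y: tensor_lang d J by (rule tensor_langI[OF J' \<open>[] \<in> allowable d J\<close>])
      interpret pointed_relabelling d I J \<pi> by unfold_locales
      show ?thesis using conj_iso by blast
    next
      case False
      \<comment> \<open>With an empty alphabet the permutation is the identity, the ideals coincide
        and the identity map is the isomorphism sought.\<close>
      then have "d = 0" by (rule no_letters[OF hI])
      then have "\<pi> = id" using \<pi>(1) by simp
      then have "J = I" using \<pi>(2) by (simp add: subst_vars_def)
      then show ?thesis using completely_isometric_refl by simp
    qed
    then show ?thesis using graded_quot_iso sps_isomorphic unfolding d by blast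
  qed
  show ?thesis using i_ii ii_vi iii_vi iv_vi v_iv vi by blast
qed

end
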